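(* Let $(M^m,g)$ be a compact, orientable Riemannian manifold without boundary of dimension $m$, and let $\alpha$ be a positive constant such that $2\alpha\ge m+3$. Then $M$ is ($\alpha$-)stable. Moreover, for $\alpha=(m+3)/2$, a smooth vector field $V$ on $M$ is Killing if and only if $I_{\alpha,\mathrm{id}}(V,V)=0$.
   Context: A smooth vector field $V$ on $(M,g)$ is Killing if $\mathcal L_Vg=0$. For a smooth map $\psi:(M,g)\to(N,h)$ the $\alpha$-energy is $E_\alpha(\psi)=\int_M(1+|d\psi|^2)^\alpha\,dV_g$, with $|d\psi|^2$ the squared Hilbert-Schmidt norm, and $\psi$ is $\alpha$-harmonic if it is a critical point of $E_\alpha$; the identity map $\mathrm{id}:(M,g)\to(M,g)$ is $\alpha$-harmonic. For an $\alpha$-harmonic $\psi$ and vector fields $\upsilon,\omega$ along $\psi$, let $I_{\alpha,\psi}(\upsilon,\omega)=\frac{\partial^2}{\partial t\,\partial s}E_\alpha(\psi_{t,s})\big|_{s=t=0}$, where $\psi_{t,s}$ is a smooth 2-parameter variation of $\psi=\psi_{0,0}$ with $\frac{\partial\psi_{t,s}}{\partial t}|_{0,0}=\upsilon$, $\frac{\partial\psi_{t,s}}{\partial s}|_{0,0}=\omega$. The map $\psi$ is $\alpha$-stable if $I_{\alpha,\psi}(\omega,\omega)\ge0$ for every vector field $\omega$ along $\psi$. The manifold $(M,g)$ is $\alpha$-stable (stable) if $\mathrm{id}:(M,g)\to(M,g)$ is $\alpha$-stable. *)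

theory Defs
  imports "HOL-Analysis.Analysis"
begin

text \<open>
  A manifold is a Hausdorff, second countable type together with a smooth atlas; a chart is a
  pair (domain, coordinate map).  Vectors and tensors are given classically, by their components in
  every chart of the atlas, subject to the transformation law on overlaps.  Components
  outside the domain of the respective chart are irrelevant and left unconstrained.
\<close>

section \<open>Smooth manifolds\<close>

text \<open>Both notions below are intended for open sets \<open>S\<close>.\<close>

primrec Ck_on :: "nat \<Rightarrow> ('e::euclidean_space \<Rightarrow> 'f::real_normed_vector) \<Rightarrow> 'e set \<Rightarrow> bool" where
  "Ck_on 0 f S \<longleftrightarrow> continuous_on S f"
| "Ck_on (Suc k) f S \<longleftrightarrow>
     (\<forall>x\<in>S. f differentiable (at x)) \<and> (\<forall>v. Ck_on k (\<lambda>x. frechet_derivative f (at x) v) S)"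

definition smooth_on :: "('e::euclidean_space \<Rightarrow> 'f::real_normed_vector) \<Rightarrow> 'e set \<Rightarrow> bool" where
  "smooth_on f S \<longleftrightarrow> (\<forall>k. Ck_on k f S)"

type_synonym ('a, 'e) chart = "'a set \<times> ('a \<Rightarrow> 'e)"

definition chart_inv :: "('a, 'e) chart \<Rightarrow> 'e \<Rightarrow> 'a" where
  "chart_inv c = inv_into (fst c) (snd c)"

definition transition :: "('a, 'e) chart \<Rightarrow> ('a, 'e) chart \<Rightarrow> 'e \<Rightarrow> 'e" where
  "transition c d = snd d \<circ> chart_inv c"

definition smooth_atlas ::
  "('a::{t2_space, second_countable_topology}, 'e::euclidean_space) chart set \<Rightarrow> bool" where
  "smooth_atlas A \<longleftrightarrow>
     (\<Union>c\<in>A. fst c) = UNIV \<and>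
     (\<forall>c\<in>A. open (fst c) \<and> open (snd c ` fst c) \<and>
        homeomorphism (fst c) (snd c ` fst c) (snd c) (chart_inv c)) \<and>
     (\<forall>c\<in>A. \<forall>d\<in>A. smooth_on (transition c d) (snd c ` (fst c \<inter> fst d)))"

definition jacobian_transition ::
  "('a, real^'m) chart \<Rightarrow> ('a, real^'m) chart \<Rightarrow> 'a \<Rightarrow> real^'m^'m" where
  "jacobian_transition c d p = matrix (frechet_derivative (transition c d) (at (snd c p)))"

text \<open>The atlas \<open>A\<close> need not be maximal, so the oriented atlas is only required to define the same
  smooth structure.\<close>

definition orientable ::
  "('a::{t2_space, second_countable_topology}, real^'m) chart set \<Rightarrow> bool" where
  "orientable A \<longleftrightarrow>
     (\<exists>B. smooth_atlas B \<and> smooth_atlas (A \<union> B) \<and>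
        (\<forall>c\<in>B. \<forall>d\<in>B. \<forall>p \<in> fst c \<inter> fst d. det (jacobian_transition c d p) > 0))"

definition smooth_map_on ::
  "('a::topological_space, 'e::euclidean_space) chart set \<Rightarrow>
   ('b::topological_space, 'f::euclidean_space) chart set \<Rightarrow> 'a set \<Rightarrow> ('a \<Rightarrow> 'b) \<Rightarrow> bool" where
  "smooth_map_on A B S f \<longleftrightarrow>
     continuous_on S f \<and>
     (\<forall>c\<in>A. \<forall>d\<in>B.
        smooth_on (snd d \<circ> f \<circ> chart_inv c) (snd c ` (fst c \<inter> S \<inter> f -` fst d)))"

text \<open>The atlas of the product of a manifold with a Euclidean parameter space.\<close>

definition product_atlas :: "('a, 'e) chart set \<Rightarrow> ('a \<times> 'p, 'e \<times> 'p) chart set" where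
  "product_atlas A = (\<lambda>c. (fst c \<times> UNIV, map_prod (snd c) id)) ` A"

text \<open>A smooth vector field along \<open>\<psi>\<close>: \<open>\<omega> d p\<close> are the components, in the chart \<open>d\<close> of the target,
  of a tangent vector at \<open>\<psi> p\<close>.\<close>

definition vector_field_along ::
  "('a::topological_space, 'e::euclidean_space) chart set \<Rightarrow>
   ('b::topological_space, 'f::euclidean_space) chart set \<Rightarrow> ('a \<Rightarrow> 'b) \<Rightarrow>
   (('b, 'f) chart \<Rightarrow> 'a \<Rightarrow> 'f) \<Rightarrow> bool" where
  "vector_field_along A B \<psi> \<omega> \<longleftrightarrow>
     (\<forall>d\<in>B. \<forall>d'\<in>B. \<forall>p. \<psi> p \<in> fst d \<inter> fst d' \<longrightarrow>
        \<omega> d' p = frechet_derivative (transition d d') (at (snd d (\<psi> p))) (\<omega> d p)) \<and>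
     (\<forall>c\<in>A. \<forall>d\<in>B. smooth_on (\<omega> d \<circ> chart_inv c) (snd c ` (fst c \<inter> \<psi> -` fst d)))"

abbreviation vector_field ::
  "('a::topological_space, 'e::euclidean_space) chart set \<Rightarrow> (('a, 'e) chart \<Rightarrow> 'a \<Rightarrow> 'e) \<Rightarrow> bool" where
  "vector_field A \<equiv> vector_field_along A A id"


section \<open>Riemannian metrics\<close>

type_synonym ('a, 'm) metric_components = "('a, real^'m) chart \<Rightarrow> 'a \<Rightarrow> real^'m^'m"

definition riemannian_metric ::
  "('a::topological_space, real^'m) chart set \<Rightarrow> ('a, 'm) metric_components \<Rightarrow> bool" where
  "riemannian_metric A g \<longleftrightarrow>
     (\<forall>c\<in>A. \<forall>p \<in> fst c. transpose (g c p) = g c p \<and> (\<forall>v. v \<noteq> 0 \<longrightarrow> v \<bullet> (g c p *v v) > 0)) \<and>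
     (\<forall>c\<in>A. \<forall>d\<in>A. \<forall>p \<in> fst c \<inter> fst d.
        g c p = transpose (jacobian_transition c d p) ** g d p ** jacobian_transition c d p) \<and>
     (\<forall>c\<in>A. smooth_on (g c \<circ> chart_inv c) (snd c ` fst c))"

definition riemannian_manifold ::
  "('a::{t2_space, second_countable_topology}, real^'m) chart set \<Rightarrow>
   ('a, 'm) metric_components \<Rightarrow> bool" where
  "riemannian_manifold A g \<longleftrightarrow> smooth_atlas A \<and> riemannian_metric A g"

text \<open>The Riemannian measure \<open>dV\<^sub>g\<close>: the unique Borel measure which in every chart has the density
  \<open>sqrt (det g)\<close> with respect to Lebesgue measure.\<close>

definition riemannian_volume ::
  "('a::topological_space, real^'m) chart set \<Rightarrow> ('a, 'm) metric_components \<Rightarrow> 'a measure" where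
  "riemannian_volume A g =
     (THE \<mu>. sets \<mu> = sets borel \<and>
        (\<forall>c\<in>A. \<forall>E\<in>sets borel. E \<subseteq> fst c \<longrightarrow>
           emeasure \<mu> E =
             (\<integral>\<^sup>+ y \<in> snd c ` E. ennreal (sqrt (det (g c (chart_inv c y)))) \<partial>lborel)))"

text \<open>The components \<open>V\<^sup>k \<partial>\<^sub>k g\<^sub>i\<^sub>j + g\<^sub>k\<^sub>j \<partial>\<^sub>i V\<^sup>k + g\<^sub>i\<^sub>k \<partial>\<^sub>j V\<^sup>k\<close> of the Lie derivative of \<open>g\<close> along \<open>V\<close>.\<close>

definition lie_derivative_metric ::
  "('a, 'm) metric_components \<Rightarrow> (('a, real^'m) chart \<Rightarrow> 'a \<Rightarrow> real^'m) \<Rightarrow>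
   ('a, 'm) metric_components" where
  "lie_derivative_metric g V c p =
     (let x = snd c p;
          DV = matrix (frechet_derivative (V c \<circ> chart_inv c) (at x))
      in frechet_derivative (g c \<circ> chart_inv c) (at x) (V c p)
           + transpose DV ** g c p + g c p ** DV)"

definition killing ::
  "('a::topological_space, real^'m) chart set \<Rightarrow> ('a, 'm) metric_components \<Rightarrow>
   (('a, real^'m) chart \<Rightarrow> 'a \<Rightarrow> real^'m) \<Rightarrow> bool" where
  "killing A g V \<longleftrightarrow>
     vector_field A V \<and> (\<forall>c\<in>A. \<forall>p \<in> fst c. lie_derivative_metric g V c p = 0)"


section \<open>The \<open>\<alpha>\<close>-energy and its variations\<close>

text \<open>The squared Hilbert-Schmidt norm \<open>tr (L\<^sup>* L)\<close> of a linear map \<open>L\<close> between the inner product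
  spaces with Gram matrices \<open>G\<close> and \<open>H\<close>; the adjoint is \<open>L\<^sup>* = G\<^sup>-\<^sup>1 L\<^sup>T H\<close>.\<close>

definition hilbert_schmidt_sq :: "real^'m^'m \<Rightarrow> real^'n^'n \<Rightarrow> real^'m^'n \<Rightarrow> real" where
  "hilbert_schmidt_sq G H L = trace ((matrix_inv G ** transpose L ** H) ** L)"

definition chart_at :: "('a, 'e) chart set \<Rightarrow> 'a \<Rightarrow> ('a, 'e) chart" where
  "chart_at A p = (SOME c. c \<in> A \<and> p \<in> fst c)"

text \<open>\<open>|d\<psi>|\<^sup>2\<close> at \<open>p\<close>; the value does not depend on the charts chosen around \<open>p\<close> and \<open>\<psi> p\<close>.\<close>

definition norm_sq_differential ::
  "('a::topological_space, real^'m) chart set \<Rightarrow> ('a, 'm) metric_components \<Rightarrow>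
   ('b::topological_space, real^'n) chart set \<Rightarrow> ('b, 'n) metric_components \<Rightarrow>
   ('a \<Rightarrow> 'b) \<Rightarrow> 'a \<Rightarrow> real" where
  "norm_sq_differential A g B h \<psi> p =
     (let c = chart_at A p; d = chart_at B (\<psi> p)
      in hilbert_schmidt_sq (g c p) (h d (\<psi> p))
           (matrix (frechet_derivative (snd d \<circ> \<psi> \<circ> chart_inv c) (at (snd c p)))))"

definition alpha_energy ::
  "real \<Rightarrow> ('a::topological_space, real^'m) chart set \<Rightarrow> ('a, 'm) metric_components \<Rightarrow>
   ('b::topological_space, real^'n) chart set \<Rightarrow> ('b, 'n) metric_components \<Rightarrow>
   ('a \<Rightarrow> 'b) \<Rightarrow> real" where
  "alpha_energy \<alpha> A g B h \<psi> =
     (LINT p | riemannian_volume A g. (1 + norm_sq_differential A g B h \<psi> p) powr \<alpha>)"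

text \<open>Variations with parameters in a neighbourhood of \<open>0\<close> in \<open>'p\<close>, jointly smooth in the point
  and the parameters.\<close>

definition smooth_variation ::
  "('a::topological_space, 'e::euclidean_space) chart set \<Rightarrow>
   ('b::topological_space, 'f::euclidean_space) chart set \<Rightarrow> ('a \<Rightarrow> 'b) \<Rightarrow>
   ('p::euclidean_space \<Rightarrow> 'a \<Rightarrow> 'b) \<Rightarrow> bool" where
  "smooth_variation A B \<psi> \<Psi> \<longleftrightarrow>
     \<Psi> 0 = \<psi> \<and>
     (\<exists>\<epsilon>>0. smooth_map_on (product_atlas A) B (UNIV \<times> ball 0 \<epsilon>) (\<lambda>(p, \<tau>). \<Psi> \<tau> p))"

text \<open>The field \<open>\<omega>\<close> along \<open>\<psi> = \<Psi> 0\<close> is the velocity at \<open>t = 0\<close> of the one-parameter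
  variation \<open>\<Psi>\<close>.\<close>

definition variation_field ::
  "('b::topological_space, 'f::euclidean_space) chart set \<Rightarrow> (real \<Rightarrow> 'a \<Rightarrow> 'b) \<Rightarrow>
   (('b, 'f) chart \<Rightarrow> 'a \<Rightarrow> 'f) \<Rightarrow> bool" where
  "variation_field B \<Psi> \<omega> \<longleftrightarrow>
     (\<forall>d\<in>B. \<forall>p. \<Psi> 0 p \<in> fst d \<longrightarrow>
        ((\<lambda>t. snd d (\<Psi> t p)) has_vector_derivative \<omega> d p) (at 0))"

text \<open>Intended for a compact domain manifold, so that variations need no support condition.\<close>

definition alpha_harmonic ::
  "real \<Rightarrow> ('a::topological_space, real^'m) chart set \<Rightarrow> ('a, 'm) metric_components \<Rightarrow>
   ('b::topological_space, real^'n) chart set \<Rightarrow> ('b, 'n) metric_components \<Rightarrow>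
   ('a \<Rightarrow> 'b) \<Rightarrow> bool" where
  "alpha_harmonic \<alpha> A g B h \<psi> \<longleftrightarrow>
     smooth_map_on A B UNIV \<psi> \<and>
     (\<forall>\<Psi> :: real \<Rightarrow> 'a \<Rightarrow> 'b. smooth_variation A B \<psi> \<Psi> \<longrightarrow>
        ((\<lambda>t. alpha_energy \<alpha> A g B h (\<Psi> t)) has_real_derivative 0) (at 0))"

text \<open>For \<open>\<alpha>\<close>-harmonic \<open>\<psi>\<close> the second derivative depends on the variation only through the two
  fields \<open>\<upsilon>\<close> and \<open>\<omega>\<close>.\<close>

definition second_variation ::
  "real \<Rightarrow> ('a::topological_space, real^'m) chart set \<Rightarrow> ('a, 'm) metric_components \<Rightarrow>
   ('b::topological_space, real^'n) chart set \<Rightarrow> ('b, 'n) metric_components \<Rightarrow> ('a \<Rightarrow> 'b) \<Rightarrow>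
   (('b, real^'n) chart \<Rightarrow> 'a \<Rightarrow> real^'n) \<Rightarrow> (('b, real^'n) chart \<Rightarrow> 'a \<Rightarrow> real^'n) \<Rightarrow> real" where
  "second_variation \<alpha> A g B h \<psi> \<upsilon> \<omega> =
     (THE I. \<exists>\<Psi> :: real \<times> real \<Rightarrow> 'a \<Rightarrow> 'b.
        smooth_variation A B \<psi> \<Psi> \<and>
        variation_field B (\<lambda>t. \<Psi> (t, 0)) \<upsilon> \<and>
        variation_field B (\<lambda>s. \<Psi> (0, s)) \<omega> \<and>
        I = deriv (\<lambda>t. deriv (\<lambda>s. alpha_energy \<alpha> A g B h (\<Psi> (t, s))) 0) 0)"

definition alpha_stable_map ::
  "real \<Rightarrow> ('a::topological_space, real^'m) chart set \<Rightarrow> ('a, 'm) metric_components \<Rightarrow>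
   ('b::topological_space, real^'n) chart set \<Rightarrow> ('b, 'n) metric_components \<Rightarrow>
   ('a \<Rightarrow> 'b) \<Rightarrow> bool" where
  "alpha_stable_map \<alpha> A g B h \<psi> \<longleftrightarrow>
     alpha_harmonic \<alpha> A g B h \<psi> \<and>
     (\<forall>\<omega>. vector_field_along A B \<psi> \<omega> \<longrightarrow> second_variation \<alpha> A g B h \<psi> \<omega> \<omega> \<ge> 0)"

definition alpha_stable ::
  "real \<Rightarrow> ('a::topological_space, real^'m) chart set \<Rightarrow> ('a, 'm) metric_components \<Rightarrow> bool" where
  "alpha_stable \<alpha> A g \<longleftrightarrow> alpha_stable_map \<alpha> A g A g id"

end

theory Submission
  imports Defs
begin

text \<open>
  For a variation \<open>\<psi>\<^sub>\<tau>\<close> of the identity let \<open>S(\<tau>)\<close> be the endomorphism \<open>g\<^sup>-\<^sup>1 \<psi>\<^sub>\<tau>\<^sup>* g\<close> of the tangent spaces, so that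
  \<open>S(0) = I\<close>, \<open>|d\<psi>\<^sub>\<tau>|\<^sup>2 = tr S(\<tau>)\<close> and the volume distortion of \<open>\<psi>\<^sub>\<tau>\<close> is \<open>\<surd>(det S(\<tau>))\<close>.  For small \<open>\<tau>\<close> the map \<open>\<psi>\<^sub>\<tau>\<close>
  preserves the total volume (by the change of variables formula on finitely many coordinate balls, where \<open>\<psi>\<^sub>\<tau>\<close> is
  injective and, by Brouwer's theorem, covers slightly smaller balls), so \<open>\<integral> \<surd>(det S(\<tau>))\<close> is constant and its second derivative at \<open>0\<close> vanishes.  Subtracting
  the right multiple of it from the second derivative of \<open>\<integral> (1 + tr S)\<^sup>\<alpha>\<close> eliminates the second derivatives of \<open>S\<close> and
  leaves, with \<open>X = g\<^sup>-\<^sup>1 L\<^sub>V g\<close>,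
  \<open>I(V, V) = \<alpha> (1 + m)\<^bsup>\<alpha> - 1\<^esup> \<integral> tr (X\<^sup>2) + ((\<alpha> - 1) / (1 + m) - 1/2) (tr X)\<^sup>2\<close>.
  The coefficient of \<open>(tr X)\<^sup>2\<close> is nonnegative iff \<open>2 \<alpha> \<ge> m + 3\<close>, and \<open>tr (X\<^sup>2)\<close> is the squared norm of \<open>L\<^sub>V g\<close>.
  No curvature is needed.  Variations with a given velocity are obtained without flows, by composing perturbations in
  single charts, cut off by a partition of unity.
\<close>

section \<open>Functions of class \<open>C\<^sup>k\<close>\<close>

text \<open>The subtracted multiple is dictated by first order. At the identity \<open>tr S\<close>
  has derivative \<open>tr S'\<close> and \<open>sqrt (det S)\<close> has derivative
  \<open>tr S' / 2\<close>, so the first derivatives of the two densities are proportional, with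
  factor \<open>2 * \<alpha> * (1 + m) powr (\<alpha> - 1)\<close>. Conservation of volume therefore
  already makes the identity harmonic, and the factor acts as a Lagrange multiplier at second order:
  it takes the place of an integration by parts.

  Two objects are definite descriptions. For the Riemannian measure, existence and uniqueness come
  from a finite Borel partition whose pieces lie in charts. For the second variation, uniqueness
  holds because the final integrand mentions \<open>V\<close> alone, and existence is the reason for
  constructing a variation with velocity \<open>V\<close>.

  In the equality case a nonnegative integrand has integral 0 and has to vanish at every point. This
  takes continuity, which is not visible in the formula, since \<open>chart_at\<close> chooses a
  chart at each point arbitrarily; it is inherited from the form of the integrand as second
  derivatives of the densities.\<close>

lemma Ck_on_subset:
  assumes "Ck_on k f S" "T \<subseteq> S"
  shows "Ck_on k f T"
  using assms(1)
proof (induction k arbitrary: f)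
  case 0
  then show ?case using assms(2) by (auto intro: continuous_on_subset)
next
  case (Suc k)
  then show ?case using assms(2) unfolding Ck_on.simps by blast
qed

lemma Ck_on_imp_continuous_on: "Ck_on k f S \<Longrightarrow> continuous_on S f"
  by (cases k) (simp_all add: continuous_at_imp_continuous_on differentiable_imp_continuous_within)

lemma Ck_on_SucD: "Ck_on (Suc k) f S \<Longrightarrow> Ck_on k f S"
proof (induction k arbitrary: f)
  case 0
  then show ?case using Ck_on_imp_continuous_on[OF 0] by simp
next
  case (Suc k)
  have "Ck_on k (\<lambda>x. frechet_derivative f (at x) v) S" for v
    using Suc.prems by (intro Suc.IH) simp
  then show ?case using Suc.prems by simp
qed

lemma Ck_on_mono:
  assumes "Ck_on k f S" "j \<le> k"
  shows "Ck_on j f S"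
  using assms(2,1) by (induction rule: inc_induct) (auto intro: Ck_on_SucD simp del: Ck_on.simps)

lemma Ck_on_cong:
  assumes "open S" "\<And>x. x \<in> S \<Longrightarrow> f x = g x" "Ck_on k f S"
  shows "Ck_on k g S"
  using assms(2,3)
proof (induction k arbitrary: f g)
  case 0
  then show ?case using continuous_on_cong[of S S f g] by simp
next
  case (Suc k)
  have d: "(g has_derivative frechet_derivative f (at x)) (at x)" if "x \<in> S" for x
    using that Suc.prems assms(1)
    by (intro has_derivative_transform_within_open[of f _ x UNIV S g])
      (auto simp: frechet_derivative_works[symmetric])
  then have fd: "frechet_derivative g (at x) = frechet_derivative f (at x)" if "x \<in> S" for x
    using frechet_derivative_at that by metis
  have "Ck_on k (\<lambda>x. frechet_derivative g (at x) v) S" for v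
    by (rule Suc.IH[of "\<lambda>x. frechet_derivative f (at x) v"]) (use fd Suc.prems in auto)
  then show ?case using d by (auto simp: differentiable_def)
qed

text \<open>The definition of \<open>Ck_on\<close> speaks of the chosen
  \<open>frechet_derivative\<close>; by uniqueness of derivatives any explicit formula for the
  derivative may be used instead.\<close>

lemma Ck_on_SucI:
  assumes "open S" "\<And>x. x \<in> S \<Longrightarrow> (f has_derivative f' x) (at x)" "\<And>v. Ck_on k (\<lambda>x. f' x v) S"
  shows "Ck_on (Suc k) f S"
proof -
  have "frechet_derivative f (at x) = f' x" if "x \<in> S" for x
    using frechet_derivative_at[OF assms(2)[OF that]] by simp
  then have "Ck_on k (\<lambda>x. frechet_derivative f (at x) v) S" for v
    by (intro Ck_on_cong[OF assms(1) _ assms(3)[of v]]) auto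
  then show ?thesis using assms(2) by (auto simp: differentiable_def)
qed

lemma Ck_on_locally:
  assumes "\<And>x. x \<in> S \<Longrightarrow> \<exists>T. open T \<and> x \<in> T \<and> Ck_on k f T"
  shows "Ck_on k f S"
  using assms
proof (induction k arbitrary: f)
  case 0
  then show ?case
    by (meson Ck_on.simps(1) continuous_at_imp_continuous_on continuous_on_eq_continuous_at)
next
  case (Suc k)
  have "Ck_on k (\<lambda>x. frechet_derivative f (at x) v) S" for v
    by (rule Suc.IH) (use Suc.prems in fastforce)
  moreover have "f differentiable (at x)" if "x \<in> S" for x using Suc.prems[OF that] by auto
  ultimately show ?case by auto
qed

lemma Ck_on_SucD_derivative:
  assumes "Ck_on (Suc k) f S" "x \<in> S"
  shows "(f has_derivative frechet_derivative f (at x)) (at x)"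
  using assms by (auto simp: frechet_derivative_works[symmetric])

lemma Ck_on_const [simp]: "Ck_on k (\<lambda>x. c) S"
  by (induction k arbitrary: c) auto

lemma Ck_on_bounded_linear:
  assumes L: "bounded_linear L" and S: "open S" and "Ck_on k f S"
  shows "Ck_on k (\<lambda>x. L (f x)) S"
  using assms(3)
proof (induction k arbitrary: f)
  case 0
  then show ?case using bounded_linear.continuous_on[OF L] by auto
next
  case (Suc k)
  show ?case
    by (rule Ck_on_SucI[where f'="\<lambda>x v. L (frechet_derivative f (at x) v)"])
      (use Suc S in \<open>auto intro!: bounded_linear.has_derivative[OF L] simp: frechet_derivative_works[symmetric]\<close>)
qed

lemma Ck_on_ident [simp]: "Ck_on k (\<lambda>x. x) S"
  by (cases k) auto

lemma Ck_on_linear: "bounded_linear L \<Longrightarrow> Ck_on k L S"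
  using Ck_on_subset[OF Ck_on_bounded_linear[of L UNIV k "\<lambda>x. x"]] by simp

lemma Ck_on_add:
  assumes S: "open S" and "Ck_on k f S" "Ck_on k g S"
  shows "Ck_on k (\<lambda>x. f x + g x) S"
  using assms(2,3)
proof (induction k arbitrary: f g)
  case 0
  then show ?case by (auto intro: continuous_on_add)
next
  case (Suc k)
  show ?case
    by (rule Ck_on_SucI[where f'="\<lambda>x v. frechet_derivative f (at x) v + frechet_derivative g (at x) v"])
      (use Suc S in \<open>auto intro!: has_derivative_add simp: frechet_derivative_works[symmetric]\<close>)
qed

lemma Ck_on_sum:
  assumes "open S" "\<And>i. i \<in> I \<Longrightarrow> Ck_on k (f i) S"
  shows "Ck_on k (\<lambda>x. \<Sum>i\<in>I. f i x) S"
  using assms(2) by (induction I rule: infinite_finite_induct) (auto intro: Ck_on_add[OF assms(1)])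

lemma Ck_on_bilinear:
  assumes b: "bounded_bilinear b" and S: "open S" and "Ck_on k f S" "Ck_on k g S"
  shows "Ck_on k (\<lambda>x. b (f x) (g x)) S"
  using assms(3,4)
proof (induction k arbitrary: f g)
  case 0
  then show ?case by (auto intro: bounded_bilinear.continuous_on[OF b])
next
  case (Suc k)
  note fg = Ck_on_SucD[OF Suc.prems(1)] Ck_on_SucD[OF Suc.prems(2)]
  show ?case
    by (rule Ck_on_SucI[where f'="\<lambda>x v. b (f x) (frechet_derivative g (at x) v) + b (frechet_derivative f (at x) v) (g x)"])
      (use Suc S fg in \<open>auto intro!: bounded_bilinear.FDERIV[OF b] Ck_on_add simp: frechet_derivative_works[symmetric]\<close>)
qed

lemmas Ck_on_mult = Ck_on_bilinear[OF bounded_bilinear_mult]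
lemmas Ck_on_scaleR = Ck_on_bilinear[OF bounded_bilinear_scaleR]
lemmas Ck_on_inner = Ck_on_bilinear[OF bounded_bilinear_inner]
lemmas Ck_on_minus = Ck_on_bounded_linear[OF bounded_linear_minus[OF bounded_linear_ident]]

lemma Ck_on_diff:
  assumes "open S" "Ck_on k f S" "Ck_on k g S"
  shows "Ck_on k (\<lambda>x. f x - g x) S"
  using Ck_on_add[OF assms(1,2) Ck_on_minus[OF assms(1,3)]] by simp

lemma Ck_on_prod:
  fixes f :: "'i \<Rightarrow> 'e::euclidean_space \<Rightarrow> real"
  assumes "open S" "\<And>i. i \<in> I \<Longrightarrow> Ck_on k (f i) S"
  shows "Ck_on k (\<lambda>x. \<Prod>i\<in>I. f i x) S"
  using assms(2) by (induction I rule: infinite_finite_induct) (auto intro: Ck_on_mult[OF assms(1)])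

text \<open>The exponent is generalized in the induction because differentiation lowers it by one.
  Exponents -1 and 1/2 later supply smooth reciprocals and square roots.\<close>

lemma Ck_on_powr:
  fixes f :: "'e::euclidean_space \<Rightarrow> real"
  assumes S: "open S" and "Ck_on k f S" and pos: "\<And>x. x \<in> S \<Longrightarrow> 0 < f x"
  shows "Ck_on k (\<lambda>x. f x powr a) S"
  using assms(2)
proof (induction k arbitrary: a)
  case 0
  then show ?case using pos by (fastforce intro!: continuous_on_powr)
next
  case (Suc k)
  have d: "((\<lambda>x. f x powr a) has_derivative (\<lambda>v. a * f x powr (a - 1) * frechet_derivative f (at x) v)) (at x)"
    if "x \<in> S" for x
    using has_derivative_compose[OF Ck_on_SucD_derivative[OF Suc.prems that]
        has_real_derivative_powr[OF pos[OF that], of a, unfolded has_field_derivative_def]] .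
  show ?case
    by (rule Ck_on_SucI[OF S d])
      (use Suc.prems Suc.IH[OF Ck_on_SucD[OF Suc.prems]] S in \<open>auto intro!: Ck_on_mult[OF S]\<close>)
qed

lemma Ck_on_compose:
  fixes f :: "'e::euclidean_space \<Rightarrow> 'f::euclidean_space" and g :: "'f \<Rightarrow> 'g::real_normed_vector"
  assumes S: "open S" and "Ck_on k f S" "Ck_on k g T" and fST: "\<And>x. x \<in> S \<Longrightarrow> f x \<in> T"
  shows "Ck_on k (\<lambda>x. g (f x)) S"
  using assms(2,3)
proof (induction k arbitrary: g)
  case 0
  then show ?case using fST by (auto intro: continuous_on_compose2)
next
  case (Suc k)
  define D where "D x = frechet_derivative f (at x)" for x
  define G where "G y = frechet_derivative g (at y)" for y
  have f: "(f has_derivative D x) (at x)" if "x \<in> S" for x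
    using Ck_on_SucD_derivative[OF Suc.prems(1) that] by (simp add: D_def)
  have g: "(g has_derivative G (f x)) (at (f x))" if "x \<in> S" for x
    using Ck_on_SucD_derivative[OF Suc.prems(2) fST[OF that]] by (simp add: G_def)
  \<comment> \<open>The direction \<open>D x v\<close> varies with \<open>x\<close>, whereas
    \<open>Ck_on\<close> controls derivatives in fixed directions only. Expanding it in the basis
    leaves fixed directions \<open>b\<close> with smooth coefficients.\<close>
  have eq: "(\<Sum>b\<in>Basis. (D x v \<bullet> b) *\<^sub>R G (f x) b) = G (f x) (D x v)" if "x \<in> S" for x v
  proof -
    interpret bounded_linear "G (f x)" using g[OF that] by (rule has_derivative_bounded_linear)
    show ?thesis by (subst (2) euclidean_representation[symmetric]) (simp add: sum scaleR)
  qed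
  show ?case
  proof (rule Ck_on_SucI[OF S])
    show "((\<lambda>x. g (f x)) has_derivative (\<lambda>v. G (f x) (D x v))) (at x)" if "x \<in> S" for x
      by (rule has_derivative_compose[OF f[OF that] g[OF that]])
    show "Ck_on k (\<lambda>x. G (f x) (D x v)) S" for v
    proof (rule Ck_on_cong[OF S eq])
      have "Ck_on k (\<lambda>x. G (f x) b) S" for b
        using Suc.IH[OF Ck_on_SucD[OF Suc.prems(1)], of "\<lambda>y. G y b"] Suc.prems(2) by (simp add: G_def)
      moreover have "Ck_on k (\<lambda>x. D x v) S" using Suc.prems(1) by (simp add: D_def)
      ultimately show "Ck_on k (\<lambda>x. \<Sum>b\<in>Basis. (D x v \<bullet> b) *\<^sub>R G (f x) b) S"
        by (intro Ck_on_sum[OF S] Ck_on_scaleR[OF S] Ck_on_inner[OF S] Ck_on_const) auto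
    qed
  qed
qed

lemma Ck_on_Pair:
  assumes "open S" "Ck_on k f S" "Ck_on k g S"
  shows "Ck_on k (\<lambda>x. (f x, g x)) S"
proof -
  have "bounded_linear (\<lambda>x. (x, 0))" "bounded_linear (\<lambda>x. (0, x))"
    by (auto intro: bounded_linear_Pair bounded_linear_ident bounded_linear_zero)
  then have "Ck_on k (\<lambda>x. (f x, 0) + (0, g x)) S"
    using assms by (intro Ck_on_add Ck_on_bounded_linear[of "\<lambda>x. (x, 0)"] Ck_on_bounded_linear[of "\<lambda>x. (0, x)"])
  then show ?thesis by simp
qed

lemma bounded_linear_axis: "bounded_linear (axis i :: 'b::real_normed_vector \<Rightarrow> 'b^'n)"
proof (rule bounded_linear_intro[where K=1])
  show "norm (axis i x :: 'b^'n) \<le> norm x * 1" for x by (simp add: norm_vec_def L2_set_def axis_def if_distrib[where f=norm] if_distrib[where f="\<lambda>y. y\<^sup>2"] cong: if_cong)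
qed (auto simp: axis_def vec_eq_iff)

lemma Ck_on_vecI:
  fixes f :: "'e::euclidean_space \<Rightarrow> 'b::real_normed_vector^'n"
  assumes "open S" "\<And>i. Ck_on k (\<lambda>x. f x $ i) S"
  shows "Ck_on k f S"
proof -
  have "Ck_on k (\<lambda>x. \<Sum>i\<in>UNIV. axis i (f x $ i) :: 'b^'n) S"
    by (intro Ck_on_sum assms Ck_on_bounded_linear[OF bounded_linear_axis])
  moreover have "(\<Sum>i\<in>UNIV. axis i (f x $ i)) = f x" for x
    by (simp add: vec_eq_iff axis_def if_distrib cong: if_cong)
  ultimately show ?thesis by simp
qed

lemma Ck_on_nth:
  fixes f :: "'e::euclidean_space \<Rightarrow> 'b::real_normed_vector^'n"
  assumes "open S" "Ck_on k f S"
  shows "Ck_on k (\<lambda>x. f x $ i) S"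
  using Ck_on_bounded_linear[OF bounded_linear_vec_nth assms] .

lemma Ck_on_real_SucI:
  fixes f :: "real \<Rightarrow> real"
  assumes "open S" "\<And>x. x \<in> S \<Longrightarrow> (f has_real_derivative f' x) (at x)" "Ck_on k f' S"
  shows "Ck_on (Suc k) f S"
  using assms by (intro Ck_on_SucI[where f'="\<lambda>x v. f' x * v"])
    (auto simp: has_field_derivative_def intro: Ck_on_mult)

section \<open>Matrices\<close>

lemma matrix_inv_mult:
  fixes A :: "real^'n^'n"
  assumes "invertible A"
  shows "A ** matrix_inv A = mat 1" "matrix_inv A ** A = mat 1"
proof -
  have "\<exists>A'. A ** A' = mat 1 \<and> A' ** A = mat 1" using assms unfolding invertible_def by simp
  from someI_ex[OF this] show "A ** matrix_inv A = mat 1" "matrix_inv A ** A = mat 1"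
    unfolding matrix_inv_def by auto
qed

lemma matrix_inv_unique:
  fixes A :: "real^'n^'n"
  assumes "B ** A = mat 1"
  shows "matrix_inv A = B"
proof -
  have "invertible A" using assms invertible_left_inverse by auto
  then have "B = B ** (A ** matrix_inv A)" by (simp add: matrix_inv_mult)
  also have "\<dots> = matrix_inv A" unfolding matrix_mul_assoc assms by simp
  finally show ?thesis by simp
qed

lemma matrix_inv_mat_1 [simp]: "matrix_inv (mat 1 :: real^'n^'n) = mat 1"
  by (rule matrix_inv_unique) simp

text \<open>Cramer's rule for the right-hand side \<open>axis j 1\<close>. It writes the inverse as
  a quotient of polynomials in the entries, from which smoothness of the inverse follows.\<close>

lemma matrix_inv_nth:
  fixes A :: "real^'n^'n"
  assumes "det A \<noteq> 0"
  shows "matrix_inv A $ i $ j = det (\<chi> k l. if l = i then axis j 1 $ k else A $ k $ l) / det A"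
proof -
  have "A *v (matrix_inv A *v axis j 1) = axis j 1"
    using matrix_inv_mult(1)[of A] assms by (simp add: matrix_vector_mul_assoc invertible_det_nz)
  then have "matrix_inv A *v axis j 1 = (\<chi> i. det (\<chi> k l. if l = i then axis j 1 $ k else A $ k $ l) / det A)"
    unfolding cramer[OF assms] .
  then have "(matrix_inv A *v axis j 1) $ i = det (\<chi> k l. if l = i then axis j 1 $ k else A $ k $ l) / det A"
    by simp
  then show ?thesis by (simp add: matrix_vector_mult_basis column_def)
qed

lemma Ck_on_det:
  fixes f :: "'e::euclidean_space \<Rightarrow> real^'n^'n"
  assumes "open S" "Ck_on k f S"
  shows "Ck_on k (\<lambda>x. det (f x)) S"
  unfolding det_def
  by (intro Ck_on_sum Ck_on_mult Ck_on_const Ck_on_prod Ck_on_nth assms)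

lemma Ck_on_matrix_inv:
  fixes f :: "'e::euclidean_space \<Rightarrow> real^'n^'n"
  assumes S: "open S" and f: "Ck_on k f S" and pos: "\<And>x. x \<in> S \<Longrightarrow> 0 < det (f x)"
  shows "Ck_on k (\<lambda>x. matrix_inv (f x)) S"
proof (intro Ck_on_vecI S)
  fix i j :: 'n
  let ?M = "\<lambda>x. \<chi> k l. if l = i then axis j 1 $ k else f x $ k $ l"
  have "Ck_on k (\<lambda>x. ?M x $ a $ b) S" for a b
    by (cases "b = i") (simp_all add: Ck_on_nth S f)
  then have "Ck_on k ?M S" by (intro Ck_on_vecI S)
  then have *: "Ck_on k (\<lambda>x. det (?M x) * det (f x) powr (-1)) S"
    by (intro Ck_on_mult Ck_on_det Ck_on_powr S f pos)
  show "Ck_on k (\<lambda>x. matrix_inv (f x) $ i $ j) S"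
  proof (rule Ck_on_cong[OF S _ *])
    show "det (?M x) * det (f x) powr (-1) = matrix_inv (f x) $ i $ j" if "x \<in> S" for x
      using matrix_inv_nth[of "f x" i j] pos[OF that] by (simp add: powr_minus divide_inverse)
  qed
qed

lemma bounded_bilinear_matrix_matrix_mult:
  "bounded_bilinear ((**) :: real^'n^'m \<Rightarrow> real^'k^'n \<Rightarrow> real^'k^'m)"
  unfolding bilinear_conv_bounded_bilinear[symmetric] bilinear_def
  by (auto intro!: linearI simp: matrix_matrix_mult_def vec_eq_iff algebra_simps sum.distrib sum_distrib_left)

lemma bounded_linear_trace: "bounded_linear (trace :: real^'n^'n \<Rightarrow> real)"
  unfolding linear_conv_bounded_linear[symmetric]
  by (auto intro!: linearI simp: trace_add) (simp add: trace_def sum_distrib_left)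

lemma bounded_linear_transpose: "bounded_linear (transpose :: real^'n^'m \<Rightarrow> real^'m^'n)"
  unfolding linear_conv_bounded_linear[symmetric]
  by (auto intro!: linearI simp: transpose_def vec_eq_iff)

lemmas Ck_on_matrix_mult = Ck_on_bilinear[OF bounded_bilinear_matrix_matrix_mult]
lemmas Ck_on_trace = Ck_on_bounded_linear[OF bounded_linear_trace]
lemmas Ck_on_transpose = Ck_on_bounded_linear[OF bounded_linear_transpose]

text \<open>Product rule in the Leibniz formula: the determinant is linear in each row, so its
  derivative replaces one row at a time.\<close>

lemma has_derivative_det_sum:
  fixes X :: "real^'n^'n"
  shows "(det has_derivative (\<lambda>H. \<Sum>i\<in>UNIV. det (\<chi> k. if k = i then H $ i else X $ k))) (at X)"
proof -
  have nth: "((\<lambda>Y::real^'n^'n. Y $ i $ j) has_derivative (\<lambda>H. H $ i $ j)) (at X)" for i j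
    by (intro bounded_linear_imp_has_derivative bounded_linear_compose[OF bounded_linear_vec_nth bounded_linear_vec_nth])
  have prod: "(\<Prod>k\<in>UNIV. (if k = i then H $ i else X $ k) $ p k) = H $ i $ p i * (\<Prod>k\<in>UNIV - {i}. X $ k $ p k)"
    for H i and p :: "'n \<Rightarrow> 'n"
    by (subst prod.remove[of UNIV i]) (auto intro!: prod.cong)
  have "(\<Sum>i\<in>UNIV. det (\<chi> k. if k = i then H $ i else X $ k))
      = (\<Sum>p | p permutes UNIV. of_int (sign p) * (\<Sum>i\<in>UNIV. H $ i $ p i * (\<Prod>k\<in>UNIV - {i}. X $ k $ p k)))" for H
    unfolding det_def by (subst sum.swap) (simp add: prod sum_distrib_left)
  moreover have "((\<lambda>Y::real^'n^'n. \<Sum>p | p permutes UNIV. of_int (sign p) * (\<Prod>i\<in>UNIV. Y $ i $ p i)) has_derivative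
      (\<lambda>H. \<Sum>p | p permutes UNIV. of_int (sign p) * (\<Sum>i\<in>UNIV. H $ i $ p i * (\<Prod>k\<in>UNIV - {i}. X $ k $ p k)))) (at X)"
    by (intro has_derivative_sum has_derivative_mult_right has_derivative_prod nth)
  ultimately show ?thesis unfolding det_def[abs_def, symmetric] by simp
qed

lemma has_derivative_det_mat_1: "(det has_derivative trace) (at (mat 1 :: real^'n^'n))"
proof -
  have "det (\<chi> k. if k = i then H $ i else mat 1 $ k) = H $ i $ i" for H :: "real^'n^'n" and i
  proof -
    \<comment> \<open>The row \<open>H $ i\<close> is a combination of the rows of the identity with
      coefficients \<open>H $ i $ j\<close>; Cramer's lemma reads off the coefficient of the
      replaced row.\<close>
    have "(\<Sum>j\<in>UNIV. H $ i $ j *s row j (mat 1 :: real^'n^'n)) = H $ i"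
      by (simp add: vec_eq_iff row_def mat_def if_distrib cong: if_cong)
    moreover have "row j (mat 1 :: real^'n^'n) = mat 1 $ j" for j by (simp add: row_def vec_eq_iff)
    ultimately show ?thesis
      using cramer_lemma_transpose[of i "H $ i" "mat 1 :: real^'n^'n"] by (simp cong: if_cong)
  qed
  then show ?thesis using has_derivative_det_sum[of "mat 1 :: real^'n^'n"] by (simp add: trace_def[abs_def])
qed

text \<open>Jacobi's formula, reduced to the derivative at the identity by \<open>det Y = det X * det (X\<^sup>-\<^sup>1 Y)\<close>.\<close>

lemma has_derivative_det:
  fixes X :: "real^'n^'n"
  assumes "invertible X"
  shows "(det has_derivative (\<lambda>H. det X * trace (matrix_inv X ** H))) (at X)"
proof -
  have m: "((\<lambda>Y. matrix_inv X ** Y) has_derivative (\<lambda>H. matrix_inv X ** H)) (at X)"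
    by (intro bounded_linear_imp_has_derivative bounded_bilinear.bounded_linear_right bounded_bilinear_matrix_matrix_mult)
  have "(det has_derivative trace) (at (matrix_inv X ** X))"
    using has_derivative_det_mat_1 matrix_inv_mult(2)[OF assms] by simp
  from has_derivative_mult_right[OF has_derivative_compose[OF m this], of "det X"]
  have "((\<lambda>Y. det X * det (matrix_inv X ** Y)) has_derivative (\<lambda>H. det X * trace (matrix_inv X ** H))) (at X)" .
  moreover have "det X * det (matrix_inv X ** Y) = det Y" for Y
  proof -
    have "det X * det (matrix_inv X ** Y) = det (X ** (matrix_inv X ** Y))" by (simp add: det_mul)
    also have "\<dots> = det Y" unfolding matrix_mul_assoc matrix_inv_mult(1)[OF assms] by simp
    finally show ?thesis .
  qed
  ultimately show ?thesis by simp
qed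

text \<open>The direction is fixed and the base point is the last argument, so that
  \<open>dir_deriv\<close> can be iterated: \<open>dir_deriv (dir_deriv f v) u\<close> is the mixed
  second derivative.\<close>

definition dir_deriv :: "('p::real_normed_vector \<Rightarrow> 'b::real_normed_vector) \<Rightarrow> 'p \<Rightarrow> 'p \<Rightarrow> 'b" where
  "dir_deriv f v x = frechet_derivative f (at x) v"

lemma dir_deriv_eq: "(f has_derivative f') (at x) \<Longrightarrow> dir_deriv f v x = f' v"
  unfolding dir_deriv_def by (metis frechet_derivative_at)

lemma has_derivative_dir_deriv:
  "Ck_on (Suc k) f S \<Longrightarrow> x \<in> S \<Longrightarrow> (f has_derivative (\<lambda>v. dir_deriv f v x)) (at x)"
  using Ck_on_SucD_derivative unfolding dir_deriv_def by metis

lemma Ck_on_dir_deriv: "Ck_on (Suc k) f S \<Longrightarrow> Ck_on k (dir_deriv f v) S"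
  unfolding dir_deriv_def[abs_def] by simp

lemma dir_deriv_cong:
  assumes "open S" "x \<in> S" "\<And>y. y \<in> S \<Longrightarrow> f y = g y"
  shows "dir_deriv f v x = dir_deriv g v x"
proof -
  have "(f has_derivative D) (at x) \<longleftrightarrow> (g has_derivative D) (at x)" for D
    using has_derivative_transform_within_open[of f D x UNIV S g]
      has_derivative_transform_within_open[of g D x UNIV S f] assms by auto
  then show ?thesis unfolding dir_deriv_def frechet_derivative_def by simp
qed

section \<open>Second-order expansion of trace and determinant along a matrix family through the
  identity\<close>

context
  fixes S :: "'p::euclidean_space \<Rightarrow> real^'m^'m" and T :: "'p set" and \<tau>0 :: 'p
  assumes T: "open T" "\<tau>0 \<in> T" and S: "Ck_on 2 S T" and S0: "S \<tau>0 = mat 1"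
begin

lemma Ck_on_path: "Ck_on (Suc 1) S T" using S by (simp add: numeral_2_eq_2)

lemma has_derivative_path: "x \<in> T \<Longrightarrow> (S has_derivative (\<lambda>v. dir_deriv S v x)) (at x)"
  by (rule has_derivative_dir_deriv[OF Ck_on_path])

lemma has_derivative_dir_deriv_path: "x \<in> T \<Longrightarrow> (dir_deriv S v has_derivative (\<lambda>u. dir_deriv (dir_deriv S v) u x)) (at x)"
  by (rule has_derivative_dir_deriv[of 0]) (use Ck_on_dir_deriv[OF Ck_on_path, of v] in auto)

lemma dir_deriv_trace_powr:
  assumes "x \<in> T" "0 < 1 + trace (S x)"
  shows "dir_deriv (\<lambda>\<tau>. (1 + trace (S \<tau>)) powr \<alpha>) v x
    = \<alpha> * (1 + trace (S x)) powr (\<alpha> - 1) * trace (dir_deriv S v x)"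
proof -
  have "((\<lambda>\<tau>. 1 + trace (S \<tau>)) has_derivative (\<lambda>v. 0 + trace (dir_deriv S v x))) (at x)"
    by (intro has_derivative_add has_derivative_const bounded_linear.has_derivative[OF bounded_linear_trace] has_derivative_path assms)
  from dir_deriv_eq[OF has_derivative_compose[OF this has_real_derivative_powr[OF assms(2), of \<alpha>, unfolded has_field_derivative_def]]]
  show ?thesis by simp
qed

lemma dir_deriv_sqrt_det:
  assumes "x \<in> T" "0 < det (S x)"
  shows "dir_deriv (\<lambda>\<tau>. sqrt (det (S \<tau>))) v x
    = sqrt (det (S x)) / 2 * trace (matrix_inv (S x) ** dir_deriv S v x)"
proof -
  have "((\<lambda>\<tau>. det (S \<tau>)) has_derivative (\<lambda>v. det (S x) * trace (matrix_inv (S x) ** dir_deriv S v x))) (at x)"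
    by (intro has_derivative_compose[OF has_derivative_path has_derivative_det] assms) (use assms in \<open>simp add: invertible_det_nz\<close>)
  from dir_deriv_eq[OF has_derivative_compose[OF this DERIV_real_sqrt[OF assms(2), unfolded has_field_derivative_def]]]
  have "2 * (sqrt (det (S x)) * dir_deriv (\<lambda>\<tau>. sqrt (det (S \<tau>))) v x)
      = sqrt (det (S x)) * (sqrt (det (S x)) * trace (matrix_inv (S x) ** dir_deriv S v x))"
    using assms(2) by (simp add: field_simps)
  then show ?thesis using assms(2) by simp
qed

lemma dir_deriv_trace_powr_at:
  "dir_deriv (\<lambda>\<tau>. (1 + trace (S \<tau>)) powr \<alpha>) v \<tau>0
    = \<alpha> * (1 + real CARD('m)) powr (\<alpha> - 1) * trace (dir_deriv S v \<tau>0)"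
  by (subst dir_deriv_trace_powr) (auto simp: T S0 trace_I add_pos_nonneg)

lemma dir_deriv_sqrt_det_at:
  "dir_deriv (\<lambda>\<tau>. sqrt (det (S \<tau>))) v \<tau>0 = trace (dir_deriv S v \<tau>0) / 2"
  by (subst dir_deriv_sqrt_det) (auto simp: T S0)

lemma dir_deriv2_trace_powr:
  "dir_deriv (dir_deriv (\<lambda>\<tau>. (1 + trace (S \<tau>)) powr \<alpha>) v) u \<tau>0
    = \<alpha> * (\<alpha> - 1) * (1 + real CARD('m)) powr (\<alpha> - 2) * trace (dir_deriv S u \<tau>0) * trace (dir_deriv S v \<tau>0)
      + \<alpha> * (1 + real CARD('m)) powr (\<alpha> - 1) * trace (dir_deriv (dir_deriv S v) u \<tau>0)"
proof -
  let ?e = "\<lambda>\<tau>. 1 + trace (S \<tau>)"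
  \<comment> \<open>The formula for the first derivative holds where the base of the power is
    positive. This is an open set around \<open>\<tau>0\<close>, so the formula may be
    differentiated again there.\<close>
  define T' where "T' = T \<inter> ?e -` {0<..}"
  have ce: "continuous_on T ?e"
    by (intro continuous_intros bounded_linear.continuous_on[OF bounded_linear_trace] Ck_on_imp_continuous_on[OF S])
  have T': "open T'" "\<tau>0 \<in> T'" unfolding T'_def
    using continuous_open_preimage[OF ce T(1), of "{0<..}"] T by (auto simp: S0 trace_I add_pos_nonneg)
  have "dir_deriv (dir_deriv (\<lambda>\<tau>. ?e \<tau> powr \<alpha>) v) u \<tau>0
      = dir_deriv (\<lambda>x. \<alpha> * (?e x powr (\<alpha> - 1) * trace (dir_deriv S v x))) u \<tau>0"
    by (rule dir_deriv_cong[OF T']) (use dir_deriv_trace_powr in \<open>auto simp: T'_def\<close>)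
  also have "\<dots> = \<alpha> * (?e \<tau>0 powr (\<alpha> - 1) * trace (dir_deriv (dir_deriv S v) u \<tau>0)
        + ((\<alpha> - 1) * ?e \<tau>0 powr (\<alpha> - 1 - 1) * trace (dir_deriv S u \<tau>0)) * trace (dir_deriv S v \<tau>0))"
  proof (rule dir_deriv_eq, intro has_derivative_mult_right has_derivative_mult)
    have "((\<lambda>\<tau>. ?e \<tau>) has_derivative (\<lambda>v. 0 + trace (dir_deriv S v \<tau>0))) (at \<tau>0)"
      by (intro has_derivative_add has_derivative_const bounded_linear.has_derivative[OF bounded_linear_trace] has_derivative_path T)
    from has_derivative_compose[OF this has_real_derivative_powr[of "?e \<tau>0" "\<alpha> - 1", unfolded has_field_derivative_def]]
    show "((\<lambda>x. ?e x powr (\<alpha> - 1)) has_derivative (\<lambda>u. (\<alpha> - 1) * ?e \<tau>0 powr (\<alpha> - 1 - 1) * trace (dir_deriv S u \<tau>0))) (at \<tau>0)"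
      using T' by (simp add: T'_def)
    show "((\<lambda>x. trace (dir_deriv S v x)) has_derivative (\<lambda>u. trace (dir_deriv (dir_deriv S v) u \<tau>0))) (at \<tau>0)"
      by (intro bounded_linear.has_derivative[OF bounded_linear_trace] has_derivative_dir_deriv_path T)
  qed
  finally show ?thesis by (simp add: S0 trace_I algebra_simps)
qed

lemma dir_deriv2_sqrt_det:
  "dir_deriv (dir_deriv (\<lambda>\<tau>. sqrt (det (S \<tau>))) v) u \<tau>0
    = (trace (dir_deriv S u \<tau>0) * trace (dir_deriv S v \<tau>0) / 2
       - trace (dir_deriv S u \<tau>0 ** dir_deriv S v \<tau>0) + trace (dir_deriv (dir_deriv S v) u \<tau>0)) / 2"
proof -
  define T' where "T' = T \<inter> (\<lambda>x. det (S x)) -` {0<..}"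
  have T': "open T'" "\<tau>0 \<in> T'" unfolding T'_def
    using continuous_open_preimage[OF Ck_on_imp_continuous_on[OF Ck_on_det[OF T(1) S]] T(1), of "{0<..}"] T by (auto simp: S0)
  define R where "R x = matrix_inv (S x)" for x
  have R0: "R \<tau>0 = mat 1" by (simp add: R_def S0)
  have "Ck_on (Suc 1) R T'" unfolding R_def
    using Ck_on_subset[OF Ck_on_path, of T'] by (intro Ck_on_matrix_inv T') (auto simp: T'_def)
  then have R: "(R has_derivative (\<lambda>u. dir_deriv R u \<tau>0)) (at \<tau>0)"
    by (rule has_derivative_dir_deriv) (rule T')
  have "((\<lambda>x. R x ** S x) has_derivative (\<lambda>u. R \<tau>0 ** dir_deriv S u \<tau>0 + dir_deriv R u \<tau>0 ** S \<tau>0)) (at \<tau>0)"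
    by (intro bounded_bilinear.FDERIV[OF bounded_bilinear_matrix_matrix_mult] R has_derivative_path T)
  then have "dir_deriv (\<lambda>x. R x ** S x) u \<tau>0 = dir_deriv S u \<tau>0 + dir_deriv R u \<tau>0" for u
    by (subst dir_deriv_eq) (auto simp: R0 S0)
  moreover have "dir_deriv (\<lambda>x. R x ** S x) u \<tau>0 = dir_deriv (\<lambda>x. mat 1 :: real^'m^'m) u \<tau>0" for u
    by (rule dir_deriv_cong[OF T']) (auto simp: R_def T'_def invertible_det_nz matrix_inv_mult)
  \<comment> \<open>Differentiating \<open>R x ** S x = mat 1\<close> at the identity. This sign is
    the source of the term with the trace of the product, hence in the end of the squared norm of
    the Lie derivative.\<close>
  ultimately have dR: "dir_deriv R u \<tau>0 = - dir_deriv S u \<tau>0" for u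
    by (simp add: dir_deriv_def eq_neg_iff_add_eq_0 add.commute)
  have "dir_deriv (dir_deriv (\<lambda>\<tau>. sqrt (det (S \<tau>))) v) u \<tau>0
      = dir_deriv (\<lambda>x. sqrt (det (S x)) * (trace (R x ** dir_deriv S v x) / 2)) u \<tau>0"
    by (rule dir_deriv_cong[OF T']) (use dir_deriv_sqrt_det in \<open>auto simp: T'_def R_def\<close>)
  also have "\<dots> = sqrt (det (S \<tau>0)) * (trace (R \<tau>0 ** dir_deriv (dir_deriv S v) u \<tau>0 + dir_deriv R u \<tau>0 ** dir_deriv S v \<tau>0) / 2)
      + dir_deriv (\<lambda>x. sqrt (det (S x))) u \<tau>0 * (trace (R \<tau>0 ** dir_deriv S v \<tau>0) / 2)"
  proof (rule dir_deriv_eq, intro has_derivative_mult)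
    have "((\<lambda>\<tau>. det (S \<tau>)) has_derivative (\<lambda>v. det (S \<tau>0) * trace (matrix_inv (S \<tau>0) ** dir_deriv S v \<tau>0))) (at \<tau>0)"
      by (intro has_derivative_compose[OF has_derivative_path has_derivative_det] T) (simp add: invertible_det_nz S0)
    from has_derivative_compose[OF this DERIV_real_sqrt[of "det (S \<tau>0)", unfolded has_field_derivative_def]]
    have "((\<lambda>x. sqrt (det (S x))) has_derivative (\<lambda>u. trace (dir_deriv S u \<tau>0) / 2)) (at \<tau>0)"
      by (simp add: S0)
    then show "((\<lambda>x. sqrt (det (S x))) has_derivative (\<lambda>u. dir_deriv (\<lambda>x. sqrt (det (S x))) u \<tau>0)) (at \<tau>0)"
      by (simp add: dir_deriv_sqrt_det_at)
    have "((\<lambda>x. trace (R x ** dir_deriv S v x)) has_derivative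
      (\<lambda>u. trace (R \<tau>0 ** dir_deriv (dir_deriv S v) u \<tau>0 + dir_deriv R u \<tau>0 ** dir_deriv S v \<tau>0))) (at \<tau>0)"
      by (intro bounded_linear.has_derivative[OF bounded_linear_trace]
          bounded_bilinear.FDERIV[OF bounded_bilinear_matrix_matrix_mult] R has_derivative_dir_deriv_path T)
    from has_derivative_mult_right[OF this, of "1/2"]
    show "((\<lambda>x. trace (R x ** dir_deriv S v x) / 2) has_derivative
      (\<lambda>u. trace (R \<tau>0 ** dir_deriv (dir_deriv S v) u \<tau>0 + dir_deriv R u \<tau>0 ** dir_deriv S v \<tau>0) / 2)) (at \<tau>0)"
      by simp
  qed
  finally show ?thesis
    by (simp add: S0 R_def dR dir_deriv_sqrt_det_at bounded_bilinear.minus_left[OF bounded_bilinear_matrix_matrix_mult]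
        linear_diff[OF bounded_linear.linear[OF bounded_linear_trace]] field_simps)
qed

end

section \<open>Factorization of positive definite matrices and positivity of traces\<close>

lemma matrix_mult_transpose_nth: "(U ** transpose U) $ i $ j = (\<Sum>s\<in>UNIV. U $ i $ s * U $ j $ s)"
  for U :: "real^'n^'m"
  by (simp add: matrix_matrix_mult_def transpose_def)

text \<open>Cholesky decomposition: peel off one row and column of \<open>K\<close> at a time.\<close>

lemma psd_decomposition:
  fixes K :: "real^'m^'m"
  assumes "finite F" "transpose K = K" "\<And>x. 0 \<le> x \<bullet> (K *v x)" "\<And>i j. i \<notin> F \<Longrightarrow> K $ i $ j = 0"
  shows "\<exists>u :: 'm \<Rightarrow> real^'m. \<forall>i j. K $ i $ j = (\<Sum>s\<in>F. u s $ i * u s $ j)"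
  using assms
proof (induction F arbitrary: K rule: finite_induct)
  case empty
  then show ?case by auto
next
  case (insert a F)
  have sym: "K $ i $ j = K $ j $ i" for i j
    using insert.prems(1) by (metis transpose_def vec_lambda_beta)
  have axis_K: "axis i 1 \<bullet> (K *v x) = (\<Sum>j\<in>UNIV. K $ i $ j * x $ j)" for i x
    by (simp add: inner_axis_axis inner_axis' matrix_vector_mult_def)
  have K_axis: "K *v axis a 1 = (\<chi> i. K $ i $ a)"
    by (simp add: matrix_vector_mult_basis column_def)
  have x_K_axis: "x \<bullet> (K *v axis a 1) = axis a 1 \<bullet> (K *v x)" for x
    unfolding axis_K K_axis by (simp add: inner_vec_def sym[of _ a] mult.commute)
  show ?case
  proof (cases "K $ a $ a = 0")
    case True
    have "K $ i $ a = 0" for i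
    proof (rule ccontr)
      assume ne: "K $ i $ a \<noteq> 0"
      \<comment> \<open>Chosen so that the quadratic form takes the value -1 at
        \<open>axis i 1 + t *\<^sub>R axis a 1\<close>: with a zero diagonal entry the form is
        affine in \<open>t\<close>.\<close>
      define t where "t = - (K $ i $ i + 1) / (2 * K $ i $ a)"
      have "0 \<le> (axis i 1 + t *\<^sub>R axis a 1) \<bullet> (K *v (axis i 1 + t *\<^sub>R axis a 1))"
        by (rule insert.prems)
      also have "\<dots> = K $ i $ i + 2 * t * K $ i $ a"
        using True sym[of a i]
        by (simp add: matrix_vector_right_distrib matrix_vector_mult_scaleR inner_add_left inner_add_right
            matrix_vector_mult_basis column_def inner_axis' algebra_simps)
      also have "\<dots> = - 1" using ne by (simp add: t_def field_simps)
      finally show False by simp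
    qed
    then have "K $ i $ j = 0" if "i \<notin> F" for i j
      using insert.prems(3)[of i j] that sym[of i j] by (cases "i = a") auto
    from insert.IH[OF insert.prems(1,2) this] obtain u :: "'m \<Rightarrow> real^'m"
      where "\<forall>i j. K $ i $ j = (\<Sum>s\<in>F. u s $ i * u s $ j)" by auto
    then show ?thesis using insert.hyps
      by (intro exI[of _ "u(a := 0)"]) (auto intro!: sum.cong)
  next
    case False
    have Kaa: "K $ a $ a > 0"
    proof -
      have "0 \<le> axis a 1 \<bullet> (K *v axis a 1)" by (rule insert.prems)
      then show ?thesis using False by (simp add: K_axis inner_axis')
    qed
    \<comment> \<open>The Schur complement of the entry \<open>K $ a $ a\<close>: it clears row and
      column \<open>a\<close>.\<close>
    define K' where "K' = (\<chi> i j. K $ i $ j - K $ i $ a * K $ j $ a / K $ a $ a)"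
    have t: "transpose K' = K'" unfolding K'_def by (simp add: transpose_def vec_eq_iff sym mult.commute)
    have p: "0 \<le> x \<bullet> (K' *v x)" for x
    proof -
      define k where "k = axis a 1 \<bullet> (K *v x)"
      have k: "(\<Sum>j\<in>UNIV. K $ j $ a * x $ j) = k" unfolding k_def axis_K by (simp add: sym[of _ a])
      \<comment> \<open>The minimizer of the form of \<open>K\<close> along the line through
        \<open>x\<close> in direction \<open>axis a 1\<close>; the form of \<open>K'\<close> at
        \<open>x\<close> is this minimum, hence nonnegative.\<close>
      define y where "y = x - (k / K $ a $ a) *\<^sub>R axis a 1"
      have aKa: "axis a 1 \<bullet> (K *v axis a 1) = K $ a $ a" by (simp add: K_axis inner_axis')
      define c where "c = k / K $ a $ a"
      have "y \<bullet> (K *v y) = x \<bullet> (K *v x) - c * k - (c * k - c * (c * K $ a $ a))"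
        unfolding y_def c_def[symmetric]
        by (simp only: matrix_vector_mult_diff_distrib matrix_vector_mult_scaleR inner_diff_left inner_diff_right
            inner_scaleR_left inner_scaleR_right x_K_axis[of x] k_def[symmetric] aKa right_diff_distrib)
      moreover have "c * K $ a $ a = k" using Kaa by (simp add: c_def)
      ultimately have "y \<bullet> (K *v y) = x \<bullet> (K *v x) - k * k / K $ a $ a"
        by (simp add: c_def)
      moreover have "K' *v x = K *v x - (k / K $ a $ a) *\<^sub>R (\<chi> i. K $ i $ a)"
        unfolding K'_def vec_eq_iff
        by (simp add: matrix_vector_mult_def left_diff_distrib right_diff_distrib sum_subtractf k[symmetric] sum_distrib_left
            sum_divide_distrib mult_ac)
      moreover have "x \<bullet> (\<chi> i. K $ i $ a) = k" unfolding k[symmetric] by (simp add: inner_vec_def mult.commute)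
      ultimately have "x \<bullet> (K' *v x) = y \<bullet> (K *v y)"
        by (simp add: inner_diff_right)
      then show ?thesis using insert.prems(2)[of y] by simp
    qed
    have "K' $ i $ j = 0" if "i \<notin> F" for i j
    proof (cases "i = a")
      case True
      then show ?thesis using Kaa sym[of a j] by (simp add: K'_def)
    next
      case False
      then show ?thesis using that insert.prems(3)[of i] by (simp add: K'_def)
    qed
    from insert.IH[OF t p this] obtain u :: "'m \<Rightarrow> real^'m"
      where u: "K' $ i $ j = (\<Sum>s\<in>F. u s $ i * u s $ j)" for i j by auto
    \<comment> \<open>The rank one matrix with entries \<open>w $ i * w $ j\<close> is exactly what
      was subtracted from \<open>K\<close> to obtain \<open>K'\<close>.\<close>
    define w where "w = (1 / sqrt (K $ a $ a)) *\<^sub>R (\<chi> i. K $ i $ a)"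
    have ww: "w $ i * w $ j = K $ i $ a * K $ j $ a / K $ a $ a" for i j
      using Kaa by (simp add: w_def)
    have "(\<Sum>s\<in>F. (u(a := w)) s $ i * (u(a := w)) s $ j) = K' $ i $ j" for i j
      unfolding u using insert.hyps by (auto intro!: sum.cong)
    then have "K $ i $ j = (\<Sum>s\<in>insert a F. (u(a := w)) s $ i * (u(a := w)) s $ j)" for i j
      using insert.hyps by (simp add: ww K'_def)
    then show ?thesis by blast
  qed
qed

lemma spd_factor:
  fixes K :: "real^'m^'m"
  assumes "transpose K = K" "\<And>x. x \<noteq> 0 \<Longrightarrow> 0 < x \<bullet> (K *v x)"
  obtains U :: "real^'m^'m" where "K = U ** transpose U"
proof -
  have "0 \<le> x \<bullet> (K *v x)" for x using assms(2)[of x] by (cases "x = 0") auto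
  from psd_decomposition[OF finite_class.finite_UNIV assms(1) this] obtain u :: "'m \<Rightarrow> real^'m"
    where u: "K $ i $ j = (\<Sum>s\<in>UNIV. u s $ i * u s $ j)" for i j by auto
  have "K = (\<chi> i s. u s $ i) ** transpose (\<chi> i s. u s $ i)"
    by (simp add: vec_eq_iff matrix_mult_transpose_nth u)
  then show thesis by (rule that)
qed

text \<open>Definiteness gives a trivial kernel, hence a nonzero determinant, and the factorization
  shows that it is a square.\<close>

lemma spd_det_pos:
  fixes K :: "real^'m^'m"
  assumes "transpose K = K" "\<And>x. x \<noteq> 0 \<Longrightarrow> 0 < x \<bullet> (K *v x)"
  shows "0 < det K"
proof -
  obtain U :: "real^'m^'m" where U: "K = U ** transpose U" using spd_factor[OF assms] .
  have "K *v x \<noteq> 0" if "x \<noteq> 0" for x using assms(2)[OF that] by auto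
  then have "invertible K" unfolding invertible_left_inverse matrix_left_invertible_ker by auto
  then have "det K \<noteq> 0" by (simp add: invertible_det_nz)
  then show ?thesis unfolding U by (auto simp: det_mul zero_less_mult_iff)
qed

lemma trace_mult_transpose_self:
  fixes M :: "real^'m^'m"
  shows "trace (M ** transpose M) = (\<Sum>i\<in>UNIV. \<Sum>j\<in>UNIV. (M $ i $ j)\<^sup>2)"
  by (simp add: trace_def matrix_mult_transpose_nth power2_eq_square)

text \<open>Used with the inverse metric for \<open>K\<close> and the Lie derivative of the metric
  for \<open>L\<close>. If \<open>K = U ** transpose U\<close>, cyclicity of the trace turns the
  expression into the sum of the squared entries of the symmetric matrix
  \<open>transpose U ** L ** U\<close>, and \<open>U\<close> is invertible.\<close>

lemma trace_square_spd:
  fixes K L :: "real^'m^'m"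
  assumes K: "transpose K = K" "\<And>x. x \<noteq> 0 \<Longrightarrow> 0 < x \<bullet> (K *v x)" and L: "transpose L = L"
  shows trace_square_spd_nonneg: "0 \<le> trace (K ** L ** (K ** L))"
    and trace_square_spd_eq_0: "trace (K ** L ** (K ** L)) = 0 \<Longrightarrow> L = 0"
proof -
  obtain U :: "real^'m^'m" where U: "K = U ** transpose U" using spd_factor[OF K] .
  define M where "M = transpose U ** L ** U"
  have M: "transpose M = M" by (simp add: M_def matrix_transpose_mul L matrix_mul_assoc)
  have "trace (K ** L ** (K ** L)) = trace (U ** (transpose U ** L ** U ** transpose U ** L))"
    unfolding U by (simp add: matrix_mul_assoc)
  also have "\<dots> = trace (M ** transpose M)"
    unfolding M unfolding M_def by (subst trace_mul_sym) (simp add: matrix_mul_assoc)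
  finally have eq: "trace (K ** L ** (K ** L)) = (\<Sum>i\<in>UNIV. \<Sum>j\<in>UNIV. (M $ i $ j)\<^sup>2)"
    by (simp add: trace_mult_transpose_self)
  then show "0 \<le> trace (K ** L ** (K ** L))" by (simp add: sum_nonneg)
  assume "trace (K ** L ** (K ** L)) = 0"
  then have "M = 0"
    unfolding eq by (simp add: sum_nonneg_eq_0_iff sum_nonneg vec_eq_iff)
  have "det U \<noteq> 0" using spd_det_pos[OF K] unfolding U by (auto simp: det_mul)
  then have inv: "invertible U" "invertible (transpose U)" by (auto simp: invertible_det_nz)
  have "L = matrix_inv (transpose U) ** (transpose U ** L ** U) ** matrix_inv U"
    using matrix_inv_mult[OF inv(1)] matrix_inv_mult[OF inv(2)]
    by (metis matrix_mul_assoc matrix_mul_lid matrix_mul_rid)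
  then show "L = 0" using \<open>M = 0\<close> unfolding M_def
    by (simp add: bounded_bilinear.zero_left[OF bounded_bilinear_matrix_matrix_mult]
       bounded_bilinear.zero_right[OF bounded_bilinear_matrix_matrix_mult])
qed

section \<open>Change of variables\<close>

text \<open>A relabelling of coordinates, by which integrals, derivatives and determinants are
  carried over to the copy of \<open>real^'m\<close> with a well-ordered index type.\<close>

definition reindex :: "('k \<Rightarrow> 'm) \<Rightarrow> real^'m \<Rightarrow> real^'k" where
  "reindex r x = (\<chi> k. x $ r k)"

lemma linear_reindex: "linear (reindex r)"
  by (auto intro!: linearI simp: reindex_def vec_eq_iff)

lemma bounded_linear_reindex: "bounded_linear (reindex r :: real^'m \<Rightarrow> real^'k)"
  using linear_reindex[of r] by (simp add: linear_conv_bounded_linear)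

lemma borel_measurable_reindex [measurable]: "reindex r \<in> borel_measurable borel"
  by (intro borel_measurable_continuous_onI bounded_linear.continuous_on[OF bounded_linear_reindex] continuous_on_id)

lemma reindex_inv:
  assumes "bij r"
  shows "reindex r (reindex (inv r) x) = x" "reindex (inv r) (reindex r y) = y"
  using bij_inv_eq_iff[OF assms] assms by (auto simp: reindex_def vec_eq_iff bij_is_inj bij_is_surj surj_f_inv_f)

lemma prod_Basis_vec: "(\<Prod>b\<in>Basis. (x :: real^'n) \<bullet> b) = (\<Prod>i\<in>UNIV. x $ i)"
proof -
  have B: "Basis = (\<lambda>i. axis i 1 :: real^'n) ` UNIV" by (auto simp: Basis_vec_def)
  have "inj (\<lambda>i. axis i 1 :: real^'n)" by (auto simp: inj_def axis_eq_axis)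
  then show ?thesis unfolding B by (simp add: prod.reindex inner_axis)
qed

text \<open>Preimages of boxes are boxes with the same side lengths in another order, and Lebesgue
  measure is determined by its values on boxes.\<close>

lemma lborel_distr_reindex:
  fixes r :: "'k::finite \<Rightarrow> 'm::finite"
  assumes r: "bij r"
  shows "distr lborel borel (reindex r) = lborel"
proof (rule lborel_eqI[symmetric])
  fix l u :: "real^'k"
  assume le: "\<And>b. b \<in> Basis \<Longrightarrow> l \<bullet> b \<le> u \<bullet> b"
  have le': "l $ k \<le> u $ k" for k using le[of "axis k 1"] by (simp add: inner_axis)
  have "reindex r -` box l u = box (reindex (inv r) l) (reindex (inv r) u)"
    using bij_inv_eq_iff[OF r] r
    by (auto simp: mem_box_cart reindex_def bij_is_inj bij_is_surj inv_f_f) (metis bij_inv_eq_iff r)+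
  then have "emeasure (distr lborel borel (reindex r)) (box l u) = emeasure lborel (box (reindex (inv r) l) (reindex (inv r) u))"
    by (subst emeasure_distr) auto
  also have "\<dots> = ennreal (\<Prod>b\<in>Basis. (reindex (inv r) u - reindex (inv r) l) \<bullet> b)"
    by (rule emeasure_lborel_box) (auto simp: Basis_vec_def inner_axis reindex_def le')
  also have "(\<Prod>b\<in>Basis. (reindex (inv r) u - reindex (inv r) l) \<bullet> b) = (\<Prod>i\<in>UNIV. (u - l) $ inv r i)"
    by (simp add: prod_Basis_vec reindex_def)
  also have "\<dots> = (\<Prod>k\<in>UNIV. (u - l) $ k)"
    by (rule prod.reindex_bij_betw) (rule bij_imp_bij_inv[OF r])
  finally show "emeasure (distr lborel borel (reindex r)) (box l u) = ennreal (\<Prod>b\<in>Basis. (u - l) \<bullet> b)"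
    by (simp add: prod_Basis_vec)
qed simp

text \<open>Conjugation turns the transposition of \<open>a\<close> and \<open>b\<close> into that
  of \<open>f a\<close> and \<open>f b\<close>. The two permutations may live on different types, as
  they do in \<open>det_reindex\<close>.\<close>

lemma swapidseq_conj:
  assumes "bij f" "swapidseq n p"
  shows "swapidseq n (f \<circ> p \<circ> inv f)"
  using assms(2)
proof (induction rule: swapidseq.induct)
  case id
  then show ?case using assms(1) by (simp add: o_def bij_is_surj surj_f_inv_f id_def[symmetric])
next
  case (comp_Suc n p a b)
  have "f \<circ> Transposition.transpose a b \<circ> p = Transposition.transpose (f a) (f b) \<circ> (f \<circ> p)"
    using bij_is_inj[OF assms(1)] by (auto simp: fun_eq_iff Transposition.transpose_def inj_eq)
  then have "f \<circ> (Transposition.transpose a b \<circ> p) \<circ> inv f = Transposition.transpose (f a) (f b) \<circ> (f \<circ> p \<circ> inv f)"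
    by (simp add: o_assoc)
  moreover have "f a \<noteq> f b" using comp_Suc assms(1) by (simp add: bij_is_inj inj_eq)
  ultimately show ?case using swapidseq.comp_Suc[OF comp_Suc.IH, of "f a" "f b"] by metis
qed

lemma sign_conj:
  assumes "bij f" "permutation p"
  shows "sign (f \<circ> p \<circ> inv f) = sign p"
proof -
  obtain n where n: "swapidseq n p" using assms(2) by (auto simp: permutation_def)
  then show ?thesis
    using evenperm_unique[OF n refl] evenperm_unique[OF swapidseq_conj[OF assms(1) n] refl] by (simp add: sign_def)
qed

text \<open>Relabelling rows and columns alike conjugates the permutations of the Leibniz formula,
  which preserves their signs.\<close>

lemma det_reindex:
  fixes r :: "'k::finite \<Rightarrow> 'm::finite" and M :: "real^'m^'m"
  assumes r: "bij r"
  shows "det (\<chi> i j. M $ r i $ r j) = det M"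
proof -
  let ?c = "\<lambda>p. r \<circ> p \<circ> inv r"
  have b: "bij_betw ?c {p. p permutes UNIV} {p. p permutes UNIV}"
  proof (rule bij_betw_byWitness[where f'="\<lambda>p. inv r \<circ> p \<circ> r"])
    show "\<forall>p\<in>{p. p permutes UNIV}. inv r \<circ> ?c p \<circ> r = p"
      using r by (auto simp: fun_eq_iff bij_is_inj)
    show "\<forall>p\<in>{p. p permutes UNIV}. ?c (inv r \<circ> p \<circ> r) = p"
      using r by (auto simp: fun_eq_iff bij_is_surj surj_f_inv_f)
    show "?c ` {p. p permutes UNIV} \<subseteq> {p. p permutes UNIV}"
         "(\<lambda>p. inv r \<circ> p \<circ> r) ` {p. p permutes UNIV} \<subseteq> {p. p permutes UNIV}"
      using r bij_imp_bij_inv[OF r] by (auto intro!: bij_imp_permutes bij_comp dest!: permutes_bij)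
  qed
  have "det M = (\<Sum>p | p permutes UNIV. of_int (sign (?c p)) * (\<Prod>i\<in>UNIV. M $ i $ ?c p i))"
    unfolding det_def by (rule sum.reindex_bij_betw[OF b, symmetric])
  also have "\<dots> = (\<Sum>p | p permutes UNIV. of_int (sign p) * (\<Prod>i\<in>UNIV. M $ r i $ r (p i)))"
  proof (rule sum.cong[OF refl])
    fix p :: "'k \<Rightarrow> 'k"
    assume p: "p \<in> {p. p permutes UNIV}"
    have "(\<Prod>i\<in>UNIV. M $ i $ ?c p i) = (\<Prod>i\<in>UNIV. M $ r i $ ?c p (r i))"
      by (rule prod.reindex_bij_betw[symmetric]) (rule r)
    moreover have "sign (?c p) = sign p"
      using p by (intro sign_conj r) (auto intro: permutes_imp_permutation[of UNIV])
    ultimately show "of_int (sign (?c p)) * (\<Prod>i\<in>UNIV. M $ i $ ?c p i) = of_int (sign p) * (\<Prod>i\<in>UNIV. M $ r i $ r (p i))"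
      using r by (simp add: bij_is_inj)
  qed
  finally show ?thesis by (simp add: det_def)
qed

text \<open>A bridge from the pair "absolutely integrable with integral \<open>b\<close>", in which
  the classical change of variables formula is phrased, to nonnegative integrals with respect to
  \<open>lborel\<close>.\<close>

lemma absolutely_integrable_nonneg_iff:
  fixes f :: "'n::euclidean_space \<Rightarrow> real"
  assumes nn: "\<And>x. x \<in> S \<Longrightarrow> 0 \<le> f x" and meas: "(\<lambda>x. indicator S x * f x) \<in> borel_measurable borel"
  shows "f absolutely_integrable_on S \<and> integral S f = b
    \<longleftrightarrow> 0 \<le> b \<and> (\<integral>\<^sup>+x. ennreal (indicator S x * f x) \<partial>lborel) = ennreal b"
proof -
  let ?f = "\<lambda>x. indicator S x * f x"
  have nn': "0 \<le> ?f x" for x using nn by (auto simp: indicator_def)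
  have meas': "?f \<in> borel_measurable lebesgue"
    using meas by (intro measurable_completion) simp
  have int: "f absolutely_integrable_on S \<longleftrightarrow> integrable lebesgue ?f"
    by (simp add: set_integrable_def)
  have eq: "(LINT x|lebesgue. ?f x) = integral S f" if "f absolutely_integrable_on S"
    using set_lebesgue_integral_eq_integral(2)[OF that] by (simp add: set_lebesgue_integral_def)
  show ?thesis
  proof (intro iffI conjI)
    assume "f absolutely_integrable_on S \<and> integral S f = b"
    then have f: "f absolutely_integrable_on S" and b: "integral S f = b" by auto
    from nn_integral_eq_integral[where M=lebesgue and f="?f"] f nn'
    have "(\<integral>\<^sup>+x. ?f x \<partial>lebesgue) = ennreal (LINT x|lebesgue. ?f x)" by (auto simp: int)
    then show "(\<integral>\<^sup>+x. ?f x \<partial>lborel) = ennreal b" using eq[OF f] b by (simp add: nn_integral_completion)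
    show "0 \<le> b" using eq[OF f] b integral_nonneg_AE[where M=lebesgue and f="?f"] nn' by auto
  next
    assume *: "0 \<le> b \<and> (\<integral>\<^sup>+x. ?f x \<partial>lborel) = ennreal b"
    have "integrable lebesgue ?f"
      by (rule integrableI_nn_integral_finite[OF meas', of b]) (use * nn' in \<open>auto simp: nn_integral_completion\<close>)
    then show f: "f absolutely_integrable_on S" by (simp add: int)
    have "ennreal (LINT x|lebesgue. ?f x) = ennreal b"
      using * nn_integral_eq_integral[where M=lebesgue and f="?f"] \<open>integrable lebesgue ?f\<close> nn' by (auto simp: nn_integral_completion)
    moreover have "0 \<le> (LINT x|lebesgue. ?f x)" using nn' by (intro integral_nonneg_AE) auto
    ultimately show "integral S f = b" using * eq[OF f] by auto
  qed
qed

lemma nn_integral_change_of_variables_wellorder: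
  fixes T :: "real^'m::{finite,wellorder} \<Rightarrow> real^'m::_" and h :: "real^'m::_ \<Rightarrow> real"
  assumes E: "E \<in> sets borel"
    and der: "\<And>x. x \<in> E \<Longrightarrow> (T has_derivative T' x) (at x)" and inj: "inj_on T E"
    and nn: "\<And>y. y \<in> T ` E \<Longrightarrow> 0 \<le> h y"
    and m1: "(\<lambda>y. indicator (T ` E) y * h y) \<in> borel_measurable borel"
    and m2: "(\<lambda>x. indicator E x * (\<bar>det (matrix (T' x))\<bar> * h (T x))) \<in> borel_measurable borel"
  shows "(\<integral>\<^sup>+y. ennreal (indicator (T ` E) y * h y) \<partial>lborel)
    = (\<integral>\<^sup>+x. ennreal (indicator E x * (\<bar>det (matrix (T' x))\<bar> * h (T x))) \<partial>lborel)" (is "?L = ?R")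
proof -
  let ?g = "\<lambda>x. \<bar>det (matrix (T' x))\<bar> * h (T x)"
  \<comment> \<open>The formula concerns vector-valued integrands; the scalar function enters as a
    vector with one entry.\<close>
  have "?g absolutely_integrable_on E \<and> integral E ?g = b \<longleftrightarrow> h absolutely_integrable_on (T ` E) \<and> integral (T ` E) h = b" for b
    using has_absolute_integral_change_of_variables[of E T T' "\<lambda>y. vec (h y) :: real^1" "vec b"]
      has_derivative_at_withinI[OF der] inj E
    by (simp add: absolutely_integrable_on_1_iff integral_on_1_eq vec_eq_iff)
  \<comment> \<open>The two sides attain the same finite values; hence they are equal and finite, or
    both infinite.\<close>
  then have iff: "0 \<le> b \<and> ?R = ennreal b \<longleftrightarrow> 0 \<le> b \<and> ?L = ennreal b" for b
    using absolutely_integrable_nonneg_iff[of E ?g b] absolutely_integrable_nonneg_iff[of "T ` E" h b] nn m1 m2 by auto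
  show ?thesis
  proof (cases ?L)
    case (real b)
    then show ?thesis using iff[of b] by simp
  next
    case top
    then show ?thesis
    proof (cases ?R)
      case (real b)
      then show ?thesis using iff[of b] by simp
    qed simp
  qed
qed

text \<open>The library proves the change of variables formula only for vectors indexed by a well-ordered type;
  every finite type has a copy of this kind.\<close>

typedef 'm well_ordered = "UNIV :: 'm set" by simp

lemma bij_Rep_well_ordered: "bij Rep_well_ordered"
  by (metis Abs_well_ordered_inverse Rep_well_ordered_inverse UNIV_I bijI')

instance well_ordered :: (finite) finite
  by standard (metis bij_Rep_well_ordered bij_betw_finite finite)

instantiation well_ordered :: (finite) wellorder
begin

definition "x \<le> y \<longleftrightarrow> to_nat (Rep_well_ordered x) \<le> to_nat (Rep_well_ordered y)"
definition "x < y \<longleftrightarrow> to_nat (Rep_well_ordered x) < to_nat (Rep_well_ordered y)"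

instance
proof
  fix x y z :: "'a well_ordered" and P
  show "x \<le> y \<Longrightarrow> y \<le> x \<Longrightarrow> x = y"
    by (auto simp: less_eq_well_ordered_def Rep_well_ordered_inject)
  show "P x" if "\<And>x. (\<And>y. y < x \<Longrightarrow> P y) \<Longrightarrow> P x"
    by (induction x rule: measure_induct_rule[of "\<lambda>x. to_nat (Rep_well_ordered x)"])
      (use that in \<open>auto simp: less_well_ordered_def\<close>)
qed (auto simp: less_eq_well_ordered_def less_well_ordered_def)

end

text \<open>Conjugation of \<open>T\<close> by the relabelling, which preserves Lebesgue measure and
  the Jacobian determinant, reduces the claim to the well-ordered case.\<close>

theorem nn_integral_change_of_variables:
  fixes T :: "real^'m \<Rightarrow> real^'m" and h :: "real^'m \<Rightarrow> real"
  assumes E: "E \<in> sets borel"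
    and der: "\<And>x. x \<in> E \<Longrightarrow> (T has_derivative T' x) (at x)" and inj: "inj_on T E"
    and nn: "\<And>y. y \<in> T ` E \<Longrightarrow> 0 \<le> h y"
    and m1: "(\<lambda>y. indicator (T ` E) y * h y) \<in> borel_measurable borel"
    and m2: "(\<lambda>x. indicator E x * (\<bar>det (matrix (T' x))\<bar> * h (T x))) \<in> borel_measurable borel"
  shows "(\<integral>\<^sup>+y. ennreal (indicator (T ` E) y * h y) \<partial>lborel)
    = (\<integral>\<^sup>+x. ennreal (indicator E x * (\<bar>det (matrix (T' x))\<bar> * h (T x))) \<partial>lborel)"
proof -
  define r where "r = (Rep_well_ordered :: 'm well_ordered \<Rightarrow> 'm)"
  have r: "bij r" unfolding r_def by (rule bij_Rep_well_ordered)
  define R where "R = (reindex r :: real^'m \<Rightarrow> _)"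
  define R' where "R' = (reindex (inv r) :: _ \<Rightarrow> real^'m)"
  have RR [simp]: "R (R' x) = x" "R' (R y) = y" for x y
    unfolding R_def R'_def by (simp_all add: reindex_inv r)
  have [measurable]: "R \<in> borel_measurable borel" "R' \<in> borel_measurable borel"
    unfolding R_def R'_def by measurable
  have bl: "bounded_linear R" "bounded_linear R'"
    unfolding R_def R'_def by (rule bounded_linear_reindex)+
  have nn_R: "(\<integral>\<^sup>+x. f (R' x) \<partial>lborel) = (\<integral>\<^sup>+y. f y \<partial>lborel)" if [measurable]: "f \<in> borel_measurable borel" for f
  proof -
    have d: "lborel = distr lborel borel R" unfolding R_def using lborel_distr_reindex[OF r] by simp
    show ?thesis by (subst d) (simp add: nn_integral_distr)
  qed
  have R_im: "R ` X = R' -` X" for X by (auto simp: image_iff) (metis RR(1))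
  note RE = R_im[of E]
  have "(R \<circ> T \<circ> R') ` (R ` E) = R ` T ` E" by (simp add: image_image)
  note im = this[unfolded R_im[of "T ` E"]]
  have det: "det (matrix (\<lambda>v. R (T' x (R' v)))) = det (matrix (T' x))" if "x \<in> E" for x
  proof -
    have l: "linear (T' x)" using der[OF that] by (rule has_derivative_linear)
    have axis: "R' (axis j 1) = axis (r j) 1" for j
      using bij_is_inj[OF r] surj_f_inv_f[OF bij_is_surj[OF r]] by (auto simp: R'_def reindex_def axis_def vec_eq_iff)
    have "matrix (\<lambda>v. R (T' x (R' v))) = (\<chi> i j. matrix (T' x) $ r i $ r j)"
      by (simp add: axis matrix_def vec_eq_iff R_def reindex_def)
    then show ?thesis using det_reindex[OF r] by simp
  qed
  have ind2: "indicator ((R \<circ> T \<circ> R') ` (R ` E)) x = (indicator (T ` E) (R' x) :: real)" for x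
    unfolding im by (auto simp: indicator_def)
  have ind1: "indicator (R ` E) x = (indicator E (R' x) :: real)" for x
    unfolding RE by (auto simp: indicator_def)
  have ind_det: "indicator (R ` E) x * (\<bar>det (matrix (\<lambda>v. R (T' (R' x) (R' v))))\<bar> * h (R' ((R \<circ> T \<circ> R') x)))
      = indicator E (R' x) * (\<bar>det (matrix (T' (R' x)))\<bar> * h (T (R' x)))" for x
    unfolding ind1 by (cases "R' x \<in> E") (auto simp: det)
  have "(\<integral>\<^sup>+y. ennreal (indicator ((R \<circ> T \<circ> R') ` (R ` E)) y * h (R' y)) \<partial>lborel)
    = (\<integral>\<^sup>+x. ennreal (indicator (R ` E) x * (\<bar>det (matrix (\<lambda>v. R (T' (R' x) (R' v))))\<bar> * h (R' ((R \<circ> T \<circ> R') x)))) \<partial>lborel)"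
  proof (rule nn_integral_change_of_variables_wellorder)
    show "R ` E \<in> sets borel" unfolding RE using measurable_sets[of R' borel borel E] E by simp
    show "inj_on (R \<circ> T \<circ> R') (R ` E)"
    proof (rule inj_onI)
      fix a b
      assume "a \<in> R ` E" "b \<in> R ` E" and eq: "(R \<circ> T \<circ> R') a = (R \<circ> T \<circ> R') b"
      then obtain x y where xy: "a = R x" "b = R y" "x \<in> E" "y \<in> E" by auto
      then have "T x = T y" using arg_cong[OF eq, of R'] by simp
      then show "a = b" using inj xy by (auto dest: inj_onD)
    qed
    show "((R \<circ> T \<circ> R') has_derivative (\<lambda>v. R (T' (R' x) (R' v)))) (at x)" if "x \<in> R ` E" for x
    proof -
      have "R' x \<in> E" using that RE by auto
      from has_derivative_compose[OF bounded_linear_imp_has_derivative[OF bl(2)] der[OF this]]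
      have "((\<lambda>x. T (R' x)) has_derivative (\<lambda>v. T' (R' x) (R' v))) (at x)" .
      from bounded_linear.has_derivative[OF bl(1) this] show ?thesis by (simp add: o_def)
    qed
    show "0 \<le> h (R' y)" if "y \<in> (R \<circ> T \<circ> R') ` (R ` E)" for y
      using that nn by auto
    show "(\<lambda>y. indicator ((R \<circ> T \<circ> R') ` (R ` E)) y * h (R' y)) \<in> borel_measurable borel"
      unfolding ind2 using measurable_compose[OF _ m1, of R' borel] by simp
    show "(\<lambda>x. indicator (R ` E) x * (\<bar>det (matrix (\<lambda>v. R (T' (R' x) (R' v))))\<bar> * h (R' ((R \<circ> T \<circ> R') x))))
        \<in> borel_measurable borel"
      unfolding ind_det using measurable_compose[OF _ m2, of R' borel] by simp
  qed
  then show ?thesis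
    unfolding ind_det ind2 using nn_R[of "\<lambda>y. ennreal (indicator (T ` E) y * h y)"]
      nn_R[of "\<lambda>x. ennreal (indicator E x * (\<bar>det (matrix (T' x))\<bar> * h (T x)))"] m1 m2 by simp
qed

section \<open>Differentiation under the integral\<close>

text \<open>By the mean value theorem the difference quotients are bounded by \<open>C\<close>, a
  constant that is integrable for a finite measure; so dominated convergence applies along every
  sequence tending to 0.\<close>

lemma (in finite_measure) has_real_derivative_integral:
  fixes G :: "'a \<Rightarrow> real \<Rightarrow> real"
  assumes d: "0 < d"
    and meas: "\<And>t. \<bar>t\<bar> < d \<Longrightarrow> (\<lambda>p. G p t) \<in> borel_measurable M"
    and bound: "\<And>p t. p \<in> space M \<Longrightarrow> \<bar>t\<bar> < d \<Longrightarrow> \<bar>G p t\<bar> \<le> B"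
    and der: "\<And>p t. p \<in> space M \<Longrightarrow> \<bar>t\<bar> < d \<Longrightarrow> (G p has_real_derivative G' p t) (at t)"
    and bound': "\<And>p t. p \<in> space M \<Longrightarrow> \<bar>t\<bar> < d \<Longrightarrow> \<bar>G' p t\<bar> \<le> C"
  shows "((\<lambda>t. \<integral>p. G p t \<partial>M) has_real_derivative (\<integral>p. G' p 0 \<partial>M)) (at 0)"
proof -
  have int: "integrable M (\<lambda>p. G p t)" if "\<bar>t\<bar> < d" for t
    using meas[OF that] bound that by (intro integrable_const_bound[of _ B]) auto
  have mvt: "\<bar>(G p t - G p 0) / t\<bar> \<le> C" if p: "p \<in> space M" and t: "\<bar>t\<bar> < d" "t \<noteq> 0" for p t
  proof -
    have "norm (G p t - G p 0) \<le> C * norm (t - 0)"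
      by (rule field_differentiable_bound[of "ball 0 d" "G p" "G' p"])
        (use p t d der bound' in \<open>auto intro: has_field_derivative_at_within\<close>)
    then show ?thesis using t(2) by (simp add: field_simps)
  qed
  show ?thesis
    unfolding DERIV_def
  proof -
    \<comment> \<open>Restricting the filter keeps every term of the sequences below inside the
      interval on which the bounds hold.\<close>
    have at: "at 0 = at (0::real) within ball 0 d" using d by (intro at_within_open[symmetric]) auto
    show "(\<lambda>h. ((\<integral>p. G p (0 + h) \<partial>M) - (\<integral>p. G p 0 \<partial>M)) / h) \<midarrow>0\<rightarrow> (\<integral>p. G' p 0 \<partial>M)"
      unfolding at tendsto_at_iff_sequentially
    proof (intro allI impI)
      fix X :: "nat \<Rightarrow> real"
      assume X: "\<forall>i. X i \<in> ball 0 d - {0}" "X \<longlonglongrightarrow> 0"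
      then have X': "\<bar>X i\<bar> < d" "X i \<noteq> 0" for i by (auto simp: dist_real_def)
      have lim: "(\<lambda>i. (G p (X i) - G p 0) / X i) \<longlonglongrightarrow> G' p 0" if "p \<in> space M" for p
      proof -
        have "((\<lambda>h. (G p (0 + h) - G p 0) / h) \<longlongrightarrow> G' p 0) (at 0 within ball 0 d)"
          using der[OF that, of 0] d unfolding DERIV_def at[symmetric] by simp
        then show ?thesis using X unfolding tendsto_at_iff_sequentially by (auto simp: o_def)
      qed
      have meas_q: "(\<lambda>p. (G p (X i) - G p 0) / X i) \<in> borel_measurable M" for i
        using meas[of "X i"] meas[of 0] X' d by auto
      have "(\<lambda>i. \<integral>p. (G p (X i) - G p 0) / X i \<partial>M) \<longlonglongrightarrow> (\<integral>p. G' p 0 \<partial>M)"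
      proof (rule integral_dominated_convergence[where w="\<lambda>_. C"])
        show "(\<lambda>p. G' p 0) \<in> borel_measurable M"
          by (rule borel_measurable_LIMSEQ_real[OF lim meas_q])
      qed (use meas_q lim mvt X' in auto)
      moreover have "(\<integral>p. (G p (X i) - G p 0) / X i \<partial>M) = ((\<integral>p. G p (X i) \<partial>M) - (\<integral>p. G p 0 \<partial>M)) / X i" for i
        using int[of "X i"] int[of 0] X' d by simp
      then have "(\<lambda>i. \<integral>p. (G p (X i) - G p 0) / X i \<partial>M) = (\<lambda>i. ((\<integral>p. G p (X i) \<partial>M) - (\<integral>p. G p 0 \<partial>M)) / X i)"
        by (rule ext)
      ultimately show "((\<lambda>h. ((\<integral>p. G p (0 + h) \<partial>M) - (\<integral>p. G p 0 \<partial>M)) / h) \<circ> X) \<longlonglongrightarrow> (\<integral>p. G' p 0 \<partial>M)"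
        by (simp only: o_def add_0_left)
    qed
  qed
qed

section \<open>Charts\<close>

locale atlas =
  fixes A :: "('a::{t2_space, second_countable_topology}, 'e::euclidean_space) chart set"
  assumes atlas: "smooth_atlas A"
begin

lemma open_chart_domain: "c \<in> A \<Longrightarrow> open (fst c)"
  and open_chart_image: "c \<in> A \<Longrightarrow> open (snd c ` fst c)"
  and chart_homeomorphism: "c \<in> A \<Longrightarrow> homeomorphism (fst c) (snd c ` fst c) (snd c) (chart_inv c)"
  and charts_cover: "(\<Union>c\<in>A. fst c) = UNIV"
  and smooth_transition: "c \<in> A \<Longrightarrow> d \<in> A \<Longrightarrow> smooth_on (transition c d) (snd c ` (fst c \<inter> fst d))"
  using atlas unfolding smooth_atlas_def by blast+

lemma continuous_on_chart: "c \<in> A \<Longrightarrow> continuous_on (fst c) (snd c)"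
  and continuous_on_chart_inv: "c \<in> A \<Longrightarrow> continuous_on (snd c ` fst c) (chart_inv c)"
  and chart_inv_chart: "c \<in> A \<Longrightarrow> p \<in> fst c \<Longrightarrow> chart_inv c (snd c p) = p"
  and chart_chart_inv: "c \<in> A \<Longrightarrow> x \<in> snd c ` fst c \<Longrightarrow> snd c (chart_inv c x) = x"
  and chart_inv_in: "c \<in> A \<Longrightarrow> x \<in> snd c ` fst c \<Longrightarrow> chart_inv c x \<in> fst c"
  using chart_homeomorphism[of c] unfolding homeomorphism_def by auto

lemma inj_on_chart: "c \<in> A \<Longrightarrow> inj_on (snd c) (fst c)"
  by (metis chart_inv_chart inj_onI)

lemma chart_at: "chart_at A p \<in> A" "p \<in> fst (chart_at A p)"
proof -
  have "\<exists>c. c \<in> A \<and> p \<in> fst c" using charts_cover by blast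
  from someI_ex[OF this] show "chart_at A p \<in> A" "p \<in> fst (chart_at A p)"
    unfolding chart_at_def by auto
qed

lemma chart_image_eq:
  assumes "c \<in> A" "S \<subseteq> fst c"
  shows "snd c ` S = snd c ` fst c \<inter> chart_inv c -` S"
proof (intro equalityI subsetI)
  fix x assume "x \<in> snd c ` S"
  then obtain p where "p \<in> S" "x = snd c p" by auto
  then show "x \<in> snd c ` fst c \<inter> chart_inv c -` S" using assms chart_inv_chart[of c p] by auto
next
  fix x assume "x \<in> snd c ` fst c \<inter> chart_inv c -` S"
  then show "x \<in> snd c ` S" using chart_chart_inv[OF assms(1), of x] by (metis IntE image_eqI vimageE)
qed

lemma chart_inv_image_eq:
  assumes "c \<in> A" "S \<subseteq> snd c ` fst c"
  shows "chart_inv c ` S = fst c \<inter> snd c -` S"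
proof (intro equalityI subsetI)
  fix p assume "p \<in> chart_inv c ` S"
  then obtain x where "x \<in> S" "p = chart_inv c x" by auto
  then show "p \<in> fst c \<inter> snd c -` S" using assms chart_chart_inv[of c x] chart_inv_in[of c x] by auto
next
  fix p assume "p \<in> fst c \<inter> snd c -` S"
  then show "p \<in> chart_inv c ` S" using chart_inv_chart[OF assms(1), of p] by (metis IntE image_eqI vimageE)
qed

lemma open_chart_image_subset:
  assumes "c \<in> A" "open U" "U \<subseteq> fst c"
  shows "open (snd c ` U)"
  unfolding chart_image_eq[OF assms(1,3)]
  using continuous_open_preimage[OF continuous_on_chart_inv open_chart_image] assms by blast

lemma open_chart_inv_image:
  assumes "c \<in> A" "open S" "S \<subseteq> snd c ` fst c"
  shows "open (chart_inv c ` S)" "chart_inv c ` S \<subseteq> fst c"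
  unfolding chart_inv_image_eq[OF assms(1,3)]
  using continuous_open_preimage[OF continuous_on_chart open_chart_domain] assms by blast+

lemma chart_image_chart_inv:
  assumes "c \<in> A" "S \<subseteq> snd c ` fst c"
  shows "snd c ` chart_inv c ` S = S"
proof -
  have "(\<lambda>x. snd c (chart_inv c x)) ` S = (\<lambda>x. x) ` S"
    using assms by (intro image_cong) (auto intro: chart_chart_inv)
  then show ?thesis by (simp add: image_image)
qed

lemma transition_chart: "c \<in> A \<Longrightarrow> p \<in> fst c \<Longrightarrow> transition c d (snd c p) = snd d p"
  by (simp add: transition_def chart_inv_chart)

lemma Ck_on_transition: "c \<in> A \<Longrightarrow> d \<in> A \<Longrightarrow> Ck_on k (transition c d) (snd c ` (fst c \<inter> fst d))"
  using smooth_transition by (auto simp: smooth_on_def)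

lemma open_overlap: "c \<in> A \<Longrightarrow> d \<in> A \<Longrightarrow> open (snd c ` (fst c \<inter> fst d))"
  by (intro open_chart_image_subset) (auto intro: open_chart_domain)

lemma has_derivative_transition:
  assumes "c \<in> A" "d \<in> A" "p \<in> fst c \<inter> fst d"
  shows "(transition c d has_derivative frechet_derivative (transition c d) (at (snd c p))) (at (snd c p))"
  using Ck_on_SucD_derivative[OF Ck_on_transition[OF assms(1,2)]] assms(3) by blast

lemma chart_inv_measurable:
  assumes "c \<in> A"
  shows "(\<lambda>x. if x \<in> snd c ` fst c then chart_inv c x else undefined) \<in> borel_measurable borel"
  using continuous_on_chart_inv[OF assms] open_chart_image[OF assms]
  by (intro borel_measurable_continuous_on_if) auto

lemma chart_image_borel:
  assumes "c \<in> A" "E \<in> sets borel" "E \<subseteq> fst c"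
  shows "snd c ` E \<in> sets borel"
proof -
  have "snd c ` E = snd c ` fst c \<inter> (\<lambda>x. if x \<in> snd c ` fst c then chart_inv c x else undefined) -` E"
    unfolding chart_image_eq[OF assms(1,3)] by auto
  moreover have "(\<lambda>x. if x \<in> snd c ` fst c then chart_inv c x else undefined) -` E \<in> sets borel"
    using measurable_sets[OF chart_inv_measurable[OF assms(1)] assms(2)] by simp
  ultimately show ?thesis using open_chart_image[OF assms(1)] by auto
qed

end

section \<open>Consequences of compactness: uniform constants and finite covers by coordinate
  balls\<close>

locale compact_atlas = atlas A
  for A :: "('a::{t2_space, second_countable_topology}, 'e::euclidean_space) chart set" +
  assumes compact_UNIV: "compact (UNIV :: 'a set)"
begin

text \<open>A finite subcover and the smallest radius and largest bound belonging to it. Statements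
  that ask for a radius only take a predicate \<open>Q\<close> that ignores its bound.\<close>

lemma uniform_over_points:
  assumes "\<And>p::'a. \<exists>U. open U \<and> p \<in> U \<and> (\<exists>d>0::real. \<exists>B::real. \<forall>q\<in>U. Q q d B)"
    and mono: "\<And>q d B d' B'. Q q d B \<Longrightarrow> 0 < d' \<Longrightarrow> d' \<le> d \<Longrightarrow> B \<le> B' \<Longrightarrow> Q q d' B'"
  obtains d B where "0 < d" "\<And>q. Q q d B"
proof -
  from assms(1) obtain U d B where U: "\<And>p. open (U p)" "\<And>p. p \<in> U p"
    and dB: "\<And>p. (0::real) < d p" "\<And>p q. q \<in> U p \<Longrightarrow> Q q (d p) (B p)"
    by metis
  have "UNIV \<subseteq> (\<Union>p\<in>UNIV. U p)" using U(2) by auto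
  then obtain F where F: "finite F" "UNIV \<subseteq> (\<Union>p\<in>F. U p)"
    using compactE_image[OF compact_UNIV, of UNIV U] U(1) by metis
  then have "F \<noteq> {}" by auto
  define d0 where "d0 = Min (d ` F)"
  define B0 where "B0 = Max (B ` F)"
  have "0 < d0" using F \<open>F \<noteq> {}\<close> dB by (simp add: d0_def)
  moreover have "Q q d0 B0" for q
  proof -
    obtain p where p: "p \<in> F" "q \<in> U p" using F by blast
    show ?thesis
      by (rule mono[OF dB(2)[OF p(2)] \<open>0 < d0\<close>]) (use F p in \<open>auto simp: d0_def B0_def\<close>)
  qed
  ultimately show thesis by (rule that)
qed

lemma coordinate_ball:
  obtains r where "0 < r" "cball (snd (chart_at A p) p) (3 * r) \<subseteq> snd (chart_at A p) ` fst (chart_at A p)"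
proof -
  obtain e where "0 < e" "cball (snd (chart_at A p) p) e \<subseteq> snd (chart_at A p) ` fst (chart_at A p)"
    using open_contains_cball[of "snd (chart_at A p) ` fst (chart_at A p)"] open_chart_image[OF chart_at(1)[of p]]
      chart_at(2)[of p] by blast
  then show thesis using that[of "e / 3"] by simp
qed

text \<open>The balls of radius \<open>r i\<close> cover; the larger concentric balls inside the
  chart leave room for points to move under a variation. The sets \<open>D i\<close> make the cover
  disjoint while staying Borel, so that measures and integrals can be summed over them.\<close>

lemma coordinate_cover:
  obtains n :: nat and c x r D where
    "\<And>i. i < n \<Longrightarrow> c i \<in> A" "\<And>i. i < n \<Longrightarrow> 0 < r i"
    "\<And>i. i < n \<Longrightarrow> cball (x i) (3 * r i) \<subseteq> snd (c i) ` fst (c i)"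
    "\<And>i. i < n \<Longrightarrow> D i \<in> sets borel" "\<And>i. i < n \<Longrightarrow> D i \<subseteq> chart_inv (c i) ` ball (x i) (r i)"
    "disjoint_family_on D {..<n}" "(\<Union>i<n. D i) = UNIV" "(\<Union>i<n. chart_inv (c i) ` ball (x i) (r i)) = UNIV"
proof -
  let ?c = "chart_at A"
  have "\<forall>p. \<exists>r>0. cball (snd (?c p) p) (3 * r) \<subseteq> snd (?c p) ` fst (?c p)"
    using coordinate_ball by metis
  then obtain r where r: "\<And>p. 0 < r p" "\<And>p. cball (snd (?c p) p) (3 * r p) \<subseteq> snd (?c p) ` fst (?c p)" by metis
  define B where "B p = chart_inv (?c p) ` ball (snd (?c p) p) (r p)" for p
  have sub: "ball (snd (?c p) p) (r p) \<subseteq> snd (?c p) ` fst (?c p)" for p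
  proof -
    have "ball (snd (?c p) p) (r p) \<subseteq> cball (snd (?c p) p) (3 * r p)" using r(1)[of p] by (auto intro: order_trans)
    then show ?thesis using r(2)[of p] by blast
  qed
  have oB: "open (B p)" for p
    unfolding B_def by (rule open_chart_inv_image[OF chart_at(1)[of p] open_ball sub])
  have pB: "p \<in> B p" for p
    unfolding B_def using chart_inv_chart[OF chart_at[of p]] r(1)[of p] by (metis centre_in_ball imageI)
  have "UNIV \<subseteq> (\<Union>p\<in>UNIV. B p)" using pB by auto
  then obtain F where F: "finite F" "UNIV \<subseteq> (\<Union>p\<in>F. B p)"
    using compactE_image[OF compact_UNIV, of UNIV B] oB by metis
  obtain h where h: "bij_betw h {0..<card F} F" using ex_bij_betw_nat_finite[OF F(1)] by auto
  \<comment> \<open>\<open>disjointed\<close> acts on infinite sequences, so the finite family is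
    continued by empty sets.\<close>
  define B' where "B' i = (if i < card F then B (h i) else {})" for i
  have "h ` {..<card F} = F" using h by (auto simp: bij_betw_def lessThan_atLeast0)
  then have "(\<Union>p\<in>h ` {..<card F}. B p) = UNIV" using F(2) by (simp add: top.extremum_unique)
  then have cov: "(\<Union>i<card F. B (h i)) = UNIV" by simp
  show thesis
  proof (rule that[of "card F" "\<lambda>i. ?c (h i)" "\<lambda>i. r (h i)" "\<lambda>i. snd (?c (h i)) (h i)" "disjointed B'"])
    have "range B' \<subseteq> sets borel" using oB by (auto simp: B'_def)
    from sets.range_disjointed_sets[OF this] show "disjointed B' i \<in> sets borel" for i by auto
    show "disjointed B' i \<subseteq> chart_inv (?c (h i)) ` ball (snd (?c (h i)) (h i)) (r (h i))" if "i < card F" for i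
      using disjointed_subset[of B' i] that by (auto simp: B'_def B_def)
    show "disjoint_family_on (disjointed B') {..<card F}"
      using disjoint_family_disjointed[of B'] by (auto simp: disjoint_family_on_def)
    have "p \<in> (\<Union>i<card F. disjointed B' i)" for p
    proof -
      obtain i where "i < card F" "p \<in> B (h i)" using cov by blast
      then have "p \<in> (\<Union>i. B' i)" unfolding B'_def by auto
      then obtain j where j: "p \<in> disjointed B' j" unfolding UN_disjointed_eq[of B', symmetric] by auto
      then have "j < card F" using disjointed_subset[of B' j] by (auto simp: B'_def split: if_splits)
      then show ?thesis using j by auto
    qed
    then show "(\<Union>i<card F. disjointed B' i) = UNIV" by blast
    show "(\<Union>i<card F. chart_inv (?c (h i)) ` ball (snd (?c (h i)) (h i)) (r (h i))) = UNIV"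
      using cov by (simp add: B_def)
  qed (use r chart_at in auto)
qed

end

section \<open>The Riemannian measure\<close>

locale riemannian = atlas A for A :: "('a::{t2_space, second_countable_topology}, real^'m) chart set" +
  fixes g :: "('a, 'm) metric_components"
  assumes metric: "riemannian_metric A g"
begin

lemma metric_symmetric: "c \<in> A \<Longrightarrow> p \<in> fst c \<Longrightarrow> transpose (g c p) = g c p"
  and metric_pos_def: "c \<in> A \<Longrightarrow> p \<in> fst c \<Longrightarrow> v \<noteq> 0 \<Longrightarrow> 0 < v \<bullet> (g c p *v v)"
  and metric_change: "c \<in> A \<Longrightarrow> d \<in> A \<Longrightarrow> p \<in> fst c \<inter> fst d \<Longrightarrow>
        g c p = transpose (jacobian_transition c d p) ** g d p ** jacobian_transition c d p"
  and smooth_metric: "c \<in> A \<Longrightarrow> smooth_on (g c \<circ> chart_inv c) (snd c ` fst c)"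
  using metric unfolding riemannian_metric_def by blast+

lemma det_metric_pos: "c \<in> A \<Longrightarrow> p \<in> fst c \<Longrightarrow> 0 < det (g c p)"
  using metric_symmetric metric_pos_def by (intro spd_det_pos)

lemma invertible_metric: "c \<in> A \<Longrightarrow> p \<in> fst c \<Longrightarrow> invertible (g c p)"
  using det_metric_pos[of c p] by (simp add: invertible_det_nz)

lemma Ck_on_metric: "c \<in> A \<Longrightarrow> Ck_on k (\<lambda>x. g c (chart_inv c x)) (snd c ` fst c)"
  using smooth_metric[of c] by (simp add: smooth_on_def o_def)

definition vol_density :: "('a, real^'m) chart \<Rightarrow> real^'m \<Rightarrow> real" where
  "vol_density c x = sqrt (det (g c (chart_inv c x)))"

lemma continuous_on_vol_density: "c \<in> A \<Longrightarrow> continuous_on (snd c ` fst c) (vol_density c)"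
  unfolding vol_density_def
  by (intro continuous_on_real_sqrt Ck_on_imp_continuous_on[OF Ck_on_det] Ck_on_metric open_chart_image)

lemma vol_density_pos: "c \<in> A \<Longrightarrow> x \<in> snd c ` fst c \<Longrightarrow> 0 < vol_density c x"
  unfolding vol_density_def using det_metric_pos[of c "chart_inv c x"] chart_inv_in by simp

lemma vol_density_change:
  assumes "c \<in> A" "d \<in> A" "p \<in> fst c \<inter> fst d"
  shows "vol_density c (snd c p) = \<bar>det (jacobian_transition c d p)\<bar> * vol_density d (snd d p)"
  unfolding vol_density_def using assms
  by (simp add: chart_inv_chart metric_change[OF assms] det_mul real_sqrt_mult)

lemma vol_density_measurable:
  assumes "c \<in> A" "S \<in> sets borel" "S \<subseteq> snd c ` fst c"
  shows "(\<lambda>x. indicator S x * vol_density c x) \<in> borel_measurable borel"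
  using borel_measurable_continuous_on_indicator[OF assms(2) continuous_on_subset[OF continuous_on_vol_density assms(3)]] assms(1)
  by simp

definition chart_volume :: "('a, real^'m) chart \<Rightarrow> 'a set \<Rightarrow> ennreal" where
  "chart_volume c E = (\<integral>\<^sup>+ x. ennreal (indicator (snd c ` E) x * vol_density c x) \<partial>lborel)"

text \<open>The density of the metric transported from the coordinates to the manifold. Off the
  chart image the density is 0, so the value \<open>undefined\<close> there carries no mass.\<close>

definition chart_measure :: "('a, real^'m) chart \<Rightarrow> 'a measure" where
  "chart_measure c = distr (density lborel (\<lambda>x. ennreal (indicator (snd c ` fst c) x * vol_density c x))) borel
     (\<lambda>x. if x \<in> snd c ` fst c then chart_inv c x else undefined)"

lemma sets_chart_measure [simp]: "sets (chart_measure c) = sets borel"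
  by (simp add: chart_measure_def)

lemma nn_integral_chart_measure:
  assumes c: "c \<in> A" and f: "f \<in> borel_measurable borel" and f0: "\<And>p. p \<notin> fst c \<Longrightarrow> f p = 0"
  shows "(\<integral>\<^sup>+p. f p \<partial>chart_measure c)
    = (\<integral>\<^sup>+x. ennreal (indicator (snd c ` fst c) x * vol_density c x) * f (chart_inv c x) \<partial>lborel)"
proof -
  have m: "(\<lambda>x. indicator (snd c ` fst c) x * vol_density c x) \<in> borel_measurable borel"
    using open_chart_image[OF c] by (intro vol_density_measurable c) auto
  note [measurable] = chart_inv_measurable[OF c] f m
  have "(\<integral>\<^sup>+p. f p \<partial>chart_measure c) = (\<integral>\<^sup>+x. ennreal (indicator (snd c ` fst c) x * vol_density c x)
      * f (if x \<in> snd c ` fst c then chart_inv c x else undefined) \<partial>lborel)"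
    unfolding chart_measure_def by (subst nn_integral_distr) (auto simp: nn_integral_density)
  also have "\<dots> = (\<integral>\<^sup>+x. ennreal (indicator (snd c ` fst c) x * vol_density c x) * f (chart_inv c x) \<partial>lborel)"
    by (rule nn_integral_cong) (auto simp: indicator_def)
  finally show ?thesis .
qed

lemma emeasure_chart_measure:
  assumes c: "c \<in> A" and E: "E \<in> sets borel" "E \<subseteq> fst c"
  shows "emeasure (chart_measure c) E = chart_volume c E"
proof -
  have "emeasure (chart_measure c) E = (\<integral>\<^sup>+p. indicator E p \<partial>chart_measure c)"
    using E by simp
  also have "\<dots> = (\<integral>\<^sup>+x. ennreal (indicator (snd c ` fst c) x * vol_density c x) * indicator E (chart_inv c x) \<partial>lborel)"
    using E by (intro nn_integral_chart_measure c) (auto simp: indicator_def)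
  also have "\<dots> = chart_volume c E"
    unfolding chart_volume_def
  proof (rule nn_integral_cong)
    fix x
    show "ennreal (indicator (snd c ` fst c) x * vol_density c x) * indicator E (chart_inv c x)
        = ennreal (indicator (snd c ` E) x * vol_density c x)"
      using E(2) chart_inv_chart[OF c] chart_chart_inv[OF c] by (auto simp: indicator_def)
  qed
  finally show ?thesis .
qed

text \<open>Change of variables along the transition map: its Jacobian determinant is exactly the
  factor relating the two densities \<open>sqrt (det g)\<close>.\<close>

lemma chart_volume_change:
  assumes c: "c \<in> A" and d: "d \<in> A" and E: "E \<in> sets borel" "E \<subseteq> fst c \<inter> fst d"
  shows "chart_volume c E = chart_volume d E"
proof -
  let ?T = "transition c d" and ?T' = "\<lambda>x. frechet_derivative (transition c d) (at x)"
  have T: "?T ` snd c ` E = snd d ` E"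
    unfolding image_image using E(2) by (intro image_cong transition_chart[OF c]) auto
  have eq: "indicator (snd c ` E) x * vol_density c x
      = indicator (snd c ` E) x * (\<bar>det (matrix (?T' x))\<bar> * vol_density d (?T x))" for x
  proof (cases "x \<in> snd c ` E")
    case True
    then obtain p where p: "p \<in> E" "x = snd c p" by auto
    then have "p \<in> fst c \<inter> fst d" using E(2) by auto
    then show ?thesis using vol_density_change[OF c d, of p] transition_chart[OF c, of p d] p
      by (simp add: jacobian_transition_def)
  qed simp
  have b: "snd c ` E \<in> sets borel" "snd d ` E \<in> sets borel"
    using E by (auto intro!: chart_image_borel c d)
  have "chart_volume d E = (\<integral>\<^sup>+ x. ennreal (indicator (?T ` snd c ` E) x * vol_density d x) \<partial>lborel)"
    by (simp add: chart_volume_def T)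
  also have "\<dots> = (\<integral>\<^sup>+ x. ennreal (indicator (snd c ` E) x * (\<bar>det (matrix (?T' x))\<bar> * vol_density d (?T x))) \<partial>lborel)"
  proof (rule nn_integral_change_of_variables)
    show "(?T has_derivative ?T' x) (at x)" if "x \<in> snd c ` E" for x
      using that E(2) by (auto intro!: has_derivative_transition c d)
    show "inj_on ?T (snd c ` E)"
      using inj_on_chart[OF d] E(2) transition_chart[OF c] by (auto simp: inj_on_def subset_iff)
    show "0 \<le> vol_density d y" if "y \<in> ?T ` snd c ` E" for y
      using that vol_density_pos[OF d, of y] E(2) unfolding T by fastforce
    show "(\<lambda>y. indicator (?T ` snd c ` E) y * vol_density d y) \<in> borel_measurable borel"
      unfolding T using E(2) b by (intro vol_density_measurable d) auto
    show "(\<lambda>x. indicator (snd c ` E) x * (\<bar>det (matrix (?T' x))\<bar> * vol_density d (?T x))) \<in> borel_measurable borel"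
      unfolding eq[symmetric] using E(2) b by (intro vol_density_measurable c) auto
  qed (rule b)
  also have "\<dots> = chart_volume c E" unfolding chart_volume_def eq ..
  finally show ?thesis by simp
qed

definition is_volume :: "'a measure \<Rightarrow> bool" where
  "is_volume \<mu> \<longleftrightarrow> sets \<mu> = sets borel \<and>
     (\<forall>c\<in>A. \<forall>E\<in>sets borel. E \<subseteq> fst c \<longrightarrow> emeasure \<mu> E = chart_volume c E)"

lemma riemannian_volume_eq: "riemannian_volume A g = (THE \<mu>. is_volume \<mu>)"
proof -
  have "ennreal (indicator S x * b) = ennreal b * indicator S x" for S :: "(real^'m) set" and x b
    by (simp add: indicator_def)
  then show ?thesis
    unfolding riemannian_volume_def is_volume_def chart_volume_def vol_density_def by simp
qed

end

locale compact_riemannian = riemannian A g + compact_atlas A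
  for A :: "('a::{t2_space, second_countable_topology}, real^'m) chart set" and g :: "('a, 'm) metric_components"
begin

abbreviation vol :: "'a measure" where "vol \<equiv> riemannian_volume A g"

text \<open>On each piece of a finite Borel partition the density of one chart is used;
  \<open>chart_volume_change\<close> shows that any other chart gives the same value. Every measure
  with the defining property decomposes over the same pieces, which yields uniqueness, and each
  piece lies in a compact coordinate ball, on which the density is bounded.\<close>

lemma volume_exists_unique: "\<exists>!\<mu>. is_volume \<mu>" "is_volume \<mu> \<Longrightarrow> finite_measure \<mu>"
proof -
  obtain n :: nat and c x r D where c: "\<And>i. i < n \<Longrightarrow> c i \<in> A" and r: "\<And>i. i < n \<Longrightarrow> 0 < r i"
    and ball: "\<And>i. i < n \<Longrightarrow> cball (x i) (3 * r i) \<subseteq> snd (c i) ` fst (c i)"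
    and D: "\<And>i. i < n \<Longrightarrow> D i \<in> sets borel" "\<And>i. i < n \<Longrightarrow> D i \<subseteq> chart_inv (c i) ` ball (x i) (r i)"
    and disj: "disjoint_family_on D {..<n}" and UD: "(\<Union>i<n. D i) = UNIV"
    by (rule coordinate_cover) blast
  have cb: "cball (x i) (r i) \<subseteq> snd (c i) ` fst (c i)" if "i < n" for i
    using ball[OF that] r[OF that] by (meson dual_order.trans mult_le_cancel_right1 not_less_iff_gr_or_eq one_le_numeral subset_cball)
  have Dc: "D i \<subseteq> fst (c i)" if "i < n" for i
    using D(2)[OF that] cb[OF that] chart_inv_in[OF c[OF that]] ball_subset_cball[of "x i" "r i"] by blast
  define \<nu> where "\<nu> E = (\<Sum>i<n. emeasure (chart_measure (c i)) (E \<inter> D i))" for E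
  define \<mu> where "\<mu> = measure_of UNIV (sets borel) \<nu>"
  have sets: "sets \<mu> = sets borel" unfolding \<mu>_def by (metis sets.sigma_sets_eq sets_measure_of space_borel sets.space_closed)
  have em: "emeasure \<mu> E = \<nu> E" if E: "E \<in> sets borel" for E
  proof (rule emeasure_measure_of[OF \<mu>_def])
    show "sets borel \<subseteq> Pow UNIV" by simp
    show "positive (sets \<mu>) \<nu>" by (simp add: positive_def \<nu>_def)
    show "countably_additive (sets \<mu>) \<nu>"
    proof (rule countably_additiveI)
      fix F :: "nat \<Rightarrow> 'a set"
      assume F: "range F \<subseteq> sets \<mu>" "disjoint_family F"
      have "(\<Sum>k. \<nu> (F k)) = (\<Sum>i<n. \<Sum>k. emeasure (chart_measure (c i)) (F k \<inter> D i))"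
        unfolding \<nu>_def by (intro suminf_sum summableI)
      also have "\<dots> = (\<Sum>i<n. emeasure (chart_measure (c i)) (\<Union>k. F k \<inter> D i))"
        using F D(1) unfolding sets
        by (intro sum.cong suminf_emeasure) (auto simp: disjoint_family_on_def)
      finally show "(\<Sum>k. \<nu> (F k)) = \<nu> (\<Union> (range F))" by (simp add: \<nu>_def)
    qed
    show "E \<in> sets \<mu>" using E sets by simp
  qed
  have "emeasure \<mu> E = chart_volume d E" if d: "d \<in> A" and E: "E \<in> sets borel" "E \<subseteq> fst d" for d E
  proof -
    have "emeasure \<mu> E = (\<Sum>i<n. emeasure (chart_measure (c i)) (E \<inter> D i))" using em[OF E(1)] by (simp add: \<nu>_def)
    also have "\<dots> = (\<Sum>i<n. emeasure (chart_measure d) (E \<inter> D i))"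
    proof (rule sum.cong[OF refl])
      fix i assume "i \<in> {..<n}"
      then have i: "i < n" by simp
      have ED: "E \<inter> D i \<in> sets borel" "E \<inter> D i \<subseteq> fst (c i) \<inter> fst d" using E D(1)[OF i] Dc[OF i] by auto
      then show "emeasure (chart_measure (c i)) (E \<inter> D i) = emeasure (chart_measure d) (E \<inter> D i)"
        using chart_volume_change[OF c[OF i] d ED] by (simp add: emeasure_chart_measure c i d)
    qed
    also have "\<dots> = emeasure (chart_measure d) (\<Union>i<n. E \<inter> D i)"
    proof (rule sum_emeasure)
      show "disjoint_family_on (\<lambda>i. E \<inter> D i) {..<n}" using disj unfolding disjoint_family_on_def by blast
    qed (use E D(1) in auto)
    also have "(\<Union>i<n. E \<inter> D i) = E" using UD by blast
    finally show ?thesis using emeasure_chart_measure[OF d E] by simp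
  qed
  then have 1: "is_volume \<mu>" using sets by (simp add: is_volume_def)
  \<comment> \<open>A candidate measure is determined by its values on subsets of the pieces, and
    those are prescribed by the charts.\<close>
  have dec: "emeasure \<mu>' E = (\<Sum>i<n. chart_volume (c i) (E \<inter> D i))" if "is_volume \<mu>'" "E \<in> sets borel" for \<mu>' E
  proof -
    have s: "sets \<mu>' = sets borel" using that by (simp add: is_volume_def)
    have "emeasure \<mu>' E = emeasure \<mu>' (\<Union>i<n. E \<inter> D i)" using UD by (intro arg_cong[where f="emeasure \<mu>'"]) blast
    also have "\<dots> = (\<Sum>i<n. emeasure \<mu>' (E \<inter> D i))"
    proof (rule sum_emeasure[symmetric])
      show "disjoint_family_on (\<lambda>i. E \<inter> D i) {..<n}" using disj unfolding disjoint_family_on_def by blast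
    qed (use that D(1) s in auto)
    also have "\<dots> = (\<Sum>i<n. chart_volume (c i) (E \<inter> D i))"
    proof (rule sum.cong[OF refl])
      fix i assume "i \<in> {..<n}"
      then have i: "i < n" by simp
      have "E \<inter> D i \<in> sets borel" "E \<inter> D i \<subseteq> fst (c i)" using that(2) D(1)[OF i] Dc[OF i] by auto
      then show "emeasure \<mu>' (E \<inter> D i) = chart_volume (c i) (E \<inter> D i)"
        using that(1) c[OF i] unfolding is_volume_def by blast
    qed
    finally show ?thesis .
  qed
  have "\<mu>' = \<mu>" if "is_volume \<mu>'" for \<mu>'
    using that 1 dec[OF that] dec[OF 1] by (intro measure_eqI) (auto simp: is_volume_def)
  with 1 show "\<exists>!\<mu>. is_volume \<mu>" by blast
  show "finite_measure \<mu>'" if v: "is_volume \<mu>'" for \<mu>'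
  proof (rule finite_measureI)
    have sp: "space \<mu>' = UNIV" using v sets_eq_imp_space_eq[of \<mu>' borel] by (simp add: is_volume_def)
    have "chart_volume (c i) (D i) < \<infinity>" if i: "i < n" for i
    proof -
      have "compact (vol_density (c i) ` cball (x i) (r i))"
        by (intro compact_continuous_image continuous_on_subset[OF continuous_on_vol_density] c i cb compact_cball)
      then obtain B where B: "\<And>y. y \<in> cball (x i) (r i) \<Longrightarrow> \<bar>vol_density (c i) y\<bar> \<le> B"
        by (metis bounded_iff compact_imp_bounded imageI real_norm_def)
      have sub: "snd (c i) ` D i \<subseteq> cball (x i) (r i)"
      proof -
        have "ball (x i) (r i) \<subseteq> snd (c i) ` fst (c i)" using cb[OF i] ball_subset_cball by blast
        from chart_image_chart_inv[OF c[OF i] this] show ?thesis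
          using image_mono[OF D(2)[OF i], of "snd (c i)"] ball_subset_cball[of "x i" "r i"] by blast
      qed
      have "chart_volume (c i) (D i) \<le> (\<integral>\<^sup>+ y. ennreal B * indicator (cball (x i) (r i)) y \<partial>lborel)"
        unfolding chart_volume_def
        by (rule nn_integral_mono) (use sub B in \<open>force simp: indicator_def intro!: ennreal_leI\<close>)
      also have "\<dots> < \<infinity>"
        using emeasure_bounded_finite[OF bounded_cball, of "x i" "r i"]
        by (subst nn_integral_cmult_indicator) (auto simp: ennreal_mult_less_top)
      finally show ?thesis .
    qed
    then show "emeasure \<mu>' (space \<mu>') \<noteq> \<infinity>"
      unfolding sp by (subst dec[OF v]) (force simp: less_top)+
  qed
qed

lemma is_volume_vol: "is_volume vol"
  unfolding riemannian_volume_eq by (rule theI'[OF volume_exists_unique(1)])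

sublocale vol: finite_measure vol
  by (rule volume_exists_unique(2)[OF is_volume_vol])

lemma sets_vol [simp, measurable_cong]: "sets vol = sets borel"
  and emeasure_vol: "c \<in> A \<Longrightarrow> E \<in> sets borel \<Longrightarrow> E \<subseteq> fst c \<Longrightarrow> emeasure vol E = chart_volume c E"
  using is_volume_vol by (auto simp: is_volume_def)

lemma space_vol [simp]: "space vol = UNIV"
  using sets_eq_imp_space_eq[OF sets_vol] by simp

text \<open>Restricted to the domain of \<open>c\<close>, the measures \<open>vol\<close> and
  \<open>chart_measure c\<close> agree on all Borel sets.\<close>

lemma nn_integral_vol_chart:
  assumes c: "c \<in> A" and f: "f \<in> borel_measurable borel" and f0: "\<And>p. p \<notin> fst c \<Longrightarrow> f p = 0"
  shows "(\<integral>\<^sup>+p. f p \<partial>vol)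
    = (\<integral>\<^sup>+x. ennreal (indicator (snd c ` fst c) x * vol_density c x) * f (chart_inv c x) \<partial>lborel)"
proof -
  have b: "fst c \<in> sets borel" using open_chart_domain[OF c] by simp
  have "restrict_space vol (fst c) = restrict_space (chart_measure c) (fst c)"
  proof (rule measure_eqI)
    show "sets (restrict_space vol (fst c)) = sets (restrict_space (chart_measure c) (fst c))"
      by (intro sets_restrict_space_cong) simp
    fix E assume "E \<in> sets (restrict_space vol (fst c))"
    then have E: "E \<in> sets borel" "E \<subseteq> fst c" using b by (auto simp: sets_restrict_space_iff)
    then show "emeasure (restrict_space vol (fst c)) E = emeasure (restrict_space (chart_measure c) (fst c)) E"
      using b by (simp add: emeasure_restrict_space emeasure_vol[OF c] emeasure_chart_measure[OF c])
  qed
  then have "(\<integral>\<^sup>+p. f p * indicator (fst c) p \<partial>vol) = (\<integral>\<^sup>+p. f p * indicator (fst c) p \<partial>chart_measure c)"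
    using nn_integral_restrict_space[of "fst c" vol f] nn_integral_restrict_space[of "fst c" "chart_measure c" f] b by simp
  moreover have "f p * indicator (fst c) p = f p" for p using f0[of p] by (cases "p \<in> fst c") auto
  ultimately show ?thesis using nn_integral_chart_measure[OF assms] by simp
qed

text \<open>A positive density on a nonempty open coordinate set cannot integrate to 0. This
  upgrades vanishing almost everywhere of a continuous function to vanishing everywhere.\<close>

lemma emeasure_vol_open_pos:
  assumes "open U" "p \<in> U"
  shows "0 < emeasure vol U"
proof -
  let ?c = "chart_at A p"
  note c = chart_at[of p]
  let ?U = "U \<inter> fst ?c"
  have oU: "open ?U" using assms open_chart_domain[OF c(1)] by auto
  have "emeasure vol ?U = chart_volume ?c ?U" using oU by (intro emeasure_vol c) auto
  moreover have "chart_volume ?c ?U \<noteq> 0"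
  proof
    assume "chart_volume ?c ?U = 0"
    moreover have oi: "open (snd ?c ` ?U)" by (intro open_chart_image_subset c oU) auto
    then have "(\<lambda>x. indicator (snd ?c ` ?U) x * vol_density ?c x) \<in> borel_measurable borel"
      by (intro vol_density_measurable c) auto
    ultimately have "AE x in lborel. ennreal (indicator (snd ?c ` ?U) x * vol_density ?c x) = 0"
      unfolding chart_volume_def by (subst (asm) nn_integral_0_iff_AE) auto
    then have "AE x in lborel. x \<notin> snd ?c ` ?U"
      by eventually_elim (use vol_density_pos[OF c(1)] in \<open>force simp: indicator_def\<close>)
    then have "emeasure lborel (snd ?c ` ?U) = 0"
      using oi by (subst (asm) AE_iff_measurable[OF _ refl]) auto
    then have "negligible (snd ?c ` ?U)"
      using oi by (simp add: negligible_iff_null_sets null_sets_def)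
    then show False using open_not_negligible[OF oi] assms c by auto
  qed
  moreover have "emeasure vol ?U \<le> emeasure vol U" using assms by (intro emeasure_mono) auto
  ultimately show ?thesis by (metis not_gr_zero le_zero_eq)
qed

end

section \<open>Parameter-dependent functions\<close>

context atlas
begin

text \<open>Joint regularity in coordinates and parameter, required in one chart around each point
  and near parameter 0 only. The neighbourhood may depend on the point; compactness makes it uniform
  in \<open>param_Ck_uniform\<close>.\<close>

definition param_Ck :: "nat \<Rightarrow> ('a \<Rightarrow> 'p::euclidean_space \<Rightarrow> 'b::real_normed_vector) \<Rightarrow> bool" where
  "param_Ck k G \<longleftrightarrow> (\<forall>p. \<exists>c\<in>A. p \<in> fst c \<and> (\<exists>W. open W \<and> (snd c p, 0) \<in> W \<and> W \<subseteq> snd c ` fst c \<times> UNIV \<and>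
     Ck_on k (\<lambda>z. G (chart_inv c (fst z)) (snd z)) W))"

lemma param_CkE:
  assumes "param_Ck k G"
  obtains c W where "c \<in> A" "p \<in> fst c" "open W" "(snd c p, 0) \<in> W" "W \<subseteq> snd c ` fst c \<times> UNIV"
    "Ck_on k (\<lambda>z. G (chart_inv c (fst z)) (snd z)) W"
  using assms unfolding param_Ck_def by meson

end

lemma has_derivative_slice:
  assumes "(H has_derivative (\<lambda>v. D v)) (at (x, \<tau>))"
  shows "((\<lambda>\<tau>. H (x, \<tau>)) has_derivative (\<lambda>v. D (0, v))) (at \<tau>)"
    and "((\<lambda>x. H (x, \<tau>)) has_derivative (\<lambda>v. D (v, 0))) (at x)"
proof -
  have 1: "((\<lambda>\<tau>. (x, \<tau>)) has_derivative (\<lambda>v. (0, v))) (at \<tau>)"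
    by (intro has_derivative_Pair has_derivative_const has_derivative_ident)
  have 2: "((\<lambda>x. (x, \<tau>)) has_derivative (\<lambda>v. (v, 0))) (at x)"
    by (intro has_derivative_Pair has_derivative_const has_derivative_ident)
  show "((\<lambda>\<tau>. H (x, \<tau>)) has_derivative (\<lambda>v. D (0, v))) (at \<tau>)"
    and "((\<lambda>x. H (x, \<tau>)) has_derivative (\<lambda>v. D (v, 0))) (at x)"
    using has_derivative_compose[OF 1 assms] has_derivative_compose[OF 2 assms] by auto
qed

context atlas
begin

lemma param_Ck_slice:
  assumes c: "c \<in> A" and G: "Ck_on (Suc k) (\<lambda>z. G (chart_inv c (fst z)) (snd z)) W" and z: "(x, \<tau>) \<in> W"
  shows "(G (chart_inv c x) has_derivative (\<lambda>v. dir_deriv (\<lambda>z. G (chart_inv c (fst z)) (snd z)) (0, v) (x, \<tau>))) (at \<tau>)"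
  using has_derivative_slice(1)[OF has_derivative_dir_deriv[OF G z]] by simp

lemma param_Ck_dir_deriv:
  assumes "param_Ck (Suc k) G"
  shows "param_Ck k (\<lambda>q. dir_deriv (G q) v)"
  unfolding param_Ck_def
proof
  fix p
  obtain c W where c: "c \<in> A" "p \<in> fst c" and W: "open W" "(snd c p, 0) \<in> W" "W \<subseteq> snd c ` fst c \<times> UNIV"
    and G: "Ck_on (Suc k) (\<lambda>z. G (chart_inv c (fst z)) (snd z)) W"
    using param_CkE[OF assms, of p] .
  have "Ck_on k (\<lambda>z. dir_deriv (G (chart_inv c (fst z))) v (snd z)) W"
  proof (rule Ck_on_cong[OF W(1) _ Ck_on_dir_deriv[OF G, of "(0, v)"]])
    fix z assume "z \<in> W"
    then show "dir_deriv (\<lambda>z. G (chart_inv c (fst z)) (snd z)) (0, v) z = dir_deriv (G (chart_inv c (fst z))) v (snd z)"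
      using dir_deriv_eq[OF param_Ck_slice[OF c(1) G, of "fst z" "snd z"]] by simp
  qed
  then show "\<exists>c\<in>A. p \<in> fst c \<and> (\<exists>W. open W \<and> (snd c p, 0) \<in> W \<and> W \<subseteq> snd c ` fst c \<times> UNIV \<and>
     Ck_on k (\<lambda>z. dir_deriv (G (chart_inv c (fst z))) v (snd z)) W)"
    using c W by blast
qed

lemma param_Ck_locally:
  fixes G :: "'a \<Rightarrow> 'p::euclidean_space \<Rightarrow> 'b::real_normed_vector"
  assumes "param_Ck k G"
  shows "\<exists>U. open U \<and> p \<in> U \<and> (\<exists>d>0. \<exists>B. \<forall>q\<in>U. \<forall>\<tau>\<in>ball 0 d. isCont (\<lambda>q. G q \<tau>) q \<and> norm (G q \<tau>) \<le> B \<and>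
    (k > 0 \<longrightarrow> (G q has_derivative (\<lambda>v. dir_deriv (G q) v \<tau>)) (at \<tau>)))"
proof -
  obtain c W where c: "c \<in> A" "p \<in> fst c" and W: "open W" "(snd c p, 0) \<in> W" "W \<subseteq> snd c ` fst c \<times> UNIV"
    and G: "Ck_on k (\<lambda>z. G (chart_inv c (fst z)) (snd z)) W"
    using param_CkE[OF assms, of p] .
  let ?H = "\<lambda>z. G (chart_inv c (fst z)) (snd z)"
  have cont: "continuous_on W ?H" using G by (rule Ck_on_imp_continuous_on)
  \<comment> \<open>Here the function differs by less than 1 from its value at the point
    \<open>(snd c p, 0)\<close>, which supplies the bound.\<close>
  define W' where "W' = W \<inter> ?H -` ball (?H (snd c p, 0)) 1"
  have W': "open W'" "(snd c p, 0) \<in> W'"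
    unfolding W'_def using continuous_open_preimage[OF cont W(1), of "ball (?H (snd c p, 0)) 1"] W by auto
  obtain X T where XT: "open X" "open T" "snd c p \<in> X" "0 \<in> T" "X \<times> T \<subseteq> W'"
    using open_prod_elim[OF W'] by (metis SigmaE2 prod.sel mem_Times_iff fst_conv snd_conv)
  obtain d where d: "0 < d" "ball 0 d \<subseteq> T" using openE[OF XT(2,4)] .
  define U where "U = fst c \<inter> snd c -` X"
  have "open U" unfolding U_def
    by (rule continuous_open_preimage[OF continuous_on_chart[OF c(1)] open_chart_domain[OF c(1)] XT(1)])
  moreover have "p \<in> U" using c XT by (simp add: U_def)
  moreover have "isCont (\<lambda>q. G q \<tau>) q \<and> norm (G q \<tau>) \<le> norm (?H (snd c p, 0)) + 1 \<and>
    (k > 0 \<longrightarrow> (G q has_derivative (\<lambda>v. dir_deriv (G q) v \<tau>)) (at \<tau>))" if q: "q \<in> U" and \<tau>: "\<tau> \<in> ball 0 d" for q \<tau>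
  proof (intro conjI impI)
    have inW: "(snd c q, \<tau>) \<in> W" if "q \<in> U" for q using that XT d \<tau> unfolding U_def W'_def by blast
    have eq: "G q \<tau> = ?H (snd c q, \<tau>)" if "q \<in> U" for q
      using that chart_inv_chart[OF c(1), of q] by (simp add: U_def)
    have "continuous_on U (\<lambda>q. ?H (snd c q, \<tau>))"
      by (rule continuous_on_compose2[OF cont])
        (use inW in \<open>auto intro!: continuous_intros continuous_on_subset[OF continuous_on_chart[OF c(1)]] simp: U_def\<close>)
    then have "continuous_on U (\<lambda>q. G q \<tau>)" using continuous_on_cong[OF refl eq, of U] by auto
    then show "isCont (\<lambda>q. G q \<tau>) q" using q \<open>open U\<close> by (simp add: continuous_on_eq_continuous_at)
    have "(snd c q, \<tau>) \<in> W'" using q \<tau> d XT unfolding U_def by blast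
    then have "dist (?H (snd c p, 0)) (?H (snd c q, \<tau>)) < 1" by (simp add: W'_def)
    then show "norm (G q \<tau>) \<le> norm (?H (snd c p, 0)) + 1"
      unfolding eq[OF q] dist_norm using norm_triangle_ineq2[of "?H (snd c q, \<tau>)" "?H (snd c p, 0)"]
      by (simp add: norm_minus_commute)
    assume "0 < k"
    then have "Ck_on (Suc 0) ?H W" using Ck_on_mono[OF G, of "Suc 0"] by simp
    from param_Ck_slice[OF c(1) this inW[OF q]]
    have "(G q has_derivative (\<lambda>v. dir_deriv ?H (0, v) (snd c q, \<tau>))) (at \<tau>)"
      using q chart_inv_chart[OF c(1), of q] by (simp add: U_def)
    then show "(G q has_derivative (\<lambda>v. dir_deriv (G q) v \<tau>)) (at \<tau>)"
      by (simp add: dir_deriv_eq[OF \<open>(G q has_derivative _) _\<close>])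
  qed
  ultimately show ?thesis using d(1) by blast
qed

end

context compact_atlas
begin

lemma param_Ck_uniform:
  fixes G :: "'a \<Rightarrow> 'p::euclidean_space \<Rightarrow> 'b::real_normed_vector"
  assumes "param_Ck k G"
  obtains d B where "0 < d" "\<And>\<tau>. \<tau> \<in> ball 0 d \<Longrightarrow> continuous_on UNIV (\<lambda>q. G q \<tau>)"
    "\<And>q \<tau>. \<tau> \<in> ball 0 d \<Longrightarrow> norm (G q \<tau>) \<le> B"
    "\<And>q \<tau>. \<tau> \<in> ball 0 d \<Longrightarrow> k > 0 \<Longrightarrow> (G q has_derivative (\<lambda>v. dir_deriv (G q) v \<tau>)) (at \<tau>)"
proof -
  obtain d B where "0 < d" and *: "\<And>q. \<forall>\<tau>\<in>ball 0 d. isCont (\<lambda>q. G q \<tau>) q \<and> norm (G q \<tau>) \<le> B \<and>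
    (k > 0 \<longrightarrow> (G q has_derivative (\<lambda>v. dir_deriv (G q) v \<tau>)) (at \<tau>))"
  proof (rule uniform_over_points[where Q="\<lambda>q d B. \<forall>\<tau>\<in>ball 0 d. isCont (\<lambda>q. G q \<tau>) q \<and> norm (G q \<tau>) \<le> B \<and>
    (k > 0 \<longrightarrow> (G q has_derivative (\<lambda>v. dir_deriv (G q) v \<tau>)) (at \<tau>))"])
    show "\<exists>U. open U \<and> p \<in> U \<and> (\<exists>d>0. \<exists>B. \<forall>q\<in>U. \<forall>\<tau>\<in>ball 0 d. isCont (\<lambda>q. G q \<tau>) q \<and> norm (G q \<tau>) \<le> B \<and>
    (k > 0 \<longrightarrow> (G q has_derivative (\<lambda>v. dir_deriv (G q) v \<tau>)) (at \<tau>)))" for p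
      by (rule param_Ck_locally[OF assms])
    fix q and d B d' B' :: real
    assume *: "\<forall>\<tau>\<in>ball 0 d. isCont (\<lambda>q. G q \<tau>) q \<and> norm (G q \<tau>) \<le> B \<and>
      (k > 0 \<longrightarrow> (G q has_derivative (\<lambda>v. dir_deriv (G q) v \<tau>)) (at \<tau>))" and "d' \<le> d" "B \<le> B'"
    then have "ball 0 d' \<subseteq> (ball 0 d :: 'p set)" by (intro subset_ball)
    with * \<open>B \<le> B'\<close> show "\<forall>\<tau>\<in>ball 0 d'. isCont (\<lambda>q. G q \<tau>) q \<and> norm (G q \<tau>) \<le> B' \<and>
      (k > 0 \<longrightarrow> (G q has_derivative (\<lambda>v. dir_deriv (G q) v \<tau>)) (at \<tau>))"
      by (meson order_trans subsetD)
  qed blast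
  then show thesis
    by (intro that[of d B]) (auto simp: continuous_on_eq_continuous_at)
qed

end

context compact_riemannian
begin

lemma has_real_derivative_integral_param:
  fixes G :: "'a \<Rightarrow> 'p::euclidean_space \<Rightarrow> real"
  assumes "param_Ck (Suc k) G"
  obtains d where "0 < d"
    "\<And>\<tau>. \<tau> \<in> ball 0 d \<Longrightarrow>
      ((\<lambda>s. \<integral>q. G q (\<tau> + s *\<^sub>R v) \<partial>vol) has_real_derivative (\<integral>q. dir_deriv (G q) v \<tau> \<partial>vol)) (at 0)"
proof -
  obtain d1 B1 where 1: "0 < d1" "\<And>\<tau>. \<tau> \<in> ball 0 d1 \<Longrightarrow> continuous_on UNIV (\<lambda>q. G q \<tau>)"
    "\<And>q \<tau>. \<tau> \<in> ball 0 d1 \<Longrightarrow> norm (G q \<tau>) \<le> B1"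
    "\<And>q \<tau>. \<tau> \<in> ball 0 d1 \<Longrightarrow> (G q has_derivative (\<lambda>v. dir_deriv (G q) v \<tau>)) (at \<tau>)"
    using param_Ck_uniform[OF assms] by (metis zero_less_Suc)
  obtain d2 B2 where 2: "0 < d2" "\<And>q \<tau>. \<tau> \<in> ball 0 d2 \<Longrightarrow> norm (dir_deriv (G q) v \<tau>) \<le> B2"
    using param_Ck_uniform[OF param_Ck_dir_deriv[OF assms, of v]] by metis
  show thesis
  proof (rule that[of "min d1 d2"])
    show "0 < min d1 d2" using 1 2 by simp
    fix \<tau> :: 'p assume \<tau>: "\<tau> \<in> ball 0 (min d1 d2)"
    \<comment> \<open>Small enough for \<open>\<tau> + s *\<^sub>R v\<close> to stay in the ball
      when \<open>\<bar>s\<bar> < e\<close>; the summand 1 covers the case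
      \<open>v = 0\<close>.\<close>
    define e where "e = (min d1 d2 - norm \<tau>) / (norm v + 1)"
    have nv: "0 < norm v + 1" by (simp add: add_nonneg_pos)
    have e: "0 < e" using \<tau> nv by (simp add: e_def)
    have in_ball: "\<tau> + s *\<^sub>R v \<in> ball 0 (min d1 d2)" if "\<bar>s\<bar> < e" for s
    proof -
      have "norm (\<tau> + s *\<^sub>R v) \<le> norm \<tau> + \<bar>s\<bar> * norm v" using norm_triangle_ineq[of \<tau> "s *\<^sub>R v"] by simp
      also have "\<bar>s\<bar> * norm v \<le> \<bar>s\<bar> * (norm v + 1)" by (simp add: mult_left_mono)
      also have "\<bar>s\<bar> * (norm v + 1) < e * (norm v + 1)" using that nv by simp
      also have "\<dots> = min d1 d2 - norm \<tau>" using nv by (simp add: e_def)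
      finally show ?thesis by simp
    qed
    have "((\<lambda>s. \<integral>q. G q (\<tau> + s *\<^sub>R v) \<partial>vol) has_real_derivative (\<integral>q. dir_deriv (G q) v (\<tau> + 0 *\<^sub>R v) \<partial>vol)) (at 0)"
    proof (rule vol.has_real_derivative_integral[OF e])
      fix s :: real assume s: "\<bar>s\<bar> < e"
      note b = in_ball[OF s]
      then show "(\<lambda>q. G q (\<tau> + s *\<^sub>R v)) \<in> borel_measurable vol"
        using borel_measurable_continuous_onI[OF 1(2)[of "\<tau> + s *\<^sub>R v"]] measurable_cong_sets[OF sets_vol refl] by auto
      fix q
      show "\<bar>G q (\<tau> + s *\<^sub>R v)\<bar> \<le> B1" using 1(3)[of "\<tau> + s *\<^sub>R v" q] b by simp
      show "\<bar>dir_deriv (G q) v (\<tau> + s *\<^sub>R v)\<bar> \<le> B2" using 2(2)[of "\<tau> + s *\<^sub>R v" q] b by simp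
      have D: "(G q has_derivative (\<lambda>w. dir_deriv (G q) w (\<tau> + s *\<^sub>R v))) (at (\<tau> + s *\<^sub>R v))"
        using b by (intro 1(4)) simp
      have "((\<lambda>s. \<tau> + s *\<^sub>R v) has_derivative (\<lambda>h. 0 + h *\<^sub>R v)) (at s)"
        by (intro has_derivative_add has_derivative_const has_derivative_scaleR_left has_derivative_ident)
      from has_derivative_compose[OF this] D
      have "((\<lambda>s. G q (\<tau> + s *\<^sub>R v)) has_derivative (\<lambda>h. dir_deriv (G q) (0 + h *\<^sub>R v) (\<tau> + s *\<^sub>R v))) (at s)" by blast
      moreover have "dir_deriv (G q) (0 + h *\<^sub>R v) (\<tau> + s *\<^sub>R v) = dir_deriv (G q) v (\<tau> + s *\<^sub>R v) * h" for h
        using linear_scale[OF has_derivative_linear[OF D], of h v] by simp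
      ultimately show "((\<lambda>s. G q (\<tau> + s *\<^sub>R v)) has_real_derivative dir_deriv (G q) v (\<tau> + s *\<^sub>R v)) (at s)"
        by (simp add: has_field_derivative_def)
    qed
    then show "((\<lambda>s. \<integral>q. G q (\<tau> + s *\<^sub>R v) \<partial>vol) has_real_derivative (\<integral>q. dir_deriv (G q) v \<tau> \<partial>vol)) (at 0)"
      by simp
  qed
qed

text \<open>The outer derivative sees the inner one on a neighbourhood of 0. Differentiation under
  the integral is therefore used at every small parameter for the inner derivative, and at 0 for the
  outer one.\<close>

lemma second_derivative_integral_param:
  fixes G :: "'a \<Rightarrow> 'p::euclidean_space \<Rightarrow> real"
  assumes "param_Ck 2 G"
  shows "deriv (\<lambda>t. deriv (\<lambda>s. \<integral>q. G q (t *\<^sub>R u + s *\<^sub>R v) \<partial>vol) 0) 0 = (\<integral>q. dir_deriv (dir_deriv (G q) v) u 0 \<partial>vol)"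
proof -
  have G: "param_Ck (Suc 1) G" using assms by (simp add: numeral_2_eq_2)
  obtain d where d: "0 < d" "\<And>\<tau>. \<tau> \<in> ball 0 d \<Longrightarrow>
      ((\<lambda>s. \<integral>q. G q (\<tau> + s *\<^sub>R v) \<partial>vol) has_real_derivative (\<integral>q. dir_deriv (G q) v \<tau> \<partial>vol)) (at 0)"
    using has_real_derivative_integral_param[OF G] by metis
  obtain d' where d': "0 < d'" "\<And>\<tau>. \<tau> \<in> ball 0 d' \<Longrightarrow>
      ((\<lambda>s. \<integral>q. dir_deriv (G q) v (\<tau> + s *\<^sub>R u) \<partial>vol) has_real_derivative (\<integral>q. dir_deriv (dir_deriv (G q) v) u \<tau> \<partial>vol)) (at 0)"
    using has_real_derivative_integral_param[of 0, OF param_Ck_dir_deriv[OF G, of v, unfolded One_nat_def]] by metis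
  have "open ((\<lambda>t::real. t *\<^sub>R u) -` ball 0 d)" by (intro open_vimage continuous_intros) auto
  then have ev: "eventually (\<lambda>t::real. t *\<^sub>R u \<in> ball 0 d) (nhds 0)"
    unfolding eventually_nhds using d(1) by (intro exI[of _ "(\<lambda>t. t *\<^sub>R u) -` ball 0 d"]) auto
  have "eventually (\<lambda>t. deriv (\<lambda>s. \<integral>q. G q (t *\<^sub>R u + s *\<^sub>R v) \<partial>vol) 0 = (\<integral>q. dir_deriv (G q) v (t *\<^sub>R u) \<partial>vol)) (nhds 0)"
    using ev by eventually_elim (rule DERIV_imp_deriv[OF d(2)])
  then have "deriv (\<lambda>t. deriv (\<lambda>s. \<integral>q. G q (t *\<^sub>R u + s *\<^sub>R v) \<partial>vol) 0) 0 = deriv (\<lambda>t. \<integral>q. dir_deriv (G q) v (t *\<^sub>R u) \<partial>vol) 0"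
    by (intro deriv_cong_ev refl)
  also have "\<dots> = (\<integral>q. dir_deriv (dir_deriv (G q) v) u 0 \<partial>vol)"
    using d'(2)[of 0] d'(1) by (intro DERIV_imp_deriv) simp
  finally show ?thesis .
qed

end

section \<open>Symmetry of second derivatives\<close>

text \<open>The mean value theorem in \<open>s\<close>, then in \<open>t\<close>. The left side is
  symmetric in the two variables, so exchanging their roles represents the same number by the other
  mixed derivative.\<close>

lemma double_difference_mvt:
  fixes F :: "real \<Rightarrow> real \<Rightarrow> real"
  assumes h: "0 < h"
    and F1: "\<And>s t. 0 \<le> s \<Longrightarrow> s \<le> h \<Longrightarrow> 0 \<le> t \<Longrightarrow> t \<le> h \<Longrightarrow> ((\<lambda>s. F s t) has_real_derivative F1 s t) (at s)"
    and F12: "\<And>s t. 0 \<le> s \<Longrightarrow> s \<le> h \<Longrightarrow> 0 \<le> t \<Longrightarrow> t \<le> h \<Longrightarrow> ((\<lambda>t. F1 s t) has_real_derivative F12 s t) (at t)"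
  obtains s t where "0 < s" "s < h" "0 < t" "t < h" "F h h - F h 0 - F 0 h + F 0 0 = h * h * F12 s t"
proof -
  have "\<exists>s>0. s < h \<and> (F h h - F h 0) - (F 0 h - F 0 0) = (h - 0) * (F1 s h - F1 s 0)"
    by (rule MVT2[OF h]) (use F1 h in \<open>auto intro!: DERIV_diff\<close>)
  then obtain s where s: "0 < s" "s < h" "(F h h - F h 0) - (F 0 h - F 0 0) = h * (F1 s h - F1 s 0)" by auto
  have "\<exists>t>0. t < h \<and> F1 s h - F1 s 0 = (h - 0) * F12 s t"
    by (rule MVT2[OF h]) (use F12 s h in auto)
  then obtain t where t: "0 < t" "t < h" "F1 s h - F1 s 0 = h * F12 s t" by auto
  show thesis by (rule that[OF s(1,2) t(1,2)]) (use s(3) t(3) in \<open>simp add: algebra_simps\<close>)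
qed

lemma has_real_derivative_along_line:
  fixes f :: "'e::euclidean_space \<Rightarrow> real"
  assumes "Ck_on (Suc k) f W" "z + s *\<^sub>R a \<in> W"
  shows "((\<lambda>s. f (z + s *\<^sub>R a)) has_real_derivative dir_deriv f a (z + s *\<^sub>R a)) (at s)"
proof -
  have D: "(f has_derivative (\<lambda>v. dir_deriv f v (z + s *\<^sub>R a))) (at (z + s *\<^sub>R a))"
    by (rule has_derivative_dir_deriv[OF assms])
  have "((\<lambda>s. z + s *\<^sub>R a) has_derivative (\<lambda>h. 0 + h *\<^sub>R a)) (at s)"
    by (intro has_derivative_add has_derivative_const has_derivative_scaleR_left has_derivative_ident)
  from has_derivative_compose[OF this D]
  have "((\<lambda>s. f (z + s *\<^sub>R a)) has_derivative (\<lambda>h. dir_deriv f (0 + h *\<^sub>R a) (z + s *\<^sub>R a))) (at s)" .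
  moreover have "dir_deriv f (0 + h *\<^sub>R a) (z + s *\<^sub>R a) = dir_deriv f a (z + s *\<^sub>R a) * h" for h
    using linear_scale[OF has_derivative_linear[OF D], of h a] by simp
  ultimately show ?thesis by (simp add: has_field_derivative_def)
qed

text \<open>Schwarz's theorem. It is needed to exchange the parameter derivative of a variation with
  the spatial derivative in its differential.\<close>

lemma dir_deriv_commute_real:
  fixes f :: "'e::euclidean_space \<Rightarrow> real"
  assumes W: "open W" "z \<in> W" and f: "Ck_on 2 f W"
  shows "dir_deriv (dir_deriv f a) b z = dir_deriv (dir_deriv f b) a z" (is "?P = ?Q")
proof (rule ccontr)
  assume "?P \<noteq> ?Q"
  \<comment> \<open>Half of the supposed gap. Near \<open>z\<close> each mixed derivative stays
    within \<open>\<eta>\<close> of its value at \<open>z\<close>, yet the two agree at suitable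
    nearby points.\<close>
  define \<eta> where "\<eta> = \<bar>?P - ?Q\<bar> / 2"
  have \<eta>: "0 < \<eta>" using \<open>?P \<noteq> ?Q\<close> by (simp add: \<eta>_def)
  have f1: "Ck_on (Suc 0) (dir_deriv f a) W" for a
    by (rule Ck_on_dir_deriv) (use f in \<open>simp only: numeral_2_eq_2\<close>)
  have f2: "continuous_on W (dir_deriv (dir_deriv f a) b)" for a b
    using Ck_on_dir_deriv[OF f1] by simp
  have f0: "Ck_on (Suc 0) f W" using f by (rule Ck_on_mono) simp
  define W' where "W' = (W \<inter> dir_deriv (dir_deriv f a) b -` ball ?P \<eta>) \<inter> (W \<inter> dir_deriv (dir_deriv f b) a -` ball ?Q \<eta>)"
  have W': "open W'" "z \<in> W'"
    unfolding W'_def using continuous_open_preimage[OF f2 W(1) open_ball] W \<eta> by auto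
  have "open ((\<lambda>st. z + fst st *\<^sub>R a + snd st *\<^sub>R b) -` W')" (is "open ?V")
    by (intro open_vimage[OF W'(1)] continuous_intros)
  moreover have "(0, 0) \<in> ?V" using W' by simp
  ultimately obtain X Y :: "real set" where "open X" "open Y" "(0, 0) \<in> X \<times> Y" "X \<times> Y \<subseteq> ?V"
    by (rule open_prod_elim)
  then have XY: "open X" "open Y" "0 \<in> X" "0 \<in> Y" "X \<times> Y \<subseteq> ?V" by auto
  obtain r1 where r1: "0 < r1" "ball 0 r1 \<subseteq> X" using openE[OF XY(1,3)] .
  obtain r2 where r2: "0 < r2" "ball 0 r2 \<subseteq> Y" using openE[OF XY(2,4)] .
  define h where "h = min r1 r2 / 2"
  have h: "0 < h" "h < r1" "h < r2" using r1(1) r2(1) by (auto simp: h_def)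
  have in_W': "z + s *\<^sub>R a + t *\<^sub>R b \<in> W'" if "0 \<le> s" "s \<le> h" "0 \<le> t" "t \<le> h" for s t
  proof -
    have "s \<in> ball 0 r1" "t \<in> ball 0 r2" using that h by auto
    then have "(s, t) \<in> ?V" using r1 r2 XY(5) by blast
    then show ?thesis by simp
  qed
  have in_W: "z + s *\<^sub>R a + t *\<^sub>R b \<in> W" if "0 \<le> s" "s \<le> h" "0 \<le> t" "t \<le> h" for s t
    using in_W'[OF that] by (simp add: W'_def)
  let ?F = "\<lambda>s t. f (z + s *\<^sub>R a + t *\<^sub>R b)"
  have swap: "z + s *\<^sub>R a + t *\<^sub>R b = z + t *\<^sub>R b + s *\<^sub>R a" for s t by simp
  obtain s t where st: "0 < s" "s < h" "0 < t" "t < h"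
    "?F h h - ?F h 0 - ?F 0 h + ?F 0 0 = h * h * dir_deriv (dir_deriv f a) b (z + s *\<^sub>R a + t *\<^sub>R b)"
  proof (rule double_difference_mvt[OF h(1), where F="?F"])
    fix s t assume st: "0 \<le> s" "s \<le> h" "0 \<le> t" "t \<le> h"
    show "((\<lambda>s. ?F s t) has_real_derivative dir_deriv f a (z + s *\<^sub>R a + t *\<^sub>R b)) (at s)"
      unfolding swap by (rule has_real_derivative_along_line[OF f0]) (use in_W[OF st] in \<open>simp add: swap\<close>)
    show "((\<lambda>t. dir_deriv f a (z + s *\<^sub>R a + t *\<^sub>R b)) has_real_derivative
        dir_deriv (dir_deriv f a) b (z + s *\<^sub>R a + t *\<^sub>R b)) (at t)"
      by (rule has_real_derivative_along_line[OF f1]) (use in_W[OF st] in simp)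
  qed blast
  obtain t' s' where st': "0 < t'" "t' < h" "0 < s'" "s' < h"
    "?F h h - ?F 0 h - ?F h 0 + ?F 0 0 = h * h * dir_deriv (dir_deriv f b) a (z + s' *\<^sub>R a + t' *\<^sub>R b)"
  proof (rule double_difference_mvt[OF h(1), where F="\<lambda>t s. ?F s t"])
    fix t s assume st: "0 \<le> t" "t \<le> h" "0 \<le> s" "s \<le> h"
    show "((\<lambda>t. ?F s t) has_real_derivative dir_deriv f b (z + s *\<^sub>R a + t *\<^sub>R b)) (at t)"
      by (rule has_real_derivative_along_line[OF f0]) (use in_W[OF st(3,4,1,2)] in simp)
    show "((\<lambda>s. dir_deriv f b (z + s *\<^sub>R a + t *\<^sub>R b)) has_real_derivative
        dir_deriv (dir_deriv f b) a (z + s *\<^sub>R a + t *\<^sub>R b)) (at s)"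
      unfolding swap by (rule has_real_derivative_along_line[OF f1]) (use in_W[OF st(3,4,1,2)] in \<open>simp add: swap\<close>)
  qed blast
  have "h * h * dir_deriv (dir_deriv f a) b (z + s *\<^sub>R a + t *\<^sub>R b) = h * h * dir_deriv (dir_deriv f b) a (z + s' *\<^sub>R a + t' *\<^sub>R b)"
    using st(5) st'(5) by linarith
  then have "dir_deriv (dir_deriv f a) b (z + s *\<^sub>R a + t *\<^sub>R b) = dir_deriv (dir_deriv f b) a (z + s' *\<^sub>R a + t' *\<^sub>R b)"
    using h(1) by simp
  moreover have "\<bar>?P - dir_deriv (dir_deriv f a) b (z + s *\<^sub>R a + t *\<^sub>R b)\<bar> < \<eta>"
    using in_W'[of s t] st by (simp add: W'_def dist_real_def)
  moreover have "\<bar>?Q - dir_deriv (dir_deriv f b) a (z + s' *\<^sub>R a + t' *\<^sub>R b)\<bar> < \<eta>"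
    using in_W'[of s' t'] st' by (simp add: W'_def dist_real_def)
  ultimately show False unfolding \<eta>_def by (auto simp: abs_if split: if_splits)
qed

lemma dir_deriv_bounded_linear:
  assumes L: "bounded_linear L" and "Ck_on (Suc k) f W" "z \<in> W"
  shows "dir_deriv (\<lambda>z. L (f z)) a z = L (dir_deriv f a z)"
  by (rule dir_deriv_eq[OF bounded_linear.has_derivative[OF L has_derivative_dir_deriv[OF assms(2,3)]]])

lemma dir_deriv_commute:
  fixes f :: "'e::euclidean_space \<Rightarrow> real^'m"
  assumes W: "open W" "z \<in> W" and f: "Ck_on 2 f W"
  shows "dir_deriv (dir_deriv f a) b z = dir_deriv (dir_deriv f b) a z"
proof -
  have f1: "Ck_on (Suc 0) (dir_deriv f a) W" for a
    by (rule Ck_on_dir_deriv) (use f in \<open>simp only: numeral_2_eq_2\<close>)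
  have f0: "Ck_on (Suc 0) f W" using f by (rule Ck_on_mono) simp
  have nth: "dir_deriv (dir_deriv (\<lambda>z. f z $ i) a) b z = dir_deriv (dir_deriv f a) b z $ i" for i a b
  proof -
    have "dir_deriv (dir_deriv (\<lambda>z. f z $ i) a) b z = dir_deriv (\<lambda>z. dir_deriv f a z $ i) b z"
      by (rule dir_deriv_cong[OF W]) (rule dir_deriv_bounded_linear[OF bounded_linear_vec_nth f0])
    then show ?thesis using dir_deriv_bounded_linear[OF bounded_linear_vec_nth f1 W(2)] by simp
  qed
  show ?thesis
    unfolding vec_eq_iff nth[symmetric] using dir_deriv_commute_real[OF W Ck_on_nth[OF W(1) f]] by blast
qed

section \<open>The Gram matrix of a map\<close>

lemma matrix_mult_eq_assoc: "A ** B = C \<Longrightarrow> A ** (B ** X) = C ** X"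
  for A B C X :: "real^'n^'n"
  by (simp add: matrix_mul_assoc)

lemma trace_det_conj:
  fixes P X :: "real^'n^'n"
  assumes "invertible P"
  shows "trace (matrix_inv P ** X ** P) = trace X" "det (matrix_inv P ** X ** P) = det X"
proof -
  have "trace (matrix_inv P ** X ** P) = trace (P ** (matrix_inv P ** X))" by (rule trace_mul_sym)
  then show "trace (matrix_inv P ** X ** P) = trace X" by (simp add: matrix_mul_assoc matrix_inv_mult[OF assms])
  have "det (matrix_inv P) * det P = 1"
    using arg_cong[OF matrix_inv_mult(2)[OF assms], of det] by (simp add: det_mul)
  then show "det (matrix_inv P ** X ** P) = det X" by (simp add: det_mul mult.commute mult.left_commute)
qed

context riemannian
begin

text \<open>In an orthonormal frame this would be \<open>(d\<psi>)\<^sup>T d\<psi>\<close>; its trace is \<open>|d\<psi>|\<^sup>2\<close> and the square root of its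
  determinant is the volume distortion of \<open>\<psi>\<close>.\<close>

definition gram :: "('a \<Rightarrow> 'a) \<Rightarrow> ('a, real^'m) chart \<Rightarrow> ('a, real^'m) chart \<Rightarrow> 'a \<Rightarrow> real^'m^'m" where
  "gram \<psi> c d p = (let L = matrix (frechet_derivative (snd d \<circ> \<psi> \<circ> chart_inv c) (at (snd c p)))
     in matrix_inv (g c p) ** transpose L ** g d (\<psi> p) ** L)"

lemma norm_sq_differential_gram:
  "norm_sq_differential A g A g \<psi> p = trace (gram \<psi> (chart_at A p) (chart_at A (\<psi> p)) p)"
  by (simp add: norm_sq_differential_def gram_def Let_def hilbert_schmidt_sq_def)

definition volume_distortion :: "('a \<Rightarrow> 'a) \<Rightarrow> 'a \<Rightarrow> real" where
  "volume_distortion \<psi> p = sqrt (det (gram \<psi> (chart_at A p) (chart_at A (\<psi> p)) p))"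

lemma invertible_jacobian:
  assumes "c \<in> A" "d \<in> A" "p \<in> fst c \<inter> fst d"
  shows "invertible (jacobian_transition c d p)"
proof -
  have "det (g c p) \<noteq> 0" using det_metric_pos[of c p] assms by simp
  then show ?thesis unfolding metric_change[OF assms] by (auto simp: invertible_det_nz det_mul)
qed

text \<open>The Jacobian \<open>Q\<close> of the target transition is absorbed by the transformation
  law of \<open>g\<close>, and the Jacobian \<open>P\<close> of the source transition survives as a
  conjugation. Trace and determinant are thus independent of the choices made by
  \<open>chart_at\<close>. The set \<open>U\<close> ensures that the chain rule describes the map on
  a whole neighbourhood of \<open>p\<close>.\<close>

lemma gram_change:
  assumes c: "c \<in> A" "c' \<in> A" "p \<in> fst c \<inter> fst c'" and d: "d \<in> A" "d' \<in> A" "\<psi> p \<in> fst d \<inter> fst d'"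
    and U: "open U" "p \<in> U" "\<psi> ` U \<subseteq> fst d"
    and h: "(snd d \<circ> \<psi> \<circ> chart_inv c) differentiable (at (snd c p))"
  shows "gram \<psi> c' d' p = matrix_inv (jacobian_transition c' c p) ** gram \<psi> c d p ** jacobian_transition c' c p"
proof -
  define P where "P = jacobian_transition c' c p"
  define Q where "Q = jacobian_transition d d' (\<psi> p)"
  let ?h = "snd d \<circ> \<psi> \<circ> chart_inv c" and ?h' = "snd d' \<circ> \<psi> \<circ> chart_inv c'"
  let ?D = "frechet_derivative ?h (at (snd c p))"
  let ?DP = "frechet_derivative (transition c' c) (at (snd c' p))"
  let ?DQ = "frechet_derivative (transition d d') (at (snd d (\<psi> p)))"
  have hp: "?h (snd c p) = snd d (\<psi> p)" using c by (simp add: chart_inv_chart)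
  have tp: "transition c' c (snd c' p) = snd c p" using c by (simp add: transition_chart)
  have dh: "(?h has_derivative ?D) (at (transition c' c (snd c' p)))" using h by (simp add: frechet_derivative_works tp)
  have dP: "(transition c' c has_derivative ?DP) (at (snd c' p))" using c by (intro has_derivative_transition) auto
  have dQ: "(transition d d' has_derivative ?DQ) (at (?h (transition c' c (snd c' p))))"
    unfolding tp hp using d by (intro has_derivative_transition) auto
  let ?U = "snd c' ` (U \<inter> (fst c \<inter> fst c'))"
  have oU: "open ?U" using U c by (intro open_chart_image_subset) (auto intro: open_chart_domain)
  have dh': "(?h' has_derivative (\<lambda>v. ?DQ (?D (?DP v)))) (at (snd c' p))"
  proof (rule has_derivative_transform_within_open[OF has_derivative_compose[OF has_derivative_compose[OF dP dh] dQ] oU])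
    show "snd c' p \<in> ?U" using U c by auto
    fix x assume "x \<in> ?U"
    then obtain q where q: "q \<in> U" "q \<in> fst c" "q \<in> fst c'" "x = snd c' q" by auto
    then have "\<psi> q \<in> fst d" using U by auto
    then show "transition d d' (?h (transition c' c x)) = ?h' x"
      using q c d by (simp add: transition_chart chart_inv_chart)
  qed
  have "matrix (frechet_derivative ?h' (at (snd c' p))) = matrix (?DQ \<circ> (?D \<circ> ?DP))"
    using frechet_derivative_at[OF dh'] by (simp add: o_def)
  also have "\<dots> = Q ** (matrix ?D ** P)"
    unfolding Q_def P_def jacobian_transition_def
    using has_derivative_linear[OF dP] has_derivative_linear[OF dh] has_derivative_linear[OF dQ]
    by (simp add: matrix_compose linear_compose)
  finally have L': "matrix (frechet_derivative ?h' (at (snd c' p))) = Q ** matrix ?D ** P" by (simp add: matrix_mul_assoc)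
  have inv: "invertible P" unfolding P_def using c by (intro invertible_jacobian) auto
  have inv_g: "invertible (g c p)" using c by (intro invertible_metric) auto
  have PT: "transpose (matrix_inv P) ** transpose P = mat 1"
    unfolding matrix_transpose_mul[symmetric] matrix_inv_mult[OF inv] by (rule transpose_mat)
  have gc': "g c' p = transpose P ** g c p ** P" unfolding P_def using c by (intro metric_change) auto
  have gd: "g d (\<psi> p) = transpose Q ** g d' (\<psi> p) ** Q" unfolding Q_def using d by (intro metric_change) auto
  have "matrix_inv (g c' p) = matrix_inv P ** (matrix_inv (g c p) ** transpose (matrix_inv P))"
    by (rule matrix_inv_unique)
      (simp add: gc' matrix_mul_assoc[symmetric] matrix_mult_eq_assoc[OF PT] matrix_mult_eq_assoc[OF matrix_inv_mult(2)[OF inv_g]] matrix_inv_mult(2)[OF inv])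
  then show ?thesis
    unfolding gram_def Let_def L' P_def[symmetric] gd
    by (simp add: matrix_transpose_mul matrix_mul_assoc[symmetric] matrix_mult_eq_assoc[OF PT])
qed

lemma gram_invariant:
  assumes c: "c \<in> A" "p \<in> fst c" and d: "d \<in> A" "\<psi> p \<in> fst d"
    and U: "open U" "p \<in> U" "\<psi> ` U \<subseteq> fst d"
    and h: "(snd d \<circ> \<psi> \<circ> chart_inv c) differentiable (at (snd c p))"
  shows "norm_sq_differential A g A g \<psi> p = trace (gram \<psi> c d p)"
    "volume_distortion \<psi> p = sqrt (det (gram \<psi> c d p))"
  unfolding norm_sq_differential_gram volume_distortion_def
  using gram_change[OF c(1) chart_at(1)[of p] _ d(1) chart_at(1)[of "\<psi> p"] _ U h] c d chart_at(2)
    trace_det_conj[OF invertible_jacobian[OF chart_at(1)[of p] c(1)], of p] by auto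

end

section \<open>Smooth families of maps\<close>

context atlas
begin

definition smooth_family :: "real \<Rightarrow> ('p::euclidean_space \<Rightarrow> 'a \<Rightarrow> 'a) \<Rightarrow> bool" where
  "smooth_family \<epsilon> F \<longleftrightarrow> smooth_map_on (product_atlas A) A (UNIV \<times> ball 0 \<epsilon>) (\<lambda>(p, \<tau>). F \<tau> p)"

text \<open>Together with \<open>family_rep\<close> this puts the family into explicit coordinates,
  avoiding the \<open>inv_into\<close> on pairs by which the inverse charts of
  \<open>product_atlas\<close> are defined.\<close>

definition family_dom :: "real \<Rightarrow> ('p::euclidean_space \<Rightarrow> 'a \<Rightarrow> 'a) \<Rightarrow> ('a, 'e) chart \<Rightarrow> ('a, 'e) chart \<Rightarrow> ('e \<times> 'p) set" where
  "family_dom \<epsilon> F c d = {z. fst z \<in> snd c ` fst c \<and> snd z \<in> ball 0 \<epsilon> \<and> F (snd z) (chart_inv c (fst z)) \<in> fst d}"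

definition family_rep :: "('p::euclidean_space \<Rightarrow> 'a \<Rightarrow> 'a) \<Rightarrow> ('a, 'e) chart \<Rightarrow> ('a, 'e) chart \<Rightarrow> 'e \<times> 'p \<Rightarrow> 'e" where
  "family_rep F c d z = snd d (F (snd z) (chart_inv c (fst z)))"

lemma chart_inv_product:
  assumes "c \<in> A" "x \<in> snd c ` fst c"
  shows "chart_inv (fst c \<times> UNIV, map_prod (snd c) id) (x, \<tau>) = (chart_inv c x, \<tau>)"
proof -
  have "inj_on (map_prod (snd c) id) (fst c \<times> UNIV)"
    using inj_on_chart[OF assms(1)] by (auto simp: inj_on_def)
  then show ?thesis unfolding chart_inv_def[of "(_, _)"]
    using chart_inv_in[OF assms] chart_chart_inv[OF assms] by (auto intro!: inv_into_f_eq)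
qed

lemma family_dom_product_chart:
  assumes c: "c \<in> A"
  shows "map_prod (snd c) id ` ((fst c \<times> UNIV) \<inter> (UNIV \<times> ball 0 \<epsilon>) \<inter> (\<lambda>(p, \<tau>). F \<tau> p) -` fst d) = family_dom \<epsilon> F c d"
    (is "?l = _")
proof (intro equalityI subsetI)
  fix z assume "z \<in> ?l"
  then show "z \<in> family_dom \<epsilon> F c d" using c by (auto simp: family_dom_def chart_inv_chart)
next
  fix z assume z: "z \<in> family_dom \<epsilon> F c d"
  have "z = map_prod (snd c) id (chart_inv c (fst z), snd z)" using z c by (simp add: family_dom_def chart_chart_inv prod_eq_iff)
  moreover have "(chart_inv c (fst z), snd z) \<in> (fst c \<times> UNIV) \<inter> (UNIV \<times> ball 0 \<epsilon>) \<inter> (\<lambda>(p, \<tau>). F \<tau> p) -` fst d"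
    using z c chart_inv_in by (auto simp: family_dom_def)
  ultimately show "z \<in> ?l" by (rule image_eqI)
qed

lemma family_rep_product_chart:
  "c \<in> A \<Longrightarrow> z \<in> family_dom \<epsilon> F c d \<Longrightarrow>
    (snd d \<circ> (\<lambda>(p, \<tau>). F \<tau> p) \<circ> chart_inv (fst c \<times> UNIV, map_prod (snd c) id)) z = family_rep F c d z"
  using chart_inv_product[of c "fst z" "snd z"] by (simp add: family_dom_def family_rep_def)

lemma smooth_family_continuous:
  "smooth_family \<epsilon> F \<Longrightarrow> continuous_on (UNIV \<times> ball 0 \<epsilon>) (\<lambda>z. F (snd z) (fst z))"
  by (simp add: smooth_family_def smooth_map_on_def case_prod_unfold)

lemma open_family_dom:
  assumes F: "continuous_on (UNIV \<times> ball 0 \<epsilon>) (\<lambda>z. F (snd z) (fst z))" and c: "c \<in> A" and d: "d \<in> A"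
  shows "open (family_dom \<epsilon> F c d)"
proof -
  have "continuous_on (snd c ` fst c \<times> ball 0 \<epsilon>) (\<lambda>z. F (snd z) (chart_inv c (fst z)))"
    by (rule continuous_on_compose2[OF F, of _ "\<lambda>z. (chart_inv c (fst z), snd z)", simplified])
      (auto intro!: continuous_intros continuous_on_compose2[OF continuous_on_chart_inv[OF c]])
  from continuous_open_preimage[OF this _ open_chart_domain[OF d]] open_chart_image[OF c]
  have "open ((snd c ` fst c \<times> ball 0 \<epsilon>) \<inter> (\<lambda>z. F (snd z) (chart_inv c (fst z))) -` fst d)"
    by (simp add: open_Times)
  moreover have "(snd c ` fst c \<times> ball 0 \<epsilon>) \<inter> (\<lambda>z. F (snd z) (chart_inv c (fst z))) -` fst d = family_dom \<epsilon> F c d"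
    unfolding family_dom_def by auto
  ultimately show ?thesis by simp
qed

lemma Ck_on_family_rep:
  fixes F :: "'p::euclidean_space \<Rightarrow> 'a \<Rightarrow> 'a"
  assumes F: "smooth_family \<epsilon> F" and c: "c \<in> A" and d: "d \<in> A"
  shows "Ck_on k (family_rep F c d) (family_dom \<epsilon> F c d)"
proof -
  let ?c = "(fst c \<times> UNIV, map_prod (snd c) id) :: ('a \<times> 'p, 'e \<times> 'p) chart"
  have "?c \<in> product_atlas A" using c by (auto simp: product_atlas_def)
  then have "smooth_on (snd d \<circ> (\<lambda>(p, \<tau>). F \<tau> p) \<circ> chart_inv ?c)
      (snd ?c ` (fst ?c \<inter> (UNIV \<times> ball 0 \<epsilon>) \<inter> (\<lambda>(p, \<tau>). F \<tau> p) -` fst d))"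
    using F d unfolding smooth_family_def smooth_map_on_def by blast
  then have "Ck_on k (snd d \<circ> (\<lambda>(p, \<tau>). F \<tau> p) \<circ> chart_inv ?c) (family_dom \<epsilon> F c d)"
    using family_dom_product_chart[OF c, of \<epsilon> F d] unfolding smooth_on_def fst_conv snd_conv by metis
  then show ?thesis
    by (rule Ck_on_cong[OF open_family_dom[OF smooth_family_continuous[OF F] c d], rotated]) (rule family_rep_product_chart[OF c])
qed

end

section \<open>Variations of the identity\<close>

text \<open>The parameter space is left general: it is \<open>real\<close> for harmonicity and for
  the construction of variations, and \<open>real \<times> real\<close> for the second
  variation.\<close>

locale variation = compact_riemannian A g
  for A :: "('a::{t2_space, second_countable_topology}, real^'m) chart set" and g :: "('a, 'm) metric_components" +
  fixes \<Psi> :: "'p::euclidean_space \<Rightarrow> 'a \<Rightarrow> 'a" and \<epsilon> :: real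
  assumes \<Psi>_0: "\<Psi> 0 = id" and \<epsilon>: "0 < \<epsilon>" and smooth_\<Psi>: "smooth_family \<epsilon> \<Psi>"
begin

text \<open>One chart on both sides is enough: at parameter 0 the map is the identity, so for small
  parameters the image of a point stays in the chart domain.\<close>

abbreviation dom :: "('a, real^'m) chart \<Rightarrow> ((real^'m) \<times> 'p) set" where
  "dom c \<equiv> family_dom \<epsilon> \<Psi> c c"

abbreviation rep :: "('a, real^'m) chart \<Rightarrow> (real^'m) \<times> 'p \<Rightarrow> real^'m" where
  "rep c \<equiv> family_rep \<Psi> c c"

lemmas dom_def = family_dom_def and rep_def = family_rep_def

lemmas continuous_\<Psi> = smooth_family_continuous[OF smooth_\<Psi>]

lemma open_dom: "c \<in> A \<Longrightarrow> open (dom c)"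
  by (rule open_family_dom[OF continuous_\<Psi>])

lemma Ck_on_rep: "c \<in> A \<Longrightarrow> Ck_on k (rep c) (dom c)"
  by (rule Ck_on_family_rep[OF smooth_\<Psi>])

lemma dom_0: "c \<in> A \<Longrightarrow> x \<in> snd c ` fst c \<Longrightarrow> (x, 0) \<in> dom c"
  using \<epsilon> chart_inv_in[of c x] by (simp add: dom_def \<Psi>_0)

lemma rep_0: "c \<in> A \<Longrightarrow> x \<in> snd c ` fst c \<Longrightarrow> rep c (x, 0) = x"
  by (simp add: rep_def \<Psi>_0 chart_chart_inv)

definition differential :: "('a, real^'m) chart \<Rightarrow> (real^'m) \<times> 'p \<Rightarrow> real^'m^'m" where
  "differential c z = matrix (\<lambda>v. dir_deriv (rep c) (v, 0) z)"

lemma differential_nth: "differential c z $ i $ j = dir_deriv (rep c) (axis j 1, 0) z $ i"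
  by (simp add: differential_def matrix_def)

lemma Ck_on_differential: assumes "c \<in> A" shows "Ck_on k (differential c) (dom c)"
proof (intro Ck_on_vecI open_dom assms)
  fix i j
  show "Ck_on k (\<lambda>z. differential c z $ i $ j) (dom c)"
    unfolding differential_nth
    by (intro Ck_on_nth open_dom assms Ck_on_dir_deriv Ck_on_rep)
qed

lemma has_derivative_rep: "c \<in> A \<Longrightarrow> z \<in> dom c \<Longrightarrow> (rep c has_derivative (\<lambda>v. dir_deriv (rep c) v z)) (at z)"
  by (rule has_derivative_dir_deriv[OF Ck_on_rep])

lemma has_derivative_space:
  assumes "c \<in> A" "(x, \<tau>) \<in> dom c"
  shows "((snd c \<circ> \<Psi> \<tau> \<circ> chart_inv c) has_derivative (\<lambda>v. dir_deriv (rep c) (v, 0) (x, \<tau>))) (at x)"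
  using has_derivative_slice(2)[OF has_derivative_rep[OF assms]] by (simp add: rep_def o_def)

text \<open>The endomorphism \<open>S(\<tau>)\<close> in the chart \<open>c\<close>, as a function
  of point and parameter together, so that its joint smoothness can be stated.\<close>

definition pullback :: "('a, real^'m) chart \<Rightarrow> (real^'m) \<times> 'p \<Rightarrow> real^'m^'m" where
  "pullback c z = matrix_inv (g c (chart_inv c (fst z))) ** transpose (differential c z)
     ** g c (chart_inv c (rep c z)) ** differential c z"

lemma pullback_gram:
  assumes c: "c \<in> A" and z: "(x, \<tau>) \<in> dom c"
  shows "pullback c (x, \<tau>) = gram (\<Psi> \<tau>) c c (chart_inv c x)"
proof -
  have x: "x \<in> snd c ` fst c" "\<Psi> \<tau> (chart_inv c x) \<in> fst c" using z by (auto simp: dom_def)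
  have "frechet_derivative (snd c \<circ> \<Psi> \<tau> \<circ> chart_inv c) (at x) = (\<lambda>v. dir_deriv (rep c) (v, 0) (x, \<tau>))"
    using frechet_derivative_at[OF has_derivative_space[OF assms]] by simp
  then show ?thesis
    by (simp add: pullback_def gram_def Let_def differential_def rep_def chart_chart_inv[OF c x(1)] chart_inv_chart[OF c x(2)])
qed

lemma pullback_invariant:
  assumes c: "c \<in> A" and z: "(x, \<tau>) \<in> dom c"
  shows "norm_sq_differential A g A g (\<Psi> \<tau>) (chart_inv c x) = trace (pullback c (x, \<tau>))"
    "volume_distortion (\<Psi> \<tau>) (chart_inv c x) = sqrt (det (pullback c (x, \<tau>)))"
proof -
  have x: "x \<in> snd c ` fst c" "\<tau> \<in> ball 0 \<epsilon>" "\<Psi> \<tau> (chart_inv c x) \<in> fst c" using z by (auto simp: dom_def)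
  have "continuous_on UNIV (\<Psi> \<tau>)"
    by (rule continuous_on_compose2[OF continuous_\<Psi>, of _ "\<lambda>q. (q, \<tau>)", simplified])
      (use x in \<open>auto intro!: continuous_intros\<close>)
  then have U: "open (\<Psi> \<tau> -` fst c)" using open_chart_domain[OF c] by (metis open_vimage)
  have h: "(snd c \<circ> \<Psi> \<tau> \<circ> chart_inv c) differentiable (at (snd c (chart_inv c x)))"
    unfolding chart_chart_inv[OF c x(1)] using has_derivative_space[OF assms] differentiableI by blast
  show "norm_sq_differential A g A g (\<Psi> \<tau>) (chart_inv c x) = trace (pullback c (x, \<tau>))"
    "volume_distortion (\<Psi> \<tau>) (chart_inv c x) = sqrt (det (pullback c (x, \<tau>)))"
    unfolding pullback_gram[OF assms]
    using gram_invariant[OF c chart_inv_in[OF c x(1)] c x(3) U _ _ h] x(3) by auto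
qed

lemma Ck_on_pullback: assumes c: "c \<in> A" shows "Ck_on k (pullback c) (dom c)"
proof -
  note o = open_dom[OF c]
  have 1: "Ck_on k (\<lambda>z. g c (chart_inv c (fst z))) (dom c)"
    by (rule Ck_on_compose[OF o Ck_on_linear[OF bounded_linear_fst] Ck_on_metric[OF c]]) (simp add: dom_def)
  have 2: "Ck_on k (\<lambda>z. g c (chart_inv c (rep c z))) (dom c)"
    by (rule Ck_on_compose[OF o Ck_on_rep[OF c] Ck_on_metric[OF c]]) (simp add: dom_def rep_def)
  show ?thesis
    unfolding pullback_def[abs_def]
    by (intro Ck_on_matrix_mult Ck_on_transpose Ck_on_matrix_inv o 1 2 Ck_on_differential c)
      (auto simp: dom_def intro!: det_metric_pos c chart_inv_in)
qed

lemma differential_0: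
  assumes c: "c \<in> A" and x: "x \<in> snd c ` fst c"
  shows "differential c (x, 0) = mat 1"
proof -
  have "((\<lambda>y. y) has_derivative (\<lambda>v. dir_deriv (rep c) (v, 0) (x, 0))) (at x)"
  proof (rule has_derivative_transform_within_open[OF has_derivative_space[OF c dom_0[OF c x]] open_chart_image[OF c] x])
    show "(snd c \<circ> \<Psi> 0 \<circ> chart_inv c) y = y" if "y \<in> snd c ` fst c" for y
      using that c by (simp add: \<Psi>_0 chart_chart_inv)
  qed
  then have "(\<lambda>v. dir_deriv (rep c) (v, 0) (x, 0)) = (\<lambda>v. v)"
    using has_derivative_unique has_derivative_ident by blast
  then show ?thesis by (simp add: differential_def matrix_id_mat_1[unfolded id_def])
qed

lemma pullback_0:
  assumes c: "c \<in> A" and x: "x \<in> snd c ` fst c"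
  shows "pullback c (x, 0) = mat 1"
  using invertible_metric[OF c chart_inv_in[OF c x]]
  by (simp add: pullback_def differential_0[OF assms] rep_0[OF assms] transpose_mat matrix_inv_mult)

text \<open>At parameter 0 the pullback is the identity matrix; by continuity it remains in the
  neighbourhood \<open>Y\<close>, on which \<open>F\<close> is smooth. This serves the energy
  density and the distortion alike.\<close>

lemma param_Ck_pullback:
  fixes F :: "real^'m^'m \<Rightarrow> real"
  assumes eq: "\<And>c x \<tau>. c \<in> A \<Longrightarrow> (x, \<tau>) \<in> dom c \<Longrightarrow> G (chart_inv c x) \<tau> = F (pullback c (x, \<tau>))"
    and Y: "open Y" "mat 1 \<in> Y" and F: "Ck_on k F Y"
  shows "param_Ck k G"
  unfolding param_Ck_def
proof
  fix p
  note c = chart_at[of p]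
  let ?c = "chart_at A p"
  define W where "W = dom ?c \<inter> pullback ?c -` Y"
  have W: "open W" unfolding W_def
    by (rule continuous_open_preimage[OF Ck_on_imp_continuous_on[OF Ck_on_pullback[OF c(1)]] open_dom[OF c(1)] Y(1)])
  have "Ck_on k (\<lambda>z. F (pullback ?c z)) W"
    by (rule Ck_on_compose[OF W Ck_on_subset[OF Ck_on_pullback[OF c(1)]] F]) (auto simp: W_def)
  then have "Ck_on k (\<lambda>z. G (chart_inv ?c (fst z)) (snd z)) W"
    by (rule Ck_on_cong[OF W, rotated]) (use eq[OF c(1)] in \<open>auto simp: W_def\<close>)
  moreover have "(snd ?c p, 0) \<in> W" unfolding W_def using c Y by (auto intro!: dom_0 simp: pullback_0)
  moreover have "W \<subseteq> snd ?c ` fst ?c \<times> UNIV" by (auto simp: W_def dom_def)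
  ultimately show "\<exists>c\<in>A. p \<in> fst c \<and> (\<exists>W. open W \<and> (snd c p, 0) \<in> W \<and> W \<subseteq> snd c ` fst c \<times> UNIV \<and>
     Ck_on k (\<lambda>z. G (chart_inv c (fst z)) (snd z)) W)"
    using W c by blast
qed

definition energy_density :: "real \<Rightarrow> 'a \<Rightarrow> 'p \<Rightarrow> real" where
  "energy_density \<alpha> q \<tau> = (1 + norm_sq_differential A g A g (\<Psi> \<tau>) q) powr \<alpha>"

definition distortion :: "'a \<Rightarrow> 'p \<Rightarrow> real" where
  "distortion q \<tau> = volume_distortion (\<Psi> \<tau>) q"

lemma continuous_on_trace_det:
  "continuous_on UNIV (trace :: real^'m^'m \<Rightarrow> real)" "continuous_on UNIV (det :: real^'m^'m \<Rightarrow> real)"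
  using Ck_on_imp_continuous_on[OF Ck_on_linear[OF bounded_linear_trace]]
    Ck_on_imp_continuous_on[OF Ck_on_det[OF open_UNIV Ck_on_ident]] by auto

lemma param_Ck_energy_density: "param_Ck k (energy_density \<alpha>)"
proof (rule param_Ck_pullback)
  let ?Y = "(\<lambda>X :: real^'m^'m. 1 + trace X) -` {0<..}"
  show Y: "open ?Y" by (intro open_vimage open_greaterThan continuous_intros continuous_on_trace_det)
  show "mat 1 \<in> ?Y" by (simp add: trace_I add_pos_nonneg)
  show "Ck_on k (\<lambda>X :: real^'m^'m. (1 + trace X) powr \<alpha>) ?Y"
    by (intro Ck_on_powr Ck_on_add Ck_on_const Ck_on_trace Ck_on_ident Y) auto
qed (simp add: energy_density_def pullback_invariant)

lemma param_Ck_distortion: "param_Ck k distortion"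
proof (rule param_Ck_pullback)
  let ?Y = "(\<lambda>X :: real^'m^'m. det X) -` {0<..}"
  show Y: "open ?Y" by (intro open_vimage open_greaterThan continuous_on_trace_det)
  show "mat 1 \<in> ?Y" by simp
  have "Ck_on k (\<lambda>X :: real^'m^'m. det X powr (1/2)) ?Y"
    by (intro Ck_on_powr Ck_on_det Ck_on_ident Y) auto
  then show "Ck_on k (\<lambda>X :: real^'m^'m. sqrt (det X)) ?Y"
    by (rule Ck_on_cong[OF Y, rotated]) (simp add: powr_half_sqrt)
qed (simp add: distortion_def pullback_invariant)

lemma alpha_energy_eq: "alpha_energy \<alpha> A g A g (\<Psi> \<tau>) = (\<integral>q. energy_density \<alpha> q \<tau> \<partial>vol)"
  by (simp add: alpha_energy_def energy_density_def)

end

section \<open>Conservation of the volume\<close>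

lemma compact_tube:
  fixes W :: "('a::topological_space \<times> 'p::real_normed_vector) set"
  assumes "compact K" "open W" "K \<times> {0} \<subseteq> W"
  obtains d where "0 < d" "K \<times> ball 0 d \<subseteq> W"
proof -
  have "\<exists>U V. openin euclidean U \<and> openin euclidean V \<and> K \<subseteq> U \<and> 0 \<in> V \<and> U \<times> V \<subseteq> W"
    using assms by (intro tube_lemma_left) auto
  then obtain U V where UV: "open V" "K \<subseteq> U" "0 \<in> V" "U \<times> V \<subseteq> W" by (auto simp: open_openin[symmetric])
  obtain d where "0 < d" "ball 0 d \<subseteq> V" using openE[OF UV(1,3)] .
  then show thesis using that[of d] UV by blast
qed

lemma bounded_bilinear_matrix_vector_mult:
  "bounded_bilinear ((*v) :: real^'n^'m \<Rightarrow> real^'n \<Rightarrow> real^'m)"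
  unfolding bilinear_conv_bounded_bilinear[symmetric] bilinear_def
  by (auto intro!: linearI simp: matrix_vector_mult_def vec_eq_iff algebra_simps sum.distrib sum_distrib_left)

section \<open>Injectivity, covering and preimages for maps near the identity\<close>

context variation
begin

lemma differential_mult: "c \<in> A \<Longrightarrow> z \<in> dom c \<Longrightarrow> differential c z *v v = dir_deriv (rep c) (v, 0) z"
  using has_derivative_space[of c "fst z" "snd z"] unfolding differential_def
  by (simp add: matrix_works has_derivative_linear)

text \<open>Near the identity a variation is a small \<open>C\<^sup>1\<close> perturbation of the identity in any chart, hence injective
  on a coordinate ball; by Brouwer's theorem it covers a smaller ball.\<close>

lemma small_variation_in_chart:
  assumes c: "c \<in> A" and r: "0 < r" and ball: "cball x0 (3 * r) \<subseteq> snd c ` fst c"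
  obtains d where "0 < d"
    "\<And>x \<tau>. x \<in> cball x0 (2 * r) \<Longrightarrow> \<tau> \<in> ball 0 d \<Longrightarrow> (x, \<tau>) \<in> dom c"
    "\<And>\<tau>. \<tau> \<in> ball 0 d \<Longrightarrow> inj_on (\<lambda>x. rep c (x, \<tau>)) (cball x0 (2 * r))"
    "\<And>y \<tau>. \<tau> \<in> ball 0 d \<Longrightarrow> y \<in> cball x0 r \<Longrightarrow> \<exists>x\<in>cball x0 (2 * r). rep c (x, \<tau>) = y"
proof -
  obtain K where K0: "0 < K" "\<forall>(M :: real^'m^'m) v. norm (M *v v) \<le> norm M * norm v * K"
    using bounded_bilinear.pos_bounded[OF bounded_bilinear_matrix_vector_mult] by metis
  then have K: "0 < K" "norm (M *v v) \<le> norm M * norm v * K" for M :: "real^'m^'m" and v by auto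
  \<comment> \<open>On \<open>W\<close> points move by less than \<open>r\<close>, as Brouwer's
    theorem will require, and, \<open>K\<close> being the bound for matrix-vector multiplication,
    the derivative of the displacement has operator norm at most 1/2.\<close>
  define W where "W = (dom c \<inter> (\<lambda>z. rep c z - fst z) -` ball 0 r) \<inter> (dom c \<inter> differential c -` ball (mat 1) (1 / (2 * K)))"
  have sub: "cball x0 (2 * r) \<subseteq> snd c ` fst c" using ball subset_cball[of "2 * r" "3 * r" x0] r by auto
  have oW: "open W"
    unfolding W_def
    by (intro open_Int continuous_open_preimage continuous_intros Ck_on_imp_continuous_on[OF Ck_on_rep]
        Ck_on_imp_continuous_on[OF Ck_on_differential] open_dom c open_ball)
  have "cball x0 (2 * r) \<times> {0} \<subseteq> W"
    using sub K(1) r by (auto simp: W_def subset_iff rep_0 c differential_0 intro!: dom_0)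
  then obtain d where d: "0 < d" "cball x0 (2 * r) \<times> ball 0 d \<subseteq> W"
    using compact_tube[OF compact_cball oW] by metis
  have dom: "(x, \<tau>) \<in> dom c" and close: "norm (rep c (x, \<tau>) - x) < r"
    and D: "norm (differential c (x, \<tau>) - mat 1) < 1 / (2 * K)"
    if "x \<in> cball x0 (2 * r)" "\<tau> \<in> ball 0 d" for x \<tau>
    using subsetD[OF d(2), of "(x, \<tau>)"] that by (auto simp: W_def dist_norm norm_minus_commute)
  have inj: "inj_on (\<lambda>x. rep c (x, \<tau>)) (cball x0 (2 * r))" if \<tau>: "\<tau> \<in> ball 0 d" for \<tau>
  proof (rule inj_onI)
    fix x y assume x: "x \<in> cball x0 (2 * r)" and y: "y \<in> cball x0 (2 * r)" and eq: "rep c (x, \<tau>) = rep c (y, \<tau>)"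
    \<comment> \<open>The displacement is a contraction with constant 1/2, so two points with equal
      images have distance at most half of itself.\<close>
    have "norm ((rep c (x, \<tau>) - x) - (rep c (y, \<tau>) - y)) \<le> 1 / 2 * norm (x - y)"
    proof (rule differentiable_bound[OF convex_cball _ _ x y])
      fix z assume z: "z \<in> cball x0 (2 * r)"
      show "((\<lambda>x. rep c (x, \<tau>) - x) has_derivative (\<lambda>v. dir_deriv (rep c) (v, 0) (z, \<tau>) - v)) (at z within cball x0 (2 * r))"
        by (rule has_derivative_diff[OF has_derivative_at_withinI[OF
              has_derivative_slice(2)[OF has_derivative_rep[OF c dom[OF z \<tau>]]]] has_derivative_ident])
      show "onorm (\<lambda>v. dir_deriv (rep c) (v, 0) (z, \<tau>) - v) \<le> 1 / 2"
      proof (rule onorm_le)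
        fix v
        have "dir_deriv (rep c) (v, 0) (z, \<tau>) - v = (differential c (z, \<tau>) - mat 1) *v v"
          by (simp add: matrix_vector_mult_diff_rdistrib differential_mult[OF c dom[OF z \<tau>]])
        also have "norm \<dots> \<le> norm (differential c (z, \<tau>) - mat 1) * norm v * K" by (rule K)
        also have "\<dots> \<le> 1 / (2 * K) * norm v * K"
          using D[OF z \<tau>] K(1) by (intro mult_right_mono) auto
        also have "\<dots> = 1 / 2 * norm v" using K(1) by simp
        finally show "norm (dir_deriv (rep c) (v, 0) (z, \<tau>) - v) \<le> 1 / 2 * norm v" .
      qed
    qed
    then show "x = y" using eq by (simp add: norm_minus_commute)
  qed
  \<comment> \<open>The theorem asks that the point \<open>a + (b - rep c (b, \<tau>))\<close> stay
    in the larger ball: it is within \<open>r\<close> of \<open>a\<close>, and \<open>a\<close> is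
    within \<open>r\<close> of the centre.\<close>
  have surj: "\<exists>x\<in>cball x0 (2 * r). rep c (x, \<tau>) = y" if \<tau>: "\<tau> \<in> ball 0 d" and y: "y \<in> cball x0 r" for y \<tau>
  proof (rule brouwer_surjective_cball[where S="cball x0 r"])
    show "continuous_on (cball x0 (2 * r)) (\<lambda>x. rep c (x, \<tau>))"
      by (rule continuous_on_compose2[OF Ck_on_imp_continuous_on[OF Ck_on_rep[OF c]]])
        (use dom[OF _ \<tau>] in \<open>auto intro!: continuous_intros\<close>)
    fix a b assume a: "a \<in> cball x0 r" and b: "b \<in> cball x0 (2 * r)"
    have "dist x0 (a + (b - rep c (b, \<tau>))) \<le> dist x0 a + norm (b - rep c (b, \<tau>))"
      using dist_triangle[of x0 "a + (b - rep c (b, \<tau>))" a] by (simp add: dist_norm norm_minus_commute)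
    then show "a + (b - rep c (b, \<tau>)) \<in> cball x0 (2 * r)"
      using a close[OF b \<tau>] by (simp add: norm_minus_commute)
  qed (use r y in auto)
  show thesis by (rule that[OF d(1) dom inj surj])
qed

text \<open>A point outside the open set \<open>?O\<close> starts outside the closed set
  \<open>?K\<close>, and by continuity it and its neighbours stay outside for small parameters;
  compactness gives one radius for all points. Preimages of a small ball can thus be studied in a
  single chart.\<close>

lemma preimage_in_coordinate_ball:
  assumes c: "c \<in> A" and r: "0 < r" and ball: "cball x0 (3 * r) \<subseteq> snd c ` fst c"
  obtains d where "0 < d" "d \<le> \<epsilon>"
    "\<And>q \<tau>. \<tau> \<in> ball 0 d \<Longrightarrow> \<Psi> \<tau> q \<in> chart_inv c ` cball x0 r \<Longrightarrow> q \<in> chart_inv c ` ball x0 (2 * r)"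
proof -
  let ?K = "chart_inv c ` cball x0 r" and ?O = "chart_inv c ` ball x0 (2 * r)"
  have sub: "cball x0 r \<subseteq> snd c ` fst c" "ball x0 (2 * r) \<subseteq> snd c ` fst c" "cball x0 r \<subseteq> ball x0 (2 * r)"
    using ball r by (auto simp: subset_iff)
  have "compact ?K" by (intro compact_continuous_image continuous_on_subset[OF continuous_on_chart_inv] c sub compact_cball)
  then have K: "closed ?K" by (rule compact_imp_closed)
  have O: "open ?O" by (rule open_chart_inv_image[OF c open_ball sub(2)])
  have KO: "?K \<subseteq> ?O" using sub(3) by (rule image_mono)
  obtain d :: real and B :: real where d: "0 < d" and *: "\<And>q. \<forall>\<tau>\<in>ball 0 (min d \<epsilon>). \<Psi> \<tau> q \<in> ?K \<longrightarrow> q \<in> ?O"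
  proof (rule uniform_over_points[where Q="\<lambda>q d B. \<forall>\<tau>\<in>ball 0 (min d \<epsilon>). \<Psi> \<tau> q \<in> ?K \<longrightarrow> q \<in> ?O"])
    fix p
    show "\<exists>U. open U \<and> p \<in> U \<and> (\<exists>d>0. \<exists>B::real. \<forall>q\<in>U. \<forall>\<tau>\<in>ball 0 (min d \<epsilon>). \<Psi> \<tau> q \<in> ?K \<longrightarrow> q \<in> ?O)"
    proof (cases "p \<in> ?O")
      case True
      then show ?thesis using O by (intro exI[of _ ?O]) (auto intro!: exI[of _ 1])
    next
      case False
      let ?W = "(UNIV \<times> ball 0 \<epsilon>) \<inter> (\<lambda>z. \<Psi> (snd z) (fst z)) -` (- ?K)"
      have "open ?W" by (intro continuous_open_preimage[OF continuous_\<Psi>] open_Times) (use K in auto)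
      moreover have "(p, 0) \<in> ?W" using False KO \<epsilon> by (auto simp: \<Psi>_0)
      ultimately obtain U T where UT: "open U" "open T" "(p, 0) \<in> U \<times> T" "U \<times> T \<subseteq> ?W" by (rule open_prod_elim)
      obtain d where "0 < d" "ball 0 d \<subseteq> T" using openE[of T 0] UT by auto
      then have "\<Psi> \<tau> q \<notin> ?K" if "q \<in> U" "\<tau> \<in> ball 0 (min d \<epsilon>)" for q \<tau>
        using UT(4) that subsetD[of "U \<times> T" ?W "(q, \<tau>)"] by auto
      then have "\<forall>q\<in>U. \<forall>\<tau>\<in>ball 0 (min d \<epsilon>). \<Psi> \<tau> q \<in> ?K \<longrightarrow> q \<in> ?O" by blast
      with UT \<open>0 < d\<close> show ?thesis by (intro exI[of _ U]) auto
    qed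
  next
    fix q and d B d' B' :: real
    assume "\<forall>\<tau>\<in>ball 0 (min d \<epsilon>). \<Psi> \<tau> q \<in> ?K \<longrightarrow> q \<in> ?O" "d' \<le> d"
    then show "\<forall>\<tau>\<in>ball 0 (min d' \<epsilon>). \<Psi> \<tau> q \<in> ?K \<longrightarrow> q \<in> ?O" by auto
  qed blast
  show thesis
  proof (rule that[of "min d \<epsilon>"])
    show "q \<in> ?O" if "\<tau> \<in> ball 0 (min d \<epsilon>)" "\<Psi> \<tau> q \<in> ?K" for q \<tau> using *[of q] that by blast
  qed (use d \<epsilon> in auto)
qed

text \<open>The distortion is the factor by which \<open>\<Psi> \<tau>\<close> scales Riemannian
  volume: the determinant of the pullback is the square of that of the differential, times the
  quotient of the metric determinants at the image and at the point.\<close>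

lemma distortion_chart:
  assumes c: "c \<in> A" and z: "(x, \<tau>) \<in> dom c"
  shows "distortion (chart_inv c x) \<tau> * vol_density c x = \<bar>det (differential c (x, \<tau>))\<bar> * vol_density c (rep c (x, \<tau>))"
proof -
  have x: "x \<in> snd c ` fst c" using z by (simp add: dom_def)
  have G: "0 < det (g c (chart_inv c x))" using x c by (intro det_metric_pos chart_inv_in)
  have "det (matrix_inv (g c (chart_inv c x))) * det (g c (chart_inv c x)) = 1"
    using arg_cong[OF matrix_inv_mult(2)[of "g c (chart_inv c x)"], of det] G by (simp add: det_mul invertible_det_nz)
  then have inv: "det (matrix_inv (g c (chart_inv c x))) = 1 / det (g c (chart_inv c x))"
    using G by (simp add: field_simps)
  have "det (pullback c (x, \<tau>)) * det (g c (chart_inv c x))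
      = (det (differential c (x, \<tau>)))\<^sup>2 * det (g c (chart_inv c (rep c (x, \<tau>))))"
    using G by (simp add: pullback_def det_mul inv power2_eq_square)
  then have "sqrt (det (pullback c (x, \<tau>))) * sqrt (det (g c (chart_inv c x)))
      = \<bar>det (differential c (x, \<tau>))\<bar> * sqrt (det (g c (chart_inv c (rep c (x, \<tau>)))))"
    by (metis real_sqrt_abs real_sqrt_mult)
  then show ?thesis by (simp add: distortion_def pullback_invariant[OF assms] vol_density_def)
qed

text \<open>For small parameters the preimage of \<open>D\<close> lies in the coordinate ball of
  radius \<open>2 * r\<close>, where the map is injective, and it is mapped onto \<open>D\<close>.
  Changing variables then produces the volume of \<open>D\<close>.\<close>

lemma nn_integral_distortion_local:
  assumes c: "c \<in> A" and r: "0 < r" and ball: "cball x0 (3 * r) \<subseteq> snd c ` fst c"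
    and D: "D \<in> sets borel" "D \<subseteq> chart_inv c ` ball x0 r"
  obtains d where "0 < d"
    "\<And>\<tau>. \<tau> \<in> ball 0 d \<Longrightarrow> (\<lambda>q. distortion q \<tau>) \<in> borel_measurable borel \<Longrightarrow>
      (\<integral>\<^sup>+q. indicator D (\<Psi> \<tau> q) * ennreal (distortion q \<tau>) \<partial>vol) = emeasure vol D"
proof -
  obtain d1 where d1: "0 < d1" and dom: "\<And>x \<tau>. x \<in> cball x0 (2 * r) \<Longrightarrow> \<tau> \<in> ball 0 d1 \<Longrightarrow> (x, \<tau>) \<in> dom c"
    and inj: "\<And>\<tau>. \<tau> \<in> ball 0 d1 \<Longrightarrow> inj_on (\<lambda>x. rep c (x, \<tau>)) (cball x0 (2 * r))"
    and surj: "\<And>y \<tau>. \<tau> \<in> ball 0 d1 \<Longrightarrow> y \<in> cball x0 r \<Longrightarrow> \<exists>x\<in>cball x0 (2 * r). rep c (x, \<tau>) = y"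
    by (rule small_variation_in_chart[OF c r ball]) blast
  obtain d2 where d2: "0 < d2" "d2 \<le> \<epsilon>"
    and pre: "\<And>q \<tau>. \<tau> \<in> ball 0 d2 \<Longrightarrow> \<Psi> \<tau> q \<in> chart_inv c ` cball x0 r \<Longrightarrow> q \<in> chart_inv c ` ball x0 (2 * r)"
    by (rule preimage_in_coordinate_ball[OF c r ball]) blast
  have sub: "ball x0 r \<subseteq> snd c ` fst c" "ball x0 (2 * r) \<subseteq> snd c ` fst c" "cball x0 (2 * r) \<subseteq> snd c ` fst c" "ball x0 r \<subseteq> cball x0 r"
    using ball r by (auto simp: subset_iff)
  show thesis
  proof (rule that[of "min d1 d2"])
    show "0 < min d1 d2" using d1 d2 by simp
    fix \<tau> :: 'p assume "\<tau> \<in> ball 0 (min d1 d2)" and meas [measurable]: "(\<lambda>q. distortion q \<tau>) \<in> borel_measurable borel"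
    then have \<tau>: "\<tau> \<in> ball 0 d1" "\<tau> \<in> ball 0 d2" "\<tau> \<in> ball 0 \<epsilon>" using d2 by auto
    let ?T = "\<lambda>x. rep c (x, \<tau>)" and ?D = "\<lambda>x. differential c (x, \<tau>)"
    let ?B = "cball x0 (2 * r)"
    define D' where "D' = snd c ` D"
    \<comment> \<open>The coordinate image of the preimage of \<open>D\<close>; restricting to the
      ball loses nothing because of \<open>pre\<close>.\<close>
    define P where "P = {x \<in> ?B. ?T x \<in> D'}"
    have Dc: "D \<subseteq> fst c" using D(2) open_chart_inv_image(2)[OF c open_ball sub(1)] by blast
    have D'_ball: "D' \<subseteq> ball x0 r"
      unfolding D'_def using image_mono[OF D(2), of "snd c"] chart_image_chart_inv[OF c sub(1)] by simp
    have D'_borel: "D' \<in> sets borel" unfolding D'_def by (rule chart_image_borel[OF c D(1) Dc])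
    have contT: "continuous_on ?B ?T"
      by (rule continuous_on_compose2[OF Ck_on_imp_continuous_on[OF Ck_on_rep[OF c]]])
        (use dom[OF _ \<tau>(1)] in \<open>auto intro!: continuous_intros\<close>)
    have contD: "continuous_on ?B ?D"
      by (rule continuous_on_compose2[OF Ck_on_imp_continuous_on[OF Ck_on_differential[OF c]]])
        (use dom[OF _ \<tau>(1)] in \<open>auto intro!: continuous_intros\<close>)
    have T_image: "?T x \<in> snd c ` fst c" if "x \<in> ?B" for x
      using dom[OF that \<tau>(1)] by (simp add: dom_def rep_def)
    have P_borel: "P \<in> sets borel"
    proof -
      have "?T -` D' \<inter> space (restrict_space borel ?B) \<in> sets (restrict_space borel ?B)"
        using borel_measurable_continuous_on_restrict[OF contT] D'_borel by (rule measurable_sets)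
      moreover have "?T -` D' \<inter> space (restrict_space borel ?B) = P" by (auto simp: P_def space_restrict_space)
      ultimately show ?thesis by (simp add: sets_restrict_space_iff)
    qed
    have TP: "?T ` P = D'"
      using surj[OF \<tau>(1)] D'_ball sub(4) by (fastforce simp: P_def image_iff)
    have cm: "continuous_on ?B (\<lambda>x. \<bar>det (?D x)\<bar> * vol_density c (?T x))"
      by (intro continuous_intros continuous_on_compose2[OF continuous_on_trace_det(2) contD]
          continuous_on_compose2[OF continuous_on_vol_density[OF c] contT]) (use T_image in auto)
    have m2: "(\<lambda>x. indicator P x * (\<bar>det (?D x)\<bar> * vol_density c (?T x))) \<in> borel_measurable borel"
    proof -
      have "(\<lambda>x. indicator ?B x *\<^sub>R (\<bar>det (?D x)\<bar> * vol_density c (?T x))) \<in> borel_measurable borel"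
        by (intro borel_measurable_continuous_on_indicator cm) auto
      then have "(\<lambda>x. indicator P x * (indicator ?B x *\<^sub>R (\<bar>det (?D x)\<bar> * vol_density c (?T x)))) \<in> borel_measurable borel"
        using P_borel by (intro borel_measurable_times) auto
      moreover have "indicator P x * (indicator ?B x *\<^sub>R (\<bar>det (?D x)\<bar> * vol_density c (?T x)))
        = indicator P x * (\<bar>det (?D x)\<bar> * vol_density c (?T x))" for x
        by (auto simp: P_def indicator_def)
      ultimately show ?thesis by (simp only:)
    qed
    have cont\<Psi>: "continuous_on UNIV (\<Psi> \<tau>)"
      by (rule continuous_on_compose2[OF continuous_\<Psi>, of _ "\<lambda>q. (q, \<tau>)", simplified])
        (use \<tau> in \<open>auto intro!: continuous_intros\<close>)
    have [measurable]: "\<Psi> \<tau> \<in> borel_measurable borel" by (rule borel_measurable_continuous_onI[OF cont\<Psi>])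
    have D_imp: "q \<in> chart_inv c ` ball x0 (2 * r)" if "\<Psi> \<tau> q \<in> D" for q
      using pre[OF \<tau>(2), of q] that D(2) sub(4) by blast
    have "(\<integral>\<^sup>+q. indicator D (\<Psi> \<tau> q) * ennreal (distortion q \<tau>) \<partial>vol)
      = (\<integral>\<^sup>+x. ennreal (indicator (snd c ` fst c) x * vol_density c x)
          * (indicator D (\<Psi> \<tau> (chart_inv c x)) * ennreal (distortion (chart_inv c x) \<tau>)) \<partial>lborel)"
    proof (rule nn_integral_vol_chart[OF c])
      show "(\<lambda>q. indicator D (\<Psi> \<tau> q) * ennreal (distortion q \<tau>)) \<in> borel_measurable borel"
        using D(1) by measurable
      show "indicator D (\<Psi> \<tau> q) * ennreal (distortion q \<tau>) = 0" if "q \<notin> fst c" for q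
        using D_imp[of q] that open_chart_inv_image(2)[OF c open_ball sub(2)] by (auto simp: indicator_def)
    qed
    also have "\<dots> = (\<integral>\<^sup>+x. ennreal (indicator P x * (\<bar>det (matrix (\<lambda>v. dir_deriv (rep c) (v, 0) (x, \<tau>)))\<bar> * vol_density c (?T x))) \<partial>lborel)"
    proof (rule nn_integral_cong)
      fix x
      show "ennreal (indicator (snd c ` fst c) x * vol_density c x)
          * (indicator D (\<Psi> \<tau> (chart_inv c x)) * ennreal (distortion (chart_inv c x) \<tau>))
        = ennreal (indicator P x * (\<bar>det (matrix (\<lambda>v. dir_deriv (rep c) (v, 0) (x, \<tau>)))\<bar> * vol_density c (?T x)))"
      proof (cases "x \<in> P")
        case True
        then have xB: "x \<in> ?B" and TxD: "?T x \<in> D'" by (auto simp: P_def)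
        note xd = dom[OF xB \<tau>(1)]
        have x: "x \<in> snd c ` fst c" "\<Psi> \<tau> (chart_inv c x) \<in> fst c" using xd by (auto simp: dom_def)
        obtain p where p: "p \<in> D" "snd c (\<Psi> \<tau> (chart_inv c x)) = snd c p" using TxD by (auto simp: D'_def rep_def)
        then have "\<Psi> \<tau> (chart_inv c x) = p" using inj_onD[OF inj_on_chart[OF c] p(2)] x(2) Dc by auto
        then have "indicator D (\<Psi> \<tau> (chart_inv c x)) = (1 :: ennreal)" using p by simp
        moreover have "ennreal (vol_density c x) * ennreal (distortion (chart_inv c x) \<tau>)
          = ennreal (\<bar>det (?D x)\<bar> * vol_density c (?T x))"
          using vol_density_pos[OF c x(1)] distortion_chart[OF c xd] by (simp add: ennreal_mult' [symmetric] mult.commute)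
        ultimately show ?thesis using True x(1) by (simp add: differential_def)
      next
        case False
        \<comment> \<open>A point mapped into \<open>D\<close> comes from the ball of radius
          \<open>2 * r\<close>, and chart inverses are injective, so it would belong to
          \<open>P\<close>.\<close>
        have "indicator D (\<Psi> \<tau> (chart_inv c x)) = (0 :: ennreal)" if x: "x \<in> snd c ` fst c"
        proof (rule ccontr)
          assume "indicator D (\<Psi> \<tau> (chart_inv c x)) \<noteq> (0 :: ennreal)"
          then have in_D: "\<Psi> \<tau> (chart_inv c x) \<in> D" by (simp add: indicator_def split: if_splits)
          obtain y where y: "y \<in> ball x0 (2 * r)" "chart_inv c x = chart_inv c y" using D_imp[OF in_D] by auto
          then have "x = y" using chart_chart_inv[OF c x] chart_chart_inv[OF c, of y] sub(2) by auto
          then have "x \<in> ?B" using y by simp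
          moreover have "?T x \<in> D'" using in_D by (simp add: rep_def D'_def)
          ultimately show False using False by (simp add: P_def)
        qed
        then show ?thesis using False by (cases "x \<in> snd c ` fst c") auto
      qed
    qed
    also have "\<dots> = (\<integral>\<^sup>+y. ennreal (indicator (?T ` P) y * vol_density c y) \<partial>lborel)"
    proof (rule nn_integral_change_of_variables[symmetric, OF P_borel])
      show "(?T has_derivative (\<lambda>v. dir_deriv (rep c) (v, 0) (x, \<tau>))) (at x)" if "x \<in> P" for x
        using has_derivative_slice(2)[OF has_derivative_rep[OF c dom[OF _ \<tau>(1)]]] that by (simp add: P_def)
      show "inj_on ?T P" using inj[OF \<tau>(1)] by (rule inj_on_subset) (auto simp: P_def)
      show "0 \<le> vol_density c y" if "y \<in> ?T ` P" for y
        using that vol_density_pos[OF c, of y] D'_ball sub(1) unfolding TP by fastforce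
      show "(\<lambda>y. indicator (?T ` P) y * vol_density c y) \<in> borel_measurable borel"
        unfolding TP using D'_ball sub(1) by (intro vol_density_measurable c D'_borel) auto
      show "(\<lambda>x. indicator P x * (\<bar>det (matrix (\<lambda>v. dir_deriv (rep c) (v, 0) (x, \<tau>)))\<bar> * vol_density c (?T x))) \<in> borel_measurable borel"
        using m2 by (simp add: differential_def)
    qed
    also have "\<dots> = emeasure vol D"
      unfolding TP emeasure_vol[OF c D(1) Dc] chart_volume_def D'_def ..
    finally show "(\<integral>\<^sup>+q. indicator D (\<Psi> \<tau> q) * ennreal (distortion q \<tau>) \<partial>vol) = emeasure vol D" .
  qed
qed

text \<open>The preimages of the pieces \<open>D i\<close> partition the manifold, so summing the
  local identities suffices. Global injectivity or a degree of \<open>\<Psi> \<tau>\<close> never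
  enters.\<close>

theorem integral_distortion:
  obtains d where "0 < d" "\<And>\<tau>. \<tau> \<in> ball 0 d \<Longrightarrow> (\<integral>q. distortion q \<tau> \<partial>vol) = measure vol UNIV"
proof -
  obtain n :: nat and c x r D where c: "\<And>i. i < n \<Longrightarrow> c i \<in> A" and r: "\<And>i. i < n \<Longrightarrow> 0 < r i"
    and ball: "\<And>i. i < n \<Longrightarrow> cball (x i) (3 * r i) \<subseteq> snd (c i) ` fst (c i)"
    and D: "\<And>i. i < n \<Longrightarrow> D i \<in> sets borel" "\<And>i. i < n \<Longrightarrow> D i \<subseteq> chart_inv (c i) ` ball (x i) (r i)"
    and disj: "disjoint_family_on D {..<n}" and UD: "(\<Union>i<n. D i) = UNIV"
    by (rule coordinate_cover) blast
  define Q where "Q i d \<longleftrightarrow> 0 < d \<and> (\<forall>\<tau>\<in>ball 0 d. (\<lambda>q. distortion q \<tau>) \<in> borel_measurable borel \<longrightarrow>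
      (\<integral>\<^sup>+q. indicator (D i) (\<Psi> \<tau> q) * ennreal (distortion q \<tau>) \<partial>vol) = emeasure vol (D i))" for i d
  have "\<exists>d. Q i d" if i: "i < n" for i
    unfolding Q_def
    by (rule nn_integral_distortion_local[OF c[OF i] r[OF i] ball[OF i] D(1)[OF i] D(2)[OF i]]) blast
  then obtain d where Qd: "\<And>i. i < n \<Longrightarrow> Q i (d i)" by metis
  from Qd have d: "\<And>i. i < n \<Longrightarrow> 0 < d i"
    "\<And>i \<tau>. i < n \<Longrightarrow> \<tau> \<in> ball 0 (d i) \<Longrightarrow> (\<lambda>q. distortion q \<tau>) \<in> borel_measurable borel \<Longrightarrow>
      (\<integral>\<^sup>+q. indicator (D i) (\<Psi> \<tau> q) * ennreal (distortion q \<tau>) \<partial>vol) = emeasure vol (D i)"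
    by (auto simp: Q_def)
  obtain d0 B0 where d0: "0 < d0" "\<And>\<tau>. \<tau> \<in> ball 0 d0 \<Longrightarrow> continuous_on UNIV (\<lambda>q. distortion q \<tau>)"
    using param_Ck_uniform[OF param_Ck_distortion[of 0]] by metis
  define \<delta> where "\<delta> = Min (insert (min d0 \<epsilon>) (d ` {..<n}))"
  have \<delta>: "0 < \<delta>" "\<delta> \<le> d0" "\<delta> \<le> \<epsilon>" "\<And>i. i < n \<Longrightarrow> \<delta> \<le> d i"
  proof -
    have le: "\<delta> \<le> a" if "a \<in> insert (min d0 \<epsilon>) (d ` {..<n})" for a
      unfolding \<delta>_def using that by (intro Min_le) auto
    show "0 < \<delta>" using d(1) d0(1) \<epsilon> by (auto simp: \<delta>_def)
    show "\<delta> \<le> d0" "\<delta> \<le> \<epsilon>" "\<And>i. i < n \<Longrightarrow> \<delta> \<le> d i" using le[of "min d0 \<epsilon>"] le by auto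
  qed
  show thesis
  proof (rule that[OF \<delta>(1)])
    fix \<tau> :: 'p assume \<tau>: "\<tau> \<in> ball 0 \<delta>"
    have meas [measurable]: "(\<lambda>q. distortion q \<tau>) \<in> borel_measurable borel"
      using \<tau> \<delta> by (intro borel_measurable_continuous_onI d0(2)) auto
    have "continuous_on UNIV (\<Psi> \<tau>)"
      by (rule continuous_on_compose2[OF continuous_\<Psi>, of _ "\<lambda>q. (q, \<tau>)", simplified])
        (use \<tau> \<delta> in \<open>auto intro!: continuous_intros\<close>)
    then have [measurable]: "\<Psi> \<tau> \<in> borel_measurable borel" by (rule borel_measurable_continuous_onI)
    have one: "(\<Sum>i<n. indicator (D i) p) = (1 :: ennreal)" for p
    proof -
      have "(\<Sum>i<n. indicator (D i) p) = (indicator (\<Union>i<n. D i) p :: ennreal)"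
        using disj by (intro indicator_UN_disjoint[symmetric]) auto
      then show ?thesis by (simp add: UD)
    qed
    have "(\<integral>\<^sup>+q. ennreal (distortion q \<tau>) \<partial>vol) = (\<integral>\<^sup>+q. (\<Sum>i<n. indicator (D i) (\<Psi> \<tau> q) * ennreal (distortion q \<tau>)) \<partial>vol)"
      by (simp add: sum_distrib_right[symmetric] one)
    also have "\<dots> = (\<Sum>i<n. \<integral>\<^sup>+q. indicator (D i) (\<Psi> \<tau> q) * ennreal (distortion q \<tau>) \<partial>vol)"
    proof (rule nn_integral_sum)
      fix i assume "i \<in> {..<n}"
      then have [measurable]: "D i \<in> sets borel" using D by simp
      show "(\<lambda>q. indicator (D i) (\<Psi> \<tau> q) * ennreal (distortion q \<tau>)) \<in> borel_measurable vol"
        by measurable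
    qed
    also have "\<dots> = (\<Sum>i<n. emeasure vol (D i))"
      using \<tau> \<delta>(4) by (intro sum.cong refl d(2) meas) fastforce+
    also have "\<dots> = emeasure vol (\<Union>i<n. D i)"
      using D disj by (intro sum_emeasure) auto
    finally have "(\<integral>\<^sup>+q. ennreal (distortion q \<tau>) \<partial>vol) = emeasure vol UNIV" by (simp add: UD)
    \<comment> \<open>Needed to read the nonnegative integral as a Lebesgue integral. The
      differential contributes the square of its determinant, so no invertibility has to be
      known.\<close>
    moreover have "0 \<le> distortion q \<tau>" for q
    proof -
      have "0 \<le> det (gram (\<Psi> \<tau>) (chart_at A q) (chart_at A (\<Psi> \<tau> q)) q)"
      proof -
        let ?L = "matrix (frechet_derivative (snd (chart_at A (\<Psi> \<tau> q)) \<circ> \<Psi> \<tau> \<circ> chart_inv (chart_at A q)) (at (snd (chart_at A q) q)))"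
        have G: "0 < det (g (chart_at A q) q)" "0 < det (g (chart_at A (\<Psi> \<tau> q)) (\<Psi> \<tau> q))"
          using chart_at by (auto intro: det_metric_pos)
        then have "det (matrix_inv (g (chart_at A q) q)) * det (g (chart_at A q) q) = 1"
          using arg_cong[OF matrix_inv_mult(2)[of "g (chart_at A q) q"], of det] by (simp add: det_mul invertible_det_nz)
        then have "0 < det (matrix_inv (g (chart_at A q) q))"
          using G(1) by (metis zero_less_mult_pos2 zero_less_one)
        then have "0 \<le> det (matrix_inv (g (chart_at A q) q)) * det (g (chart_at A (\<Psi> \<tau> q)) (\<Psi> \<tau> q)) * (det ?L * det ?L)"
          using G(2) by simp
        then show ?thesis by (simp add: gram_def Let_def det_mul mult_ac)
      qed
      then show ?thesis by (simp add: distortion_def volume_distortion_def)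
    qed
    ultimately show "(\<integral>q. distortion q \<tau> \<partial>vol) = measure vol UNIV"
      by (subst integral_eq_nn_integral) (auto simp: measure_def)
  qed
qed

lemma integral_dir_deriv_distortion: "(\<integral>q. dir_deriv (distortion q) v 0 \<partial>vol) = 0"
  and integral_dir_deriv2_distortion: "(\<integral>q. dir_deriv (dir_deriv (distortion q) v) u 0 \<partial>vol) = 0"
proof -
  obtain d where d: "0 < d" "\<And>\<tau>. \<tau> \<in> ball 0 d \<Longrightarrow> (\<integral>q. distortion q \<tau> \<partial>vol) = measure vol UNIV"
    using integral_distortion by metis
  have ev: "eventually (\<lambda>s. (\<integral>q. distortion q (\<tau> + s *\<^sub>R w) \<partial>vol) = measure vol UNIV) (nhds (0::real))"
    if "\<tau> \<in> ball 0 d" for \<tau> w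
  proof -
    have "open ((\<lambda>s::real. \<tau> + s *\<^sub>R w) -` ball 0 d)" by (intro open_vimage continuous_intros) auto
    then show ?thesis
      unfolding eventually_nhds using that d(2) by (intro exI[of _ "(\<lambda>s. \<tau> + s *\<^sub>R w) -` ball 0 d"]) auto
  qed
  have 0: "deriv (\<lambda>s. \<integral>q. distortion q (\<tau> + s *\<^sub>R w) \<partial>vol) 0 = 0" if "\<tau> \<in> ball 0 d" for \<tau> w
    using deriv_cong_ev[OF ev[OF that, of w] refl] by simp
  obtain e where "0 < e" and e: "\<And>\<tau>. \<tau> \<in> ball 0 e \<Longrightarrow>
      ((\<lambda>s. \<integral>q. distortion q (\<tau> + s *\<^sub>R v) \<partial>vol) has_real_derivative (\<integral>q. dir_deriv (distortion q) v \<tau> \<partial>vol)) (at 0)"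
    using has_real_derivative_integral_param[OF param_Ck_distortion[of "Suc 0"]] by metis
  show "(\<integral>q. dir_deriv (distortion q) v 0 \<partial>vol) = 0"
    using 0[of 0 v] DERIV_imp_deriv[OF e[of 0]] d(1) \<open>0 < e\<close> by simp
  have "open ((\<lambda>t::real. t *\<^sub>R u) -` ball 0 d)" by (intro open_vimage continuous_intros) auto
  then have "eventually (\<lambda>t::real. deriv (\<lambda>s. \<integral>q. distortion q (t *\<^sub>R u + s *\<^sub>R v) \<partial>vol) 0 = 0) (nhds 0)"
    unfolding eventually_nhds using 0 d(1) by (intro exI[of _ "(\<lambda>t. t *\<^sub>R u) -` ball 0 d"]) auto
  from deriv_cong_ev[OF this refl] second_derivative_integral_param[OF param_Ck_distortion, of u v]
  show "(\<integral>q. dir_deriv (dir_deriv (distortion q) v) u 0 \<partial>vol) = 0" by simp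
qed

end

section \<open>The second variation\<close>

context variation
begin

lemma dir_deriv_time:
  assumes c: "c \<in> A" and z: "(x, \<tau>) \<in> dom c" and f: "Ck_on (Suc k) f (dom c)"
  shows "((\<lambda>\<tau>. f (x, \<tau>)) has_derivative (\<lambda>v. dir_deriv f (0, v) (x, \<tau>))) (at \<tau>)"
  by (rule has_derivative_slice(1)[OF has_derivative_dir_deriv[OF f z]])

definition velocity :: "'p \<Rightarrow> ('a, real^'m) chart \<Rightarrow> 'a \<Rightarrow> real^'m" where
  "velocity v c p = dir_deriv (rep c) (0, v) (snd c p, 0)"

lemma velocity_eq:
  assumes c: "c \<in> A" and p: "p \<in> fst c" and \<omega>: "variation_field A (\<lambda>t. \<Psi> (t *\<^sub>R v)) \<omega>"
  shows "\<omega> c p = velocity v c p"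
proof -
  have x: "snd c p \<in> snd c ` fst c" using p by simp
  have "((\<lambda>t. rep c (snd c p, t *\<^sub>R v)) has_derivative (\<lambda>h. dir_deriv (rep c) (0, h *\<^sub>R v) (snd c p, 0))) (at 0)"
  proof -
    have "((\<lambda>\<tau>. rep c (snd c p, \<tau>)) has_derivative (\<lambda>v. dir_deriv (rep c) (0, v) (snd c p, 0))) (at (0 *\<^sub>R v))"
      using dir_deriv_time[OF c dom_0[OF c x] Ck_on_rep[OF c]] by simp
    moreover have "((\<lambda>t. t *\<^sub>R v) has_derivative (\<lambda>h. h *\<^sub>R v)) (at 0)"
      by (intro has_derivative_scaleR_left has_derivative_ident)
    ultimately show ?thesis by (rule has_derivative_compose[rotated])
  qed
  moreover have "dir_deriv (rep c) (0, h *\<^sub>R v) (snd c p, 0) = h *\<^sub>R dir_deriv (rep c) (0, v) (snd c p, 0)" for h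
    using linear_scale[OF has_derivative_linear[OF has_derivative_rep[OF c dom_0[OF c x]]], of h "(0, v)"] by simp
  ultimately have "((\<lambda>t. snd c (\<Psi> (t *\<^sub>R v) p)) has_vector_derivative velocity v c p) (at 0)"
    by (simp add: has_vector_derivative_def velocity_def rep_def chart_inv_chart[OF c p])
  moreover have "((\<lambda>t. snd c (\<Psi> (t *\<^sub>R v) p)) has_vector_derivative \<omega> c p) (at 0)"
    using \<omega> c p by (simp add: variation_field_def \<Psi>_0)
  ultimately show ?thesis by (rule vector_derivative_unique_at[symmetric])
qed

text \<open>This is where the Lie derivative enters: the product rule for
  \<open>transpose (differential) ** g ** differential\<close> yields its three summands. The
  velocity must match \<open>V\<close> on the whole chart domain, since \<open>V\<close> is
  differentiated in space.\<close>

lemma dir_deriv_pullback_0: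
  assumes c: "c \<in> A" and p: "p \<in> fst c" and V: "\<And>q. q \<in> fst c \<Longrightarrow> V c q = velocity v c q"
  shows "dir_deriv (\<lambda>\<tau>. pullback c (snd c p, \<tau>)) v 0 = matrix_inv (g c p) ** lie_derivative_metric g V c p"
proof -
  let ?x = "snd c p"
  let ?G = "\<lambda>x. g c (chart_inv c x)"
  have x: "?x \<in> snd c ` fst c" using p by simp
  note z = dom_0[OF c x] and o = open_dom[OF c]
  define D where "D v = dir_deriv (differential c) (0, v) (?x, 0)" for v
  define G' where "G' = frechet_derivative (g c \<circ> chart_inv c) (at ?x)"
  have dL: "((\<lambda>\<tau>. differential c (?x, \<tau>)) has_derivative D) (at 0)"
    unfolding D_def[abs_def] by (rule dir_deriv_time[OF c z Ck_on_differential[OF c]])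
  have "(?G has_derivative G') (at (rep c (?x, 0)))"
    using Ck_on_SucD_derivative[OF Ck_on_metric[OF c] x] by (simp add: rep_0[OF c x] G'_def o_def)
  from has_derivative_compose[OF dir_deriv_time[OF c z Ck_on_rep[OF c]] this]
  have dG: "((\<lambda>\<tau>. ?G (rep c (?x, \<tau>))) has_derivative (\<lambda>v. G' (velocity v c p))) (at 0)" by (simp add: velocity_def)
  note FD = bounded_bilinear.FDERIV[OF bounded_bilinear_matrix_matrix_mult]
  have "((\<lambda>\<tau>. matrix_inv (g c p) ** (transpose (differential c (?x, \<tau>)) ** (?G (rep c (?x, \<tau>)) ** differential c (?x, \<tau>))))
      has_derivative (\<lambda>v. matrix_inv (g c p) ** (transpose (differential c (?x, 0)) ** (?G (rep c (?x, 0)) ** D v + G' (velocity v c p) ** differential c (?x, 0))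
      + transpose (D v) ** (?G (rep c (?x, 0)) ** differential c (?x, 0))) + 0 ** (transpose (differential c (?x, 0)) ** (?G (rep c (?x, 0)) ** differential c (?x, 0))))) (at 0)"
    by (intro FD dL dG bounded_linear.has_derivative[OF bounded_linear_transpose] has_derivative_const)
  from dir_deriv_eq[OF this, of v]
  have "dir_deriv (\<lambda>\<tau>. pullback c (?x, \<tau>)) v 0
      = matrix_inv (g c p) ** (g c p ** D v + G' (velocity v c p) + transpose (D v) ** g c p)"
    by (simp add: pullback_def matrix_mul_assoc[symmetric] chart_inv_chart[OF c p] differential_0[OF c x] rep_0[OF c x]
        transpose_mat bounded_bilinear.zero_left[OF bounded_bilinear_matrix_matrix_mult])
  \<comment> \<open>The parameter derivative of the differential is the spatial derivative of the
    velocity, by symmetry of second derivatives.\<close>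
  also have "D v = matrix (frechet_derivative (V c \<circ> chart_inv c) (at ?x))"
  proof -
    have w: "Ck_on (Suc 0) (dir_deriv (rep c) w) (dom c)" for w by (rule Ck_on_dir_deriv[OF Ck_on_rep[OF c]])
    have "((\<lambda>x. dir_deriv (rep c) (0, v) (x, 0)) has_derivative (\<lambda>w. dir_deriv (dir_deriv (rep c) (0, v)) (w, 0) (?x, 0))) (at ?x)"
      by (rule has_derivative_slice(2)[OF has_derivative_dir_deriv[OF w z]])
    then have "((V c \<circ> chart_inv c) has_derivative (\<lambda>w. dir_deriv (dir_deriv (rep c) (0, v)) (w, 0) (?x, 0))) (at ?x)"
      by (rule has_derivative_transform_within_open[OF _ open_chart_image[OF c] x])
        (use c in \<open>auto simp: V velocity_def chart_inv_chart\<close>)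
    then have fd: "frechet_derivative (V c \<circ> chart_inv c) (at ?x) = (\<lambda>w. dir_deriv (dir_deriv (rep c) (0, v)) (w, 0) (?x, 0))"
      using frechet_derivative_at by metis
    have "D v $ i $ j = dir_deriv (dir_deriv (rep c) (0, v)) (axis j 1, 0) (?x, 0) $ i" for i j
    proof -
      have "D v $ i $ j = dir_deriv (\<lambda>z. differential c z $ i $ j) (0, v) (?x, 0)"
        unfolding D_def
        using dir_deriv_bounded_linear[OF bounded_linear_compose[OF bounded_linear_vec_nth bounded_linear_vec_nth]
            Ck_on_differential[OF c] z] by metis
      also have "\<dots> = dir_deriv (dir_deriv (rep c) (axis j 1, 0)) (0, v) (?x, 0) $ i"
        unfolding differential_nth by (rule dir_deriv_bounded_linear[OF bounded_linear_vec_nth w z])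
      also have "dir_deriv (dir_deriv (rep c) (axis j 1, 0)) (0, v) (?x, 0) = dir_deriv (dir_deriv (rep c) (0, v)) (axis j 1, 0) (?x, 0)"
        by (rule dir_deriv_commute[OF o z Ck_on_rep[OF c]])
      finally show ?thesis .
    qed
    then show ?thesis by (simp add: fd matrix_def vec_eq_iff)
  qed
  finally show ?thesis
    by (simp add: lie_derivative_metric_def Let_def G'_def V[OF p] add_ac)
qed

definition slice :: "('a, real^'m) chart \<Rightarrow> 'a \<Rightarrow> 'p set" where
  "slice c p = {\<tau>. (snd c p, \<tau>) \<in> dom c}"

lemma slice:
  assumes c: "c \<in> A" and p: "p \<in> fst c"
  shows "open (slice c p)" "0 \<in> slice c p" "Ck_on k (\<lambda>\<tau>. pullback c (snd c p, \<tau>)) (slice c p)"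
    "pullback c (snd c p, 0) = mat 1"
    "\<And>\<tau>. \<tau> \<in> slice c p \<Longrightarrow> energy_density \<alpha> p \<tau> = (1 + trace (pullback c (snd c p, \<tau>))) powr \<alpha>"
    "\<And>\<tau>. \<tau> \<in> slice c p \<Longrightarrow> distortion p \<tau> = sqrt (det (pullback c (snd c p, \<tau>)))"
proof -
  show o: "open (slice c p)"
    unfolding slice_def using open_vimage[OF open_dom[OF c], of "\<lambda>\<tau>. (snd c p, \<tau>)"]
    by (simp add: vimage_def continuous_on_Pair)
  show "0 \<in> slice c p" "pullback c (snd c p, 0) = mat 1"
    using p by (auto simp: slice_def intro!: dom_0 pullback_0 c)
  show "Ck_on k (\<lambda>\<tau>. pullback c (snd c p, \<tau>)) (slice c p)"
    by (rule Ck_on_compose[OF o Ck_on_Pair[OF o Ck_on_const Ck_on_ident] Ck_on_pullback[OF c]]) (simp add: slice_def)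
  show "energy_density \<alpha> p \<tau> = (1 + trace (pullback c (snd c p, \<tau>))) powr \<alpha>"
    "distortion p \<tau> = sqrt (det (pullback c (snd c p, \<tau>)))" if "\<tau> \<in> slice c p" for \<tau>
    using pullback_invariant[OF c, of "snd c p" \<tau>] that
    by (simp_all add: slice_def energy_density_def distortion_def chart_inv_chart[OF c p])
qed

lemma dir_deriv2_cong:
  assumes "open S" "x \<in> S" "\<And>y. y \<in> S \<Longrightarrow> f y = h y"
  shows "dir_deriv (dir_deriv f v) u x = dir_deriv (dir_deriv h v) u x"
  using assms by (intro dir_deriv_cong[of S]) (auto intro: dir_deriv_cong)

text \<open>Both derivatives are multiples of \<open>trace (dir_deriv S v 0)\<close> for the
  pullback \<open>S\<close>. The common factor makes the identity harmonic and reappears in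
  \<open>reduced_hessian\<close>.\<close>

lemma dir_deriv_densities:
  "dir_deriv (energy_density \<alpha> p) v 0 = 2 * \<alpha> * (1 + real CARD('m)) powr (\<alpha> - 1) * dir_deriv (distortion p) v 0"
proof -
  note sl = slice[OF chart_at(1)[of p] chart_at(2)[of p]]
  note S = sl(1,2) sl(3)[of 2] sl(4)
  have "dir_deriv (energy_density \<alpha> p) v 0 = dir_deriv (\<lambda>\<tau>. (1 + trace (pullback (chart_at A p) (snd (chart_at A p) p, \<tau>))) powr \<alpha>) v 0"
    using sl(5) by (intro dir_deriv_cong[OF sl(1,2)])
  moreover have "dir_deriv (distortion p) v 0 = dir_deriv (\<lambda>\<tau>. sqrt (det (pullback (chart_at A p) (snd (chart_at A p) p, \<tau>)))) v 0"
    using sl(6) by (intro dir_deriv_cong[OF sl(1,2)])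
  ultimately show ?thesis
    by (simp add: dir_deriv_trace_powr_at[OF S] dir_deriv_sqrt_det_at[OF S])
qed

text \<open>Subtracting a multiple of the second derivative of the distortion, whose integral vanishes, cancels the
  acceleration of the variation.\<close>

definition reduced_hessian :: "real \<Rightarrow> 'p \<Rightarrow> 'p \<Rightarrow> 'a \<Rightarrow> real" where
  "reduced_hessian \<alpha> u v p = dir_deriv (dir_deriv (energy_density \<alpha> p) v) u 0
     - 2 * \<alpha> * (1 + real CARD('m)) powr (\<alpha> - 1) * dir_deriv (dir_deriv (distortion p) v) u 0"

text \<open>The traces of the second derivative of the pullback cancel. Of the rest,
  \<open>(\<alpha> - 1) / (1 + m)\<close> stems from the power, the square root of the determinant
  gives -1/2, and \<open>trace (X ** X)\<close> comes from the derivative of the inverse matrix.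
  Both directions have the same velocity because only the diagonal value of the second variation is
  wanted.\<close>

lemma reduced_hessian_eq:
  assumes c: "c \<in> A" and p: "p \<in> fst c"
    and Vu: "\<And>q. q \<in> fst c \<Longrightarrow> V c q = velocity u c q" and Vv: "\<And>q. q \<in> fst c \<Longrightarrow> V c q = velocity v c q"
    and X: "X = matrix_inv (g c p) ** lie_derivative_metric g V c p"
  shows "reduced_hessian \<alpha> u v p = \<alpha> * (1 + real CARD('m)) powr (\<alpha> - 1)
    * (trace (X ** X) + ((\<alpha> - 1) / (1 + real CARD('m)) - 1 / 2) * (trace X)\<^sup>2)"
proof -
  note sl = slice[OF c p]
  note S = sl(1,2) sl(3)[of 2] sl(4)
  let ?S = "\<lambda>\<tau>. pullback c (snd c p, \<tau>)"
  have A: "dir_deriv ?S u 0 = X" "dir_deriv ?S v 0 = X"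
    unfolding X by (rule dir_deriv_pullback_0[OF c p], erule Vu Vv)+
  have m: "0 < 1 + real CARD('m)" by simp
  have pw: "(1 + real CARD('m)) powr (\<alpha> - 2) = (1 + real CARD('m)) powr (\<alpha> - 1) / (1 + real CARD('m))"
    using powr_diff[of "1 + real CARD('m)" "\<alpha> - 1" 1] m by (simp add: algebra_simps)
  have "dir_deriv (dir_deriv (energy_density \<alpha> p) v) u 0 = dir_deriv (dir_deriv (\<lambda>\<tau>. (1 + trace (?S \<tau>)) powr \<alpha>) v) u 0"
    using sl(5) by (intro dir_deriv2_cong[OF sl(1,2)])
  also have "\<dots> = \<alpha> * (\<alpha> - 1) * (1 + real CARD('m)) powr (\<alpha> - 2) * trace X * trace X
      + \<alpha> * (1 + real CARD('m)) powr (\<alpha> - 1) * trace (dir_deriv (dir_deriv ?S v) u 0)"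
    by (simp add: dir_deriv2_trace_powr[OF S] A)
  finally have E: "dir_deriv (dir_deriv (energy_density \<alpha> p) v) u 0 = \<dots>" .
  have "dir_deriv (dir_deriv (distortion p) v) u 0 = dir_deriv (dir_deriv (\<lambda>\<tau>. sqrt (det (?S \<tau>))) v) u 0"
    using sl(6) by (intro dir_deriv2_cong[OF sl(1,2)])
  also have "\<dots> = (trace X * trace X / 2 - trace (X ** X) + trace (dir_deriv (dir_deriv ?S v) u 0)) / 2"
    by (simp add: dir_deriv2_sqrt_det[OF S] A)
  finally have J: "dir_deriv (dir_deriv (distortion p) v) u 0 = \<dots>" .
  show ?thesis
    unfolding reduced_hessian_def E J pw using m by (simp add: field_simps power2_eq_square)
qed

lemma continuous_dir_deriv2:
  fixes G :: "'a \<Rightarrow> 'p \<Rightarrow> real"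
  assumes "param_Ck 2 G"
  shows "continuous_on UNIV (\<lambda>q. dir_deriv (dir_deriv (G q) v) u 0)"
    "integrable vol (\<lambda>q. dir_deriv (dir_deriv (G q) v) u 0)"
proof -
  have "param_Ck (Suc (Suc 0)) G" using assms by (simp add: numeral_2_eq_2)
  then have "param_Ck 0 (\<lambda>q. dir_deriv (dir_deriv (G q) v) u)"
    by (intro param_Ck_dir_deriv)
  then obtain d B where d: "0 < d" "\<And>\<tau>. \<tau> \<in> ball 0 d \<Longrightarrow> continuous_on UNIV (\<lambda>q. dir_deriv (dir_deriv (G q) v) u \<tau>)"
    "\<And>q \<tau>. \<tau> \<in> ball 0 d \<Longrightarrow> norm (dir_deriv (dir_deriv (G q) v) u \<tau>) \<le> B"
    by (rule param_Ck_uniform) blast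
  show c: "continuous_on UNIV (\<lambda>q. dir_deriv (dir_deriv (G q) v) u 0)" using d by simp
  show "integrable vol (\<lambda>q. dir_deriv (dir_deriv (G q) v) u 0)"
    using d(1) d(3)[of 0] borel_measurable_continuous_onI[OF c] measurable_cong_sets[OF sets_vol refl]
    by (intro vol.integrable_const_bound[of _ B]) auto
qed

lemma reduced_hessian:
  "continuous_on UNIV (reduced_hessian \<alpha> u v)" "integrable vol (reduced_hessian \<alpha> u v)"
  "deriv (\<lambda>t. deriv (\<lambda>s. alpha_energy \<alpha> A g A g (\<Psi> (t *\<^sub>R u + s *\<^sub>R v))) 0) 0 = (\<integral>q. reduced_hessian \<alpha> u v q \<partial>vol)"
proof -
  note E = continuous_dir_deriv2[OF param_Ck_energy_density[of 2 \<alpha>], of v u]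
  note J = continuous_dir_deriv2[OF param_Ck_distortion[of 2], of v u]
  show "continuous_on UNIV (reduced_hessian \<alpha> u v)"
    unfolding reduced_hessian_def[abs_def] by (intro continuous_intros E J)
  show "integrable vol (reduced_hessian \<alpha> u v)"
    unfolding reduced_hessian_def[abs_def] by (intro Bochner_Integration.integrable_diff integrable_mult_right E J)
  show "deriv (\<lambda>t. deriv (\<lambda>s. alpha_energy \<alpha> A g A g (\<Psi> (t *\<^sub>R u + s *\<^sub>R v))) 0) 0 = (\<integral>q. reduced_hessian \<alpha> u v q \<partial>vol)"
    unfolding alpha_energy_eq second_derivative_integral_param[OF param_Ck_energy_density] reduced_hessian_def
    using E(2) J(2) by (simp add: integral_dir_deriv2_distortion)
qed

lemma first_variation:
  "((\<lambda>t. alpha_energy \<alpha> A g A g (\<Psi> (t *\<^sub>R v))) has_real_derivative 0) (at 0)"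
proof -
  obtain d where d: "0 < d" "\<And>\<tau>. \<tau> \<in> ball 0 d \<Longrightarrow>
      ((\<lambda>s. \<integral>q. energy_density \<alpha> q (\<tau> + s *\<^sub>R v) \<partial>vol) has_real_derivative (\<integral>q. dir_deriv (energy_density \<alpha> q) v \<tau> \<partial>vol)) (at 0)"
    using has_real_derivative_integral_param[OF param_Ck_energy_density[of "Suc 0"]] by metis
  have "(\<integral>q. dir_deriv (energy_density \<alpha> q) v 0 \<partial>vol) = 0"
    unfolding dir_deriv_densities by (simp add: integral_dir_deriv_distortion)
  then show ?thesis using d(2)[of 0] d(1) by (simp add: alpha_energy_eq)
qed

end

section \<open>Harmonicity of the identity and the value of the second variation\<close>

context compact_riemannian
begin

text \<open>The reduced Hessian expressed by \<open>V\<close> alone. That no variation occurs in it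
  is what makes the value described by \<open>second_variation\<close> unique.\<close>

definition hessian_density :: "real \<Rightarrow> (('a, real^'m) chart \<Rightarrow> 'a \<Rightarrow> real^'m) \<Rightarrow> ('a, real^'m) chart \<Rightarrow> 'a \<Rightarrow> real" where
  "hessian_density \<alpha> V c p = (let X = matrix_inv (g c p) ** lie_derivative_metric g V c p in
     \<alpha> * (1 + real CARD('m)) powr (\<alpha> - 1)
      * (trace (X ** X) + ((\<alpha> - 1) / (1 + real CARD('m)) - 1 / 2) * (trace X)\<^sup>2))"

lemma smooth_variationE:
  fixes \<Psi> :: "'p::euclidean_space \<Rightarrow> 'a \<Rightarrow> 'a"
  assumes "smooth_variation A A id \<Psi>"
  obtains \<epsilon> where "variation A g \<Psi> \<epsilon>"
proof -
  obtain \<epsilon> where "\<Psi> 0 = id" "0 < \<epsilon>" "smooth_map_on (product_atlas A) A (UNIV \<times> ball 0 \<epsilon>) (\<lambda>(p, \<tau>). \<Psi> \<tau> p)"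
    using assms by (auto simp: smooth_variation_def)
  then have "variation A g \<Psi> \<epsilon>" by unfold_locales (auto simp: smooth_family_def)
  then show thesis by (rule that)
qed

lemma alpha_harmonic_id: "alpha_harmonic \<alpha> A g A g id"
  unfolding alpha_harmonic_def
proof (intro conjI allI impI)
  have "smooth_on (snd d \<circ> id \<circ> chart_inv c) (snd c ` (fst c \<inter> UNIV \<inter> id -` fst d))" if "c \<in> A" "d \<in> A" for c d
    using smooth_transition[OF that] by (simp add: transition_def)
  then show "smooth_map_on A A UNIV id" by (simp add: smooth_map_on_def)
  fix \<Psi> :: "real \<Rightarrow> 'a \<Rightarrow> 'a" assume "smooth_variation A A id \<Psi>"
  then obtain \<epsilon> where "variation A g \<Psi> \<epsilon>" by (rule smooth_variationE)
  then interpret variation A g \<Psi> \<epsilon> .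
  show "((\<lambda>t. alpha_energy \<alpha> A g A g (\<Psi> t)) has_real_derivative 0) (at 0)"
    using first_variation[of \<alpha> 1] by simp
qed

text \<open>Continuity, integrability and independence of the chart are all transferred from
  \<open>reduced_hessian\<close>, which is defined without a chart.\<close>

lemma second_derivative_variation:
  fixes \<Psi> :: "real \<times> real \<Rightarrow> 'a \<Rightarrow> 'a"
  assumes "smooth_variation A A id \<Psi>" "variation_field A (\<lambda>t. \<Psi> (t, 0)) V" "variation_field A (\<lambda>s. \<Psi> (0, s)) V"
  shows "deriv (\<lambda>t. deriv (\<lambda>s. alpha_energy \<alpha> A g A g (\<Psi> (t, s))) 0) 0 = (\<integral>p. hessian_density \<alpha> V (chart_at A p) p \<partial>vol)"
    "continuous_on UNIV (\<lambda>p. hessian_density \<alpha> V (chart_at A p) p)"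
    "integrable vol (\<lambda>p. hessian_density \<alpha> V (chart_at A p) p)"
    "\<And>c p. c \<in> A \<Longrightarrow> p \<in> fst c \<Longrightarrow> hessian_density \<alpha> V c p = hessian_density \<alpha> V (chart_at A p) p"
proof -
  obtain \<epsilon> where "variation A g \<Psi> \<epsilon>" using assms(1) by (rule smooth_variationE)
  then interpret variation A g \<Psi> \<epsilon> .
  have eq: "reduced_hessian \<alpha> (1, 0) (0, 1) p = hessian_density \<alpha> V c p" if "c \<in> A" "p \<in> fst c" for c p
    unfolding hessian_density_def Let_def
    using velocity_eq[OF that(1), of _ "(1, 0)" V] velocity_eq[OF that(1), of _ "(0, 1)" V] assms(2,3)
    by (intro reduced_hessian_eq[OF that]) auto
  have eq': "(\<lambda>p. hessian_density \<alpha> V (chart_at A p) p) = reduced_hessian \<alpha> (1, 0) (0, 1)"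
    using eq[OF chart_at] by (intro ext) simp
  show "deriv (\<lambda>t. deriv (\<lambda>s. alpha_energy \<alpha> A g A g (\<Psi> (t, s))) 0) 0 = (\<integral>p. hessian_density \<alpha> V (chart_at A p) p \<partial>vol)"
    unfolding eq' using reduced_hessian(3)[of \<alpha> "(1, 0)" "(0, 1)"] by simp
  show "continuous_on UNIV (\<lambda>p. hessian_density \<alpha> V (chart_at A p) p)"
    "integrable vol (\<lambda>p. hessian_density \<alpha> V (chart_at A p) p)"
    unfolding eq' by (rule reduced_hessian)+
  show "hessian_density \<alpha> V c p = hessian_density \<alpha> V (chart_at A p) p" if "c \<in> A" "p \<in> fst c" for c p
    using eq[OF that] eq[OF chart_at, of p] by simp
qed

end

section \<open>Existence of variations\<close>

text \<open>The functions \<open>x\<^sup>-\<^sup>n exp (- 1 / x)\<close> on the positive half-line, closed under differentiation up to linear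
  combinations.\<close>

definition flat :: "nat \<Rightarrow> real \<Rightarrow> real" where
  "flat n x = (if 0 < x then inverse x ^ n / exp (inverse x) else 0)"

lemma has_real_derivative_flat: "(flat n has_real_derivative flat (n + 2) x - real n * flat (n + 1) x) (at x)"
proof -
  consider "0 < x" | "x < 0" | "x = 0" by linarith
  then show ?thesis
  proof cases
    case 1
    have "((\<lambda>x. inverse x ^ n * exp (- inverse x)) has_real_derivative
        (real n * inverse x ^ (n - 1) * (- (inverse x * inverse x))) * exp (- inverse x)
        + inverse x ^ n * (exp (- inverse x) * (inverse x * inverse x))) (at x)"
      using 1 by (auto intro!: derivative_eq_intros)
    moreover have "(real n * inverse x ^ (n - 1) * (- (inverse x * inverse x))) * exp (- inverse x)
        + inverse x ^ n * (exp (- inverse x) * (inverse x * inverse x)) = flat (n + 2) x - real n * flat (n + 1) x"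
      using 1 by (cases n) (simp_all add: flat_def exp_minus divide_inverse algebra_simps)
    ultimately have "((\<lambda>x. inverse x ^ n * exp (- inverse x)) has_real_derivative flat (n + 2) x - real n * flat (n + 1) x) (at x)"
      by simp
    then show ?thesis
      by (rule has_field_derivative_transform_within_open[of _ _ _ "{0<..}"])
        (use 1 in \<open>auto simp: flat_def exp_minus divide_inverse\<close>)
  next
    case 2
    have "((\<lambda>x. 0) has_real_derivative 0) (at x)" by simp
    then have "(flat n has_real_derivative 0) (at x)"
      by (rule has_field_derivative_transform_within_open[of _ _ _ "{..<0}"]) (use 2 in \<open>auto simp: flat_def\<close>)
    then show ?thesis using 2 by (simp add: flat_def)
  next
    case 3
    have "((\<lambda>x. inverse x ^ Suc n / exp (inverse x)) \<longlongrightarrow> 0) (at_right (0::real))"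
      by (rule filterlim_compose[OF tendsto_power_div_exp_0 filterlim_inverse_at_top_right])
    then have "(flat (Suc n) \<longlongrightarrow> 0) (at_right 0)"
      by (rule Lim_transform_eventually) (auto simp: flat_def eventually_at_filter)
    moreover have "(flat (Suc n) \<longlongrightarrow> 0) (at_left 0)"
      by (rule Lim_transform_eventually[OF tendsto_const]) (auto simp: flat_def eventually_at_filter)
    ultimately have "(flat (Suc n) \<longlongrightarrow> 0) (at 0)" by (simp add: filterlim_split_at)
    \<comment> \<open>The difference quotient at 0 is again a function of the family, and it tends
      to 0 because the exponential beats every power.\<close>
    moreover have "(flat n (0 + h) - flat n 0) / h = flat (Suc n) h" for h by (simp add: flat_def divide_inverse)
    ultimately have "(flat n has_real_derivative 0) (at 0)" by (simp add: DERIV_def)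
    then show ?thesis using 3 by (simp add: flat_def)
  qed
qed

lemma Ck_on_flat: "Ck_on k (flat n) UNIV"
proof (induction k arbitrary: n)
  case 0
  show ?case using has_real_derivative_flat by (auto intro!: DERIV_isCont continuous_at_imp_continuous_on)
next
  case (Suc k)
  show ?case
    by (rule Ck_on_real_SucI[OF open_UNIV has_real_derivative_flat]) (intro Ck_on_diff Ck_on_mult Ck_on_const Suc open_UNIV)
qed

text \<open>Built from the squared distance, which unlike the distance is smooth at the
  centre.\<close>

definition bump :: "'e::euclidean_space \<Rightarrow> real \<Rightarrow> 'e \<Rightarrow> real" where
  "bump a r x = flat 0 (r\<^sup>2 - (x - a) \<bullet> (x - a))"

lemma Ck_on_bump: "Ck_on k (bump a r) UNIV"
proof -
  have "Ck_on k (\<lambda>x. r\<^sup>2 - (x - a) \<bullet> (x - a)) UNIV"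
    by (intro Ck_on_diff Ck_on_inner Ck_on_const Ck_on_ident open_UNIV)
  from Ck_on_compose[OF open_UNIV this Ck_on_flat] show ?thesis unfolding bump_def[abs_def] by simp
qed

lemma bump_pos_iff: "0 < r \<Longrightarrow> 0 < bump a r x \<longleftrightarrow> x \<in> ball a r"
proof -
  assume r: "0 < r"
  have "norm (x - a) < r \<longleftrightarrow> (norm (x - a))\<^sup>2 < r\<^sup>2"
    using r power_strict_mono[of "norm (x - a)" r 2] power2_less_imp_less[of "norm (x - a)" r] by auto
  moreover have "x \<in> ball a r \<longleftrightarrow> norm (x - a) < r" by (simp add: dist_norm norm_minus_commute)
  ultimately show ?thesis by (simp add: bump_def flat_def power2_norm_eq_inner)
qed

lemma bump_nonneg: "0 \<le> bump a r x"
  by (simp add: bump_def flat_def)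

section \<open>Smooth families: a local criterion, composition and change of parameters\<close>

context atlas
begin

text \<open>One pair of charts around each point and parameter suffices, as other pairs differ by
  transition maps. Continuity is settled first, because it provides the open domains in the other
  charts.\<close>

lemma smooth_familyI:
  fixes F :: "'p::euclidean_space \<Rightarrow> 'a \<Rightarrow> 'a"
  assumes "\<And>p \<tau>. \<tau> \<in> ball 0 \<epsilon> \<Longrightarrow> \<exists>c\<in>A. \<exists>d\<in>A. p \<in> fst c \<and> (\<exists>W. open W \<and> (snd c p, \<tau>) \<in> W \<and> W \<subseteq> family_dom \<epsilon> F c d \<and>
    (\<forall>k. Ck_on k (family_rep F c d) W))"
  shows "smooth_family \<epsilon> F"
  unfolding smooth_family_def smooth_map_on_def
proof (intro conjI ballI)
  let ?F = "\<lambda>(p, \<tau>). F \<tau> p"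
  have "isCont ?F (p, \<tau>)" if \<tau>: "\<tau> \<in> ball 0 \<epsilon>" for p \<tau>
  proof -
    obtain c d W where c: "c \<in> A" "p \<in> fst c" and d: "d \<in> A" and W: "open W" "(snd c p, \<tau>) \<in> W" "W \<subseteq> family_dom \<epsilon> F c d"
      and Ck: "\<And>k. Ck_on k (family_rep F c d) W"
      using assms[OF \<tau>, of p] by blast
    define Y where "Y = (fst c \<times> UNIV) \<inter> (\<lambda>z. (snd c (fst z), snd z)) -` W"
    have cc: "continuous_on (fst c \<times> UNIV) (\<lambda>z. (snd c (fst z), snd z))"
      by (intro continuous_intros continuous_on_compose2[OF continuous_on_chart[OF c(1)]]) auto
    have Y: "open Y" "(p, \<tau>) \<in> Y" unfolding Y_def
      using continuous_open_preimage[OF cc _ W(1)] open_chart_domain[OF c(1)] c W by (auto simp: open_Times)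
    have "continuous_on Y (\<lambda>z. chart_inv d (family_rep F c d (snd c (fst z), snd z)))"
    proof (intro continuous_on_compose2[OF continuous_on_chart_inv[OF d]] continuous_on_compose2[OF Ck_on_imp_continuous_on[OF Ck[of 0]]])
      show "continuous_on Y (\<lambda>z. (snd c (fst z), snd z))" using cc by (rule continuous_on_subset) (auto simp: Y_def)
      show "(\<lambda>z. family_rep F c d (snd c (fst z), snd z)) ` Y \<subseteq> snd d ` fst d"
        using W(3) by (force simp: Y_def family_dom_def family_rep_def)
    qed (auto simp: Y_def)
    moreover have "chart_inv d (family_rep F c d (snd c (fst z), snd z)) = ?F z" if "z \<in> Y" for z
      using that W(3) by (auto simp: Y_def family_dom_def family_rep_def chart_inv_chart c d subset_iff)
    ultimately have "continuous_on Y ?F" by (rule continuous_on_eq)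
    then show ?thesis using Y by (simp add: continuous_on_eq_continuous_at)
  qed
  then show cont: "continuous_on (UNIV \<times> ball 0 \<epsilon>) ?F"
    by (auto intro!: continuous_at_imp_continuous_on)
  then have cont': "continuous_on (UNIV \<times> ball 0 \<epsilon>) (\<lambda>z. F (snd z) (fst z))" by (simp add: case_prod_unfold)
  fix c' :: "('a \<times> 'p, 'e \<times> 'p) chart" and d2 assume "c' \<in> product_atlas A" and d2: "d2 \<in> A"
  then obtain c2 where c2: "c2 \<in> A" and c': "c' = (fst c2 \<times> UNIV, map_prod (snd c2) id)" by (auto simp: product_atlas_def)
  note o = open_family_dom[OF cont' c2 d2]
  have "Ck_on k (family_rep F c2 d2) (family_dom \<epsilon> F c2 d2)" for k
  proof (rule Ck_on_locally)
    fix z assume z: "z \<in> family_dom \<epsilon> F c2 d2"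
    define p where "p = chart_inv c2 (fst z)"
    have x: "fst z \<in> snd c2 ` fst c2" "snd z \<in> ball 0 \<epsilon>" "F (snd z) p \<in> fst d2" using z by (auto simp: family_dom_def p_def)
    have p: "p \<in> fst c2" "snd c2 p = fst z" using x c2 by (auto simp: p_def chart_inv_in chart_chart_inv)
    obtain c d W where c: "c \<in> A" "p \<in> fst c" and d: "d \<in> A" and W: "open W" "(snd c p, snd z) \<in> W" "W \<subseteq> family_dom \<epsilon> F c d"
      and Ck: "\<And>k. Ck_on k (family_rep F c d) W"
      using assms[OF x(2), of p] by blast
    let ?t = "\<lambda>z. (transition c2 c (fst z), snd z)"
    define Z where "Z = (snd c2 ` (fst c2 \<inter> fst c)) \<times> (UNIV :: 'p set)"
    have oZ: "open Z" unfolding Z_def using open_overlap[OF c2 c(1)] by (simp add: open_Times)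
    have t: "Ck_on k ?t Z" for k
      by (intro Ck_on_Pair oZ Ck_on_linear bounded_linear_snd
          Ck_on_compose[OF oZ Ck_on_linear[OF bounded_linear_fst] Ck_on_transition[OF c2 c(1)]]) (auto simp: Z_def)
    define Y where "Y = (Z \<inter> ?t -` W) \<inter> family_dom \<epsilon> F c2 d2"
    have Y: "open Y" "z \<in> Y"
    proof -
      show "open Y" unfolding Y_def
        by (intro open_Int o continuous_open_preimage[OF Ck_on_imp_continuous_on[OF t[of 0]]] oZ W)
      have "fst z = snd c2 p" using p by simp
      then show "z \<in> Y" unfolding Y_def Z_def
        using p c W z transition_chart[OF c2 p(1), of c] by (cases z) auto
    qed
    have in_Y: "transition c2 c (fst y) = snd c (chart_inv c2 (fst y)) \<and> chart_inv c2 (fst y) \<in> fst c2 \<inter> fst c" if "y \<in> Y" for y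
      using that c2 by (auto simp: Y_def Z_def transition_chart chart_inv_chart)
    have F_eq: "family_rep F c d (?t y) = snd d (F (snd y) (chart_inv c2 (fst y)))"
      and F_in: "F (snd y) (chart_inv c2 (fst y)) \<in> fst d \<inter> fst d2" if "y \<in> Y" for y
    proof -
      have q: "chart_inv c (transition c2 c (fst y)) = chart_inv c2 (fst y)" using in_Y[OF that] c by (simp add: chart_inv_chart)
      then show "family_rep F c d (?t y) = snd d (F (snd y) (chart_inv c2 (fst y)))" by (simp add: family_rep_def)
      have "?t y \<in> family_dom \<epsilon> F c d" "y \<in> family_dom \<epsilon> F c2 d2" using that W(3) by (auto simp: Y_def)
      then show "F (snd y) (chart_inv c2 (fst y)) \<in> fst d \<inter> fst d2" using q by (simp add: family_dom_def)
    qed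
    have "Ck_on k (\<lambda>y. family_rep F c d (?t y)) Y"
      by (rule Ck_on_compose[OF Y(1) Ck_on_subset[OF t] Ck]) (auto simp: Y_def)
    then have "Ck_on k (\<lambda>y. transition d d2 (family_rep F c d (?t y))) Y"
      by (rule Ck_on_compose[OF Y(1) _ Ck_on_transition[OF d d2]]) (use F_eq F_in in auto)
    then have "Ck_on k (family_rep F c2 d2) Y"
    proof (rule Ck_on_cong[OF Y(1), rotated])
      fix y assume "y \<in> Y"
      then show "transition d d2 (family_rep F c d (?t y)) = family_rep F c2 d2 y"
        using F_eq F_in transition_chart[OF d] by (simp add: family_rep_def)
    qed
    then show "\<exists>T. open T \<and> z \<in> T \<and> Ck_on k (family_rep F c2 d2) T" using Y by blast
  qed
  then have "Ck_on k (snd d2 \<circ> ?F \<circ> chart_inv c') (family_dom \<epsilon> F c2 d2)" for k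
    unfolding c' by (rule Ck_on_cong[OF o, rotated]) (rule family_rep_product_chart[OF c2, symmetric])
  then show "smooth_on (snd d2 \<circ> ?F \<circ> chart_inv c') (snd c' ` (fst c' \<inter> (UNIV \<times> ball 0 \<epsilon>) \<inter> ?F -` fst d2))"
    unfolding smooth_on_def c' fst_conv snd_conv family_dom_product_chart[OF c2] by blast
qed

lemma smooth_family_id: "smooth_family \<epsilon> (\<lambda>\<tau>::'p::euclidean_space. id)"
proof (rule smooth_familyI)
  fix p :: 'a and \<tau> :: 'p assume \<tau>: "\<tau> \<in> ball 0 \<epsilon>"
  note c = chart_at[of p]
  let ?c = "chart_at A p"
  let ?W = "snd ?c ` fst ?c \<times> ball (0 :: 'p) \<epsilon>"
  have o: "open ?W" using open_chart_image[OF c(1)] by (simp add: open_Times)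
  have "Ck_on k (family_rep (\<lambda>\<tau>. id) ?c ?c) ?W" for k
    by (rule Ck_on_cong[OF o _ Ck_on_linear[OF bounded_linear_fst]]) (use c in \<open>auto simp: family_rep_def chart_inv_chart\<close>)
  moreover have "?W \<subseteq> family_dom \<epsilon> (\<lambda>\<tau>. id) ?c ?c" using c by (auto simp: family_dom_def chart_inv_chart)
  ultimately show "\<exists>c\<in>A. \<exists>d\<in>A. p \<in> fst c \<and> (\<exists>W. open W \<and> (snd c p, \<tau>) \<in> W \<and> W \<subseteq> family_dom \<epsilon> (\<lambda>\<tau>. id) c d \<and>
    (\<forall>k. Ck_on k (family_rep (\<lambda>\<tau>. id) c d) W))"
    using c o \<tau> by (intro bexI[of _ ?c] conjI exI[of _ ?W]) auto
qed

lemma smooth_family_comp: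
  fixes F G :: "'p::euclidean_space \<Rightarrow> 'a \<Rightarrow> 'a"
  assumes F: "smooth_family \<epsilon> F" and G: "smooth_family \<epsilon> G"
  shows "smooth_family \<epsilon> (\<lambda>\<tau>. F \<tau> \<circ> G \<tau>)"
proof (rule smooth_familyI)
  fix p :: 'a and \<tau> :: 'p assume \<tau>: "\<tau> \<in> ball 0 \<epsilon>"
  define c d e where "c = chart_at A p" and "d = chart_at A (G \<tau> p)" and "e = chart_at A (F \<tau> (G \<tau> p))"
  have c: "c \<in> A" "p \<in> fst c" and d: "d \<in> A" "G \<tau> p \<in> fst d" and e: "e \<in> A" "F \<tau> (G \<tau> p) \<in> fst e"
    using chart_at by (auto simp: c_def d_def e_def)
  let ?h = "\<lambda>z. (family_rep G c d z, snd z)"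
  note oG = open_family_dom[OF smooth_family_continuous[OF G] c(1) d(1)]
  have h: "Ck_on k ?h (family_dom \<epsilon> G c d)" for k
    by (intro Ck_on_Pair oG Ck_on_family_rep G c d Ck_on_linear bounded_linear_snd)
  define W where "W = family_dom \<epsilon> G c d \<inter> ?h -` family_dom \<epsilon> F d e"
  have oW: "open W" unfolding W_def
    by (intro continuous_open_preimage[OF Ck_on_imp_continuous_on[OF h[of 0]]] oG open_family_dom[OF smooth_family_continuous[OF F]] d e)
  have G_inv: "chart_inv d (family_rep G c d z) = G (snd z) (chart_inv c (fst z))" if "z \<in> family_dom \<epsilon> G c d" for z
    using that d by (simp add: family_dom_def family_rep_def chart_inv_chart)
  have "Ck_on k (\<lambda>z. family_rep F d e (?h z)) W" for k
    by (rule Ck_on_compose[OF oW Ck_on_subset[OF h] Ck_on_family_rep[OF F d(1) e(1)]]) (auto simp: W_def)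
  then have "Ck_on k (family_rep (\<lambda>\<tau>. F \<tau> \<circ> G \<tau>) c e) W" for k
    by (rule Ck_on_cong[OF oW, rotated]) (use G_inv in \<open>auto simp: W_def family_rep_def\<close>)
  moreover have "W \<subseteq> family_dom \<epsilon> (\<lambda>\<tau>. F \<tau> \<circ> G \<tau>) c e"
  proof
    fix z assume "z \<in> W"
    then have z: "z \<in> family_dom \<epsilon> G c d" "?h z \<in> family_dom \<epsilon> F d e" by (auto simp: W_def)
    then show "z \<in> family_dom \<epsilon> (\<lambda>\<tau>. F \<tau> \<circ> G \<tau>) c e" using G_inv[OF z(1)] by (simp add: family_dom_def)
  qed
  moreover have "(snd c p, \<tau>) \<in> W"
    using c d e \<tau> by (auto simp: W_def family_dom_def family_rep_def chart_inv_chart)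
  ultimately show "\<exists>c\<in>A. \<exists>d\<in>A. p \<in> fst c \<and> (\<exists>W. open W \<and> (snd c p, \<tau>) \<in> W \<and> W \<subseteq> family_dom \<epsilon> (\<lambda>\<tau>. F \<tau> \<circ> G \<tau>) c d \<and>
    (\<forall>k. Ck_on k (family_rep (\<lambda>\<tau>. F \<tau> \<circ> G \<tau>) c d) W))"
    using c e oW by blast
qed

text \<open>Used both to shrink the parameter ball and to pass from one parameter to the sum of
  two.\<close>

lemma smooth_family_reparametrize:
  fixes F :: "'q::euclidean_space \<Rightarrow> 'a \<Rightarrow> 'a" and l :: "'p::euclidean_space \<Rightarrow> 'q"
  assumes F: "smooth_family \<epsilon> F" and l: "bounded_linear l" "\<And>\<tau>. \<tau> \<in> ball 0 \<delta> \<Longrightarrow> l \<tau> \<in> ball 0 \<epsilon>"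
  shows "smooth_family \<delta> (\<lambda>\<tau>. F (l \<tau>))"
proof (rule smooth_familyI)
  fix p :: 'a and \<tau> :: 'p assume \<tau>: "\<tau> \<in> ball 0 \<delta>"
  define c d where "c = chart_at A p" and "d = chart_at A (F (l \<tau>) p)"
  have c: "c \<in> A" "p \<in> fst c" and d: "d \<in> A" "F (l \<tau>) p \<in> fst d" using chart_at by (auto simp: c_def d_def)
  let ?h = "\<lambda>z. (fst z, l (snd z))"
  have bl: "bounded_linear ?h"
    by (intro bounded_linear_Pair bounded_linear_fst bounded_linear_compose[OF l(1) bounded_linear_snd])
  define W where "W = (UNIV \<times> ball 0 \<delta>) \<inter> ?h -` family_dom \<epsilon> F c d"
  have oW: "open W" unfolding W_def
    by (intro open_Int open_Times open_UNIV open_ball open_vimage bounded_linear.continuous_on[OF bl] continuous_on_id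
        open_family_dom[OF smooth_family_continuous[OF F]] c d)
  have "Ck_on k (\<lambda>z. family_rep F c d (?h z)) W" for k
    by (rule Ck_on_compose[OF oW Ck_on_linear[OF bl] Ck_on_family_rep[OF F c(1) d(1)]]) (auto simp: W_def)
  then have "Ck_on k (family_rep (\<lambda>\<tau>. F (l \<tau>)) c d) W" for k by (simp add: family_rep_def[abs_def])
  moreover have "W \<subseteq> family_dom \<delta> (\<lambda>\<tau>. F (l \<tau>)) c d" by (auto simp: W_def family_dom_def)
  moreover have "(snd c p, \<tau>) \<in> W" using c d \<tau> l(2) by (auto simp: W_def family_dom_def chart_inv_chart)
  ultimately show "\<exists>c\<in>A. \<exists>d\<in>A. p \<in> fst c \<and> (\<exists>W. open W \<and> (snd c p, \<tau>) \<in> W \<and> W \<subseteq> family_dom \<delta> (\<lambda>\<tau>. F (l \<tau>)) c d \<and>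
    (\<forall>k. Ck_on k (family_rep (\<lambda>\<tau>. F (l \<tau>)) c d) W))"
    using c d oW by blast
qed

lemma smooth_family_mono:
  fixes F :: "'p::euclidean_space \<Rightarrow> 'a \<Rightarrow> 'a"
  assumes "smooth_family \<epsilon> F" and "\<epsilon>' \<le> \<epsilon>"
  shows "smooth_family \<epsilon>' F"
  using smooth_family_reparametrize[OF assms(1) bounded_linear_ident, of \<epsilon>'] assms(2) by auto

end

section \<open>Bump functions on the manifold and a partition of unity\<close>

context atlas
begin

definition coordinate_bump :: "('a, 'e) chart \<Rightarrow> 'e \<Rightarrow> real \<Rightarrow> 'a \<Rightarrow> real" where
  "coordinate_bump c x0 r p = (if p \<in> fst c then bump x0 r (snd c p) else 0)"

lemma coordinate_bump_nonneg: "0 \<le> coordinate_bump c x0 r p"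
  by (simp add: coordinate_bump_def bump_nonneg)

lemma coordinate_bump_pos:
  assumes c: "c \<in> A" and r: "0 < r" and p: "p \<in> chart_inv c ` ball x0 r" and sub: "ball x0 r \<subseteq> snd c ` fst c"
  shows "0 < coordinate_bump c x0 r p"
proof -
  obtain x where x: "x \<in> ball x0 r" "p = chart_inv c x" using p by auto
  then have "x \<in> snd c ` fst c" using sub by auto
  then show ?thesis
    using x bump_pos_iff[OF r, of x0 x] by (simp add: coordinate_bump_def chart_chart_inv[OF c] chart_inv_in[OF c])
qed

lemma coordinate_bump_support:
  assumes c: "c \<in> A" and r: "0 < r" and "coordinate_bump c x0 r p \<noteq> 0"
  shows "p \<in> chart_inv c ` cball x0 r"
proof -
  have p: "p \<in> fst c" "bump x0 r (snd c p) \<noteq> 0" using assms(3) by (auto simp: coordinate_bump_def split: if_splits)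
  then have "snd c p \<in> ball x0 r" using bump_nonneg[of x0 r "snd c p"] bump_pos_iff[OF r, of x0 "snd c p"] by simp
  then have "snd c p \<in> cball x0 r" using ball_subset_cball by blast
  then show ?thesis using chart_inv_chart[OF c p(1)] by (metis imageI)
qed

lemma closed_coordinate_ball:
  assumes c: "c \<in> A" and sub: "cball x0 r \<subseteq> snd c ` fst c"
  shows "closed (chart_inv c ` cball x0 r)" "chart_inv c ` cball x0 r \<subseteq> fst c"
proof -
  have "compact (chart_inv c ` cball x0 r)"
    by (intro compact_continuous_image continuous_on_subset[OF continuous_on_chart_inv] c sub compact_cball)
  then show "closed (chart_inv c ` cball x0 r)" by (rule compact_imp_closed)
  show "chart_inv c ` cball x0 r \<subseteq> fst c" using sub chart_inv_in[OF c] by auto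
qed

text \<open>Extension by zero is smooth because the support lies in a compact, hence closed, subset
  of the chart domain: around a point outside that domain the function vanishes identically.\<close>

lemma Ck_on_coordinate_bump:
  assumes c: "c \<in> A" and r: "0 < r" and sub: "cball x0 r \<subseteq> snd c ` fst c" and d: "d \<in> A"
  shows "Ck_on k (\<lambda>y. coordinate_bump c x0 r (chart_inv d y)) (snd d ` fst d)"
proof (rule Ck_on_locally)
  fix y assume y: "y \<in> snd d ` fst d"
  let ?f = "\<lambda>y. coordinate_bump c x0 r (chart_inv d y)"
  note K = closed_coordinate_ball[OF c sub]
  show "\<exists>T. open T \<and> y \<in> T \<and> Ck_on k ?f T"
  proof (cases "chart_inv d y \<in> fst c")
    case True
    let ?T = "snd d ` (fst d \<inter> fst c)"
    have o: "open ?T" by (rule open_overlap[OF d c])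
    have "Ck_on k (\<lambda>y. bump x0 r (transition d c y)) ?T"
      by (rule Ck_on_compose[OF o Ck_on_transition[OF d c] Ck_on_bump]) simp
    then have "Ck_on k ?f ?T"
      by (rule Ck_on_cong[OF o, rotated]) (use d in \<open>auto simp: coordinate_bump_def transition_def chart_inv_chart\<close>)
    moreover have "y \<in> ?T" using True y d chart_chart_inv[OF d y] chart_inv_in[OF d y] by (metis IntI imageI)
    ultimately show ?thesis using o by blast
  next
    case False
    let ?T = "snd d ` (fst d - chart_inv c ` cball x0 r)"
    have o: "open ?T" using K(1) open_chart_domain[OF d] by (intro open_chart_image_subset d) auto
    have "Ck_on k ?f ?T"
    proof (rule Ck_on_cong[OF o _ Ck_on_const[of k 0]])
      fix z assume "z \<in> ?T"
      then have "chart_inv d z \<notin> chart_inv c ` cball x0 r" using d by (auto simp: chart_inv_chart)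
      then show "0 = ?f z" using coordinate_bump_support[OF c r] by metis
    qed
    moreover have "y \<in> ?T" using False y d K(2) chart_chart_inv[OF d y] chart_inv_in[OF d y] by (metis DiffI imageI subsetD)
    ultimately show ?thesis using o by blast
  qed
qed

end

context compact_atlas
begin

lemma partition_of_unity:
  obtains n :: nat and c x r \<rho> where
    "\<And>i. i < n \<Longrightarrow> c i \<in> A" "\<And>i. i < n \<Longrightarrow> 0 < r i"
    "\<And>i. i < n \<Longrightarrow> cball (x i) (3 * r i) \<subseteq> snd (c i) ` fst (c i)"
    "\<And>i d k. i < n \<Longrightarrow> d \<in> A \<Longrightarrow> Ck_on k (\<lambda>y. \<rho> i (chart_inv d y) :: real) (snd d ` fst d)"
    "\<And>i p. i < n \<Longrightarrow> \<rho> i p \<noteq> 0 \<Longrightarrow> p \<in> chart_inv (c i) ` cball (x i) (r i)"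
    "\<And>p. (\<Sum>i<n. \<rho> i p) = 1"
proof -
  obtain n :: nat and c x r D where c: "\<And>i. i < n \<Longrightarrow> c i \<in> A" and r: "\<And>i. i < n \<Longrightarrow> 0 < r i"
    and ball: "\<And>i. i < n \<Longrightarrow> cball (x i) (3 * r i) \<subseteq> snd (c i) ` fst (c i)"
    and cov: "(\<Union>i<n. chart_inv (c i) ` ball (x i) (r i)) = UNIV"
    by (rule coordinate_cover) blast
  define b where "b i = coordinate_bump (c i) (x i) (r i)" for i
  define B where "B p = (\<Sum>i<n. b i p)" for p
  have sub: "cball (x i) (r i) \<subseteq> snd (c i) ` fst (c i)" "ball (x i) (r i) \<subseteq> snd (c i) ` fst (c i)" if "i < n" for i
    using ball[OF that] r[OF that] by (auto simp: subset_iff)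
  have B: "0 < B p" for p
  proof -
    obtain i where i: "i < n" "p \<in> chart_inv (c i) ` ball (x i) (r i)" using cov by blast
    then have "0 < b i p" unfolding b_def by (intro coordinate_bump_pos c r sub)
    then show ?thesis unfolding B_def using i coordinate_bump_nonneg by (intro sum_pos2[of _ i]) (auto simp: b_def)
  qed
  have b: "Ck_on k (\<lambda>y. b i (chart_inv d y)) (snd d ` fst d)" if "i < n" "d \<in> A" for i d k
    unfolding b_def using that by (intro Ck_on_coordinate_bump c r sub)
  \<comment> \<open>The reciprocal is written with \<open>powr\<close> so that
    \<open>Ck_on_powr\<close> applies.\<close>
  define \<rho> where "\<rho> i p = b i p * B p powr (-1)" for i p
  have 1: "Ck_on k (\<lambda>y. \<rho> i (chart_inv d y)) (snd d ` fst d)" if "i < n" "d \<in> A" for i d k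
    using that B unfolding \<rho>_def B_def by (intro Ck_on_mult Ck_on_powr Ck_on_sum b open_chart_image) auto
  have 2: "p \<in> chart_inv (c i) ` cball (x i) (r i)" if "i < n" "\<rho> i p \<noteq> 0" for i p
    using that unfolding \<rho>_def b_def by (intro coordinate_bump_support c r) auto
  have 3: "(\<Sum>i<n. \<rho> i p) = 1" for p
    using B[of p] by (simp add: \<rho>_def sum_distrib_right[symmetric] B_def[symmetric] powr_minus)
  show thesis by (rule that[OF c r ball 1 2 3])
qed

end

section \<open>Construction of a variation with prescribed velocity\<close>

context compact_riemannian
begin

lemma variation_id: "variation A g (\<lambda>\<tau>::'p::euclidean_space. id) 1"
  by unfold_locales (auto simp: smooth_family_id)

text \<open>At parameter 0 the differential of \<open>F 0 = id\<close> is the identity, so the chain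
  rule adds the velocity of \<open>G\<close>, unchanged, to that of \<open>F\<close>.\<close>

lemma variation_comp:
  fixes F G :: "real \<Rightarrow> 'a \<Rightarrow> 'a"
  assumes F: "variation A g F \<epsilon>" "variation_field A F v" and G: "variation A g G \<epsilon>'" "variation_field A G w"
  shows "variation A g (\<lambda>t. F t \<circ> G t) (min \<epsilon> \<epsilon>')" "variation_field A (\<lambda>t. F t \<circ> G t) (\<lambda>d p. v d p + w d p)"
proof -
  interpret F: variation A g F \<epsilon> by fact
  interpret G: variation A g G \<epsilon>' by fact
  have "smooth_family (min \<epsilon> \<epsilon>') (\<lambda>t. F t \<circ> G t)"
    by (intro smooth_family_comp smooth_family_mono[OF F.smooth_\<Psi>] smooth_family_mono[OF G.smooth_\<Psi>]) auto
  then show "variation A g (\<lambda>t. F t \<circ> G t) (min \<epsilon> \<epsilon>')"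
    by unfold_locales (auto simp: F.\<Psi>_0 G.\<Psi>_0 F.\<epsilon> G.\<epsilon>)
  show "variation_field A (\<lambda>t. F t \<circ> G t) (\<lambda>d p. v d p + w d p)"
    unfolding variation_field_def
  proof (intro ballI allI impI)
    fix d p assume d: "d \<in> A" and "(F 0 \<circ> G 0) p \<in> fst d"
    then have p: "p \<in> fst d" by (simp add: F.\<Psi>_0 G.\<Psi>_0)
    then have x: "snd d p \<in> snd d ` fst d" by simp
    let ?z = "(snd d p, 0::real)"
    have z: "?z \<in> F.dom d" by (rule F.dom_0[OF d x])
    have "((\<lambda>t. snd d (G t p)) has_vector_derivative w d p) (at 0)"
      using G(2) d p by (simp add: variation_field_def G.\<Psi>_0)
    then have "((\<lambda>t. (snd d (G t p), t)) has_derivative (\<lambda>h. (h *\<^sub>R w d p, h))) (at 0)"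
      unfolding has_vector_derivative_def by (intro has_derivative_Pair has_derivative_ident)
    moreover have "(F.rep d has_derivative (\<lambda>u. dir_deriv (F.rep d) u ?z)) (at (snd d (G 0 p), 0))"
      using F.has_derivative_rep[OF d z] by (simp add: G.\<Psi>_0)
    ultimately have "((\<lambda>t. F.rep d (snd d (G t p), t)) has_derivative (\<lambda>h. dir_deriv (F.rep d) (h *\<^sub>R w d p, h) ?z)) (at 0)"
      by (rule has_derivative_compose)
    moreover have "dir_deriv (F.rep d) (h *\<^sub>R w d p, h) ?z = h *\<^sub>R (v d p + w d p)" for h
    proof -
      have lin: "linear (\<lambda>u. dir_deriv (F.rep d) u ?z)" by (rule has_derivative_linear[OF F.has_derivative_rep[OF d z]])
      have "dir_deriv (F.rep d) (w d p, 0) ?z = w d p"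
        using F.differential_mult[OF d z, of "w d p"] by (simp add: F.differential_0[OF d x])
      moreover have "dir_deriv (F.rep d) (0, 1) ?z = v d p"
        using F.velocity_eq[OF d p, of 1 v] F(2) by (simp add: F.velocity_def)
      ultimately have "dir_deriv (F.rep d) ((w d p, 0) + (0, 1)) ?z = w d p + v d p"
        using linear_add[OF lin, of "(w d p, 0)" "(0, 1)"] by simp
      then show ?thesis using linear_scale[OF lin, of h "(w d p, 1)"] by (simp add: add.commute)
    qed
    ultimately have "((\<lambda>t. F.rep d (snd d (G t p), t)) has_vector_derivative v d p + w d p) (at 0)"
      by (simp add: has_vector_derivative_def)
    then show "((\<lambda>t. snd d ((F t \<circ> G t) p)) has_vector_derivative v d p + w d p) (at 0)"
    proof (rule has_vector_derivative_transform_within_open[OF _ G.slice(1,2)[OF d p]])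
      fix t assume "t \<in> G.slice d p"
      then have "G t p \<in> fst d" by (simp add: G.slice_def family_dom_def chart_inv_chart[OF d p])
      then show "F.rep d (snd d (G t p), t) = snd d ((F t \<circ> G t) p)"
        by (simp add: family_rep_def chart_inv_chart[OF d])
    qed
  qed
qed

text \<open>In the chart \<open>c\<close> points move along straight lines with velocity
  \<open>u\<close>, the coordinate form of the field cut off by \<open>\<rho>\<close>. Off the
  support nothing moves, so the map extends by the identity.\<close>

lemma variation_cutoff:
  assumes V: "vector_field A V" and c: "c \<in> A" and r: "0 < r" and ball: "cball x0 (3 * r) \<subseteq> snd c ` fst c"
    and \<rho>: "\<And>k. Ck_on k (\<lambda>x. \<rho> (chart_inv c x)) (snd c ` fst c)"
    and supp: "\<And>p. \<rho> p \<noteq> 0 \<Longrightarrow> p \<in> chart_inv c ` cball x0 r"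
  obtains F \<epsilon> where "variation A g F \<epsilon>" "variation_field A F (\<lambda>d p. \<rho> p *\<^sub>R V d p)"
proof -
  have sub: "cball x0 r \<subseteq> snd c ` fst c" using ball r by (auto simp: subset_iff)
  note K = closed_coordinate_ball[OF c sub]
  define u where "u x = \<rho> (chart_inv c x) *\<^sub>R V c (chart_inv c x)" for x
  have "smooth_on (V c \<circ> chart_inv c) (snd c ` (fst c \<inter> id -` fst c))"
    using V c unfolding vector_field_along_def by blast
  then have Vc: "Ck_on k (\<lambda>x. V c (chart_inv c x)) (snd c ` fst c)" for k by (simp add: smooth_on_def o_def)
  note oc = open_chart_image[OF c]
  have u: "Ck_on k u (snd c ` fst c)" for k
    unfolding u_def[abs_def] by (intro Ck_on_scaleR oc \<rho> Vc)
  have "compact (u ` cball x0 r)"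
    by (intro compact_continuous_image continuous_on_subset[OF Ck_on_imp_continuous_on[OF u]] sub compact_cball)
  then obtain M where M: "\<And>x. x \<in> cball x0 r \<Longrightarrow> norm (u x) \<le> M"
    by (metis bounded_iff compact_imp_bounded imageI)
  \<comment> \<open>For \<open>\<bar>t\<bar> < \<epsilon>\<close> points of the ball of radius
    \<open>r\<close> move by at most \<open>r\<close> and so remain in the chart image; the summand
    1 avoids division by zero.\<close>
  define \<epsilon> where "\<epsilon> = r / (\<bar>M\<bar> + 1)"
  have \<epsilon>: "0 < \<epsilon>" using r by (simp add: \<epsilon>_def)
  have u0: "u x = 0" if "x \<in> snd c ` fst c" "x \<notin> cball x0 r" for x
  proof (rule ccontr)
    assume "u x \<noteq> 0"
    then have "chart_inv c x \<in> chart_inv c ` cball x0 r" using supp by (simp add: u_def)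
    then obtain y where y: "y \<in> cball x0 r" "chart_inv c x = chart_inv c y" by auto
    then have "x = y" using chart_chart_inv[OF c that(1)] chart_chart_inv[OF c, of y] sub by auto
    then show False using y that by simp
  qed
  define h where "h t x = x + t *\<^sub>R u x" for t x
  have h_in: "h t x \<in> snd c ` fst c" if x: "x \<in> snd c ` fst c" and t: "\<bar>t\<bar> < \<epsilon>" for t x
  proof (cases "x \<in> cball x0 r")
    case True
    have "norm (t *\<^sub>R u x) \<le> \<epsilon> * (\<bar>M\<bar> + 1)"
      using t M[OF True] by (auto intro!: mult_mono)
    also have "\<dots> = r" by (simp add: \<epsilon>_def)
    finally have "norm (t *\<^sub>R u x) \<le> r" .
    moreover have "dist x0 (h t x) \<le> dist x0 x + norm (t *\<^sub>R u x)"
      using dist_triangle[of x0 "h t x" x] by (simp add: h_def dist_norm)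
    ultimately have "h t x \<in> cball x0 (3 * r)" using True r by simp
    then show ?thesis using ball by blast
  next
    case False
    then show ?thesis using u0[OF x False] x by (simp add: h_def)
  qed
  define F where "F t p = (if p \<in> fst c then chart_inv c (h t (snd c p)) else p)" for t p
  have F_id: "F t q = q" if "q \<notin> chart_inv c ` cball x0 r" for t q
  proof (cases "q \<in> fst c")
    case True
    then have "u (snd c q) = 0" using that supp[of q] by (auto simp: u_def chart_inv_chart[OF c])
    then show ?thesis using True by (simp add: F_def h_def chart_inv_chart[OF c])
  qed (simp add: F_def)
  have "smooth_family \<epsilon> F"
  proof (rule smooth_familyI)
    fix p and \<tau> :: real assume \<tau>: "\<tau> \<in> ball 0 \<epsilon>"
    show "\<exists>c\<in>A. \<exists>d\<in>A. p \<in> fst c \<and> (\<exists>W. open W \<and> (snd c p, \<tau>) \<in> W \<and> W \<subseteq> family_dom \<epsilon> F c d \<and>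
      (\<forall>k. Ck_on k (family_rep F c d) W))"
    proof (cases "p \<in> fst c")
      case True
      let ?W = "snd c ` fst c \<times> ball (0::real) \<epsilon>"
      have oW: "open ?W" using oc by (simp add: open_Times)
      have Ck: "Ck_on k (\<lambda>z. fst z + snd z *\<^sub>R u (fst z)) ?W" for k
        by (intro Ck_on_add Ck_on_scaleR oW Ck_on_linear bounded_linear_fst bounded_linear_snd
            Ck_on_compose[OF oW Ck_on_linear[OF bounded_linear_fst] u]) auto
      have eq: "fst z + snd z *\<^sub>R u (fst z) = family_rep F c c z" and dom: "z \<in> family_dom \<epsilon> F c c" if "z \<in> ?W" for z
      proof -
        have z: "fst z \<in> snd c ` fst c" "snd z \<in> ball 0 \<epsilon>" using that by auto
        note hz = h_in[OF z(1), of "snd z"]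
        have Fz: "F (snd z) (chart_inv c (fst z)) = chart_inv c (h (snd z) (fst z))"
          using chart_inv_in[OF c z(1)] by (simp add: F_def chart_chart_inv[OF c z(1)])
        then show "fst z + snd z *\<^sub>R u (fst z) = family_rep F c c z"
          using hz z(2) by (simp add: family_rep_def chart_chart_inv[OF c] h_def)
        show "z \<in> family_dom \<epsilon> F c c"
          using hz z Fz chart_inv_in[OF c] by (simp add: family_dom_def)
      qed
      have "Ck_on k (family_rep F c c) ?W" for k
        by (rule Ck_on_cong[OF oW eq Ck])
      moreover have "?W \<subseteq> family_dom \<epsilon> F c c" using dom by blast
      ultimately show ?thesis using c True oW \<tau> by (intro bexI[of _ c] conjI exI[of _ ?W]) auto
    next
      case False
      let ?d = "chart_at A p" and ?K = "chart_inv c ` cball x0 r"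
      note d = chart_at[of p]
      \<comment> \<open>Off the closed set \<open>?K\<close> each \<open>F t\<close> is the
        identity, so around a point outside the domain of \<open>c\<close> the family is constant in
        \<open>t\<close>.\<close>
      let ?W = "snd ?d ` (fst ?d - ?K) \<times> ball (0::real) \<epsilon>"
      have oW: "open ?W"
        using K(1) open_chart_domain[OF d(1)] by (intro open_Times open_chart_image_subset d open_ball) auto
      have *: "fst z = family_rep F ?d ?d z \<and> z \<in> family_dom \<epsilon> F ?d ?d" if "z \<in> ?W" for z
        using that F_id d by (auto simp: family_rep_def family_dom_def chart_inv_chart)
      have "Ck_on k (family_rep F ?d ?d) ?W" for k
        by (rule Ck_on_cong[OF oW _ Ck_on_linear[OF bounded_linear_fst]]) (use * in blast)
      moreover have "?W \<subseteq> family_dom \<epsilon> F ?d ?d" using * by blast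
      moreover have "(snd ?d p, \<tau>) \<in> ?W" using d False K(2) \<tau> by auto
      ultimately show ?thesis using d oW by blast
    qed
  qed
  moreover have "F 0 = id" by (auto simp: F_def h_def chart_inv_chart[OF c])
  ultimately have "variation A g F \<epsilon>" using \<epsilon> by unfold_locales
  moreover have "variation_field A F (\<lambda>d p. \<rho> p *\<^sub>R V d p)"
    unfolding variation_field_def
  proof (intro ballI allI impI)
    fix d p assume d: "d \<in> A" and "F 0 p \<in> fst d"
    then have p: "p \<in> fst d" using \<open>F 0 = id\<close> by simp
    show "((\<lambda>t. snd d (F t p)) has_vector_derivative \<rho> p *\<^sub>R V d p) (at 0)"
    proof (cases "p \<in> fst c")
      case True
      let ?D = "frechet_derivative (transition c d) (at (snd c p))"
      have tD: "(transition c d has_derivative ?D) (at (h 0 (snd c p)))"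
        using has_derivative_transition[OF c d, of p] True p by (simp add: h_def)
      have "((\<lambda>t. h t (snd c p)) has_derivative (\<lambda>s. 0 + s *\<^sub>R u (snd c p))) (at 0)"
        unfolding h_def by (intro has_derivative_add has_derivative_const has_derivative_scaleR_left has_derivative_ident)
      from has_derivative_compose[OF this tD]
      have "((\<lambda>t. transition c d (h t (snd c p))) has_derivative (\<lambda>s. ?D (s *\<^sub>R u (snd c p)))) (at 0)" by simp
      \<comment> \<open>The transformation law of \<open>V\<close> makes the velocity correct in
        every chart, though the motion was defined in \<open>c\<close>.\<close>
      moreover have "?D (s *\<^sub>R u (snd c p)) = s *\<^sub>R (\<rho> p *\<^sub>R V d p)" for s
      proof -
        have "id p \<in> fst c \<inter> fst d" using p True by simp
        then have "V d p = frechet_derivative (transition c d) (at (snd c (id p))) (V c p)"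
          using V c d unfolding vector_field_along_def by blast
        then have "V d p = ?D (V c p)" by simp
        then show ?thesis
          using linear_scale[OF has_derivative_linear[OF tD]] by (simp add: u_def chart_inv_chart[OF c True])
      qed
      moreover have "transition c d (h t (snd c p)) = snd d (F t p)" for t
        using True by (simp add: transition_def F_def)
      ultimately show ?thesis by (simp add: has_vector_derivative_def)
    next
      case False
      then have "\<rho> p = 0" using supp[of p] K(2) by auto
      then show ?thesis using False by (simp add: F_def)
    qed
  qed
  ultimately show thesis by (rule that)
qed

lemma variation_exists:
  assumes V: "vector_field A V"
  obtains F :: "real \<Rightarrow> 'a \<Rightarrow> 'a" and \<epsilon> where "variation A g F \<epsilon>" "variation_field A F V"
proof -
  obtain n :: nat and c x r \<rho> where c: "\<And>i. i < n \<Longrightarrow> c i \<in> A" and r: "\<And>i. i < n \<Longrightarrow> 0 < r i"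
    and ball: "\<And>i. i < n \<Longrightarrow> cball (x i) (3 * r i) \<subseteq> snd (c i) ` fst (c i)"
    and \<rho>: "\<And>i d k. i < n \<Longrightarrow> d \<in> A \<Longrightarrow> Ck_on k (\<lambda>y. \<rho> i (chart_inv d y) :: real) (snd d ` fst d)"
    and supp: "\<And>i p. i < n \<Longrightarrow> \<rho> i p \<noteq> 0 \<Longrightarrow> p \<in> chart_inv (c i) ` cball (x i) (r i)"
    and one: "\<And>p. (\<Sum>i<n. \<rho> i p) = 1"
    by (rule partition_of_unity) blast
  \<comment> \<open>The velocity grows by one summand of the partition of unity with each
    composition; for \<open>j = n\<close> the sum is 1 and the field is \<open>V\<close>.\<close>
  have "\<exists>(F :: real \<Rightarrow> 'a \<Rightarrow> 'a) \<epsilon>. variation A g F \<epsilon> \<and> variation_field A F (\<lambda>d p. (\<Sum>i<j. \<rho> i p) *\<^sub>R V d p)" if "j \<le> n" for j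
    using that
  proof (induction j)
    case 0
    have "variation_field A (\<lambda>t. id) (\<lambda>d p. (\<Sum>i<0::nat. \<rho> i p) *\<^sub>R V d p)" by (simp add: variation_field_def)
    then show ?case using variation_id by blast
  next
    case (Suc j)
    then obtain F :: "real \<Rightarrow> 'a \<Rightarrow> 'a" and \<epsilon> where F: "variation A g F \<epsilon>" "variation_field A F (\<lambda>d p. (\<Sum>i<j. \<rho> i p) *\<^sub>R V d p)"
      by auto
    have j: "j < n" using Suc by simp
    obtain G \<epsilon>' where G: "variation A g G \<epsilon>'" "variation_field A G (\<lambda>d p. \<rho> j p *\<^sub>R V d p)"
      by (rule variation_cutoff[OF V c[OF j] r[OF j] ball[OF j] \<rho>[OF j c[OF j]] supp[OF j]]) auto
    have "variation_field A (\<lambda>t. F t \<circ> G t) (\<lambda>d p. (\<Sum>i<Suc j. \<rho> i p) *\<^sub>R V d p)"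
      using variation_comp(2)[OF F G] by (simp add: scaleR_left_distrib)
    then show ?case using variation_comp(1)[OF F G] by blast
  qed
  from this[OF order_refl] show thesis using that by (auto simp: one)
qed

section \<open>Stability\<close>

text \<open>Every admissible variation yields the same integral by
  \<open>second_derivative_variation\<close>; to evaluate the definite description it remains to
  exhibit one.\<close>

lemma second_variation_eq:
  assumes V: "vector_field A V"
  shows "second_variation \<alpha> A g A g id V V = (\<integral>p. hessian_density \<alpha> V (chart_at A p) p \<partial>vol)"
    "continuous_on UNIV (\<lambda>p. hessian_density \<alpha> V (chart_at A p) p)"
    "integrable vol (\<lambda>p. hessian_density \<alpha> V (chart_at A p) p)"
    "\<And>c p. c \<in> A \<Longrightarrow> p \<in> fst c \<Longrightarrow> hessian_density \<alpha> V c p = hessian_density \<alpha> V (chart_at A p) p"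
proof -
  obtain F :: "real \<Rightarrow> 'a \<Rightarrow> 'a" and \<epsilon> where F: "variation A g F \<epsilon>" "variation_field A F V"
    using variation_exists[OF V] by blast
  interpret F: variation A g F \<epsilon> by fact
  \<comment> \<open>The sum of the parameters gives both partial velocities the same value
    \<open>V\<close>.\<close>
  define \<Psi> where "\<Psi> \<tau> = F (fst \<tau> + snd \<tau>)" for \<tau> :: "real \<times> real"
  \<comment> \<open>Half the radius, as the sum of two numbers below \<open>\<epsilon> / 2\<close>
    in absolute value is below \<open>\<epsilon>\<close>.\<close>
  have "smooth_family (\<epsilon> / 2) \<Psi>" unfolding \<Psi>_def[abs_def]
  proof (rule smooth_family_reparametrize[OF F.smooth_\<Psi>])
    show "bounded_linear (\<lambda>\<tau> :: real \<times> real. fst \<tau> + snd \<tau>)"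
      by (intro bounded_linear_add bounded_linear_fst bounded_linear_snd)
    show "fst \<tau> + snd \<tau> \<in> ball 0 \<epsilon>" if "\<tau> \<in> ball 0 (\<epsilon> / 2)" for \<tau> :: "real \<times> real"
      using that norm_fst_le[of "fst \<tau>" "snd \<tau>"] norm_snd_le[of "snd \<tau>" "fst \<tau>"] norm_triangle_ineq[of "fst \<tau>" "snd \<tau>"] by auto
  qed
  then have \<Psi>: "smooth_variation A A id \<Psi>"
    using F.\<epsilon> F.\<Psi>_0 unfolding smooth_variation_def smooth_family_def by (auto simp: \<Psi>_def intro!: exI[of _ "\<epsilon> / 2"])
  have fields: "variation_field A (\<lambda>t. \<Psi> (t, 0)) V" "variation_field A (\<lambda>s. \<Psi> (0, s)) V"
    using F(2) by (simp_all add: \<Psi>_def)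
  note sd = second_derivative_variation[OF \<Psi> fields]
  show "continuous_on UNIV (\<lambda>p. hessian_density \<alpha> V (chart_at A p) p)"
    "integrable vol (\<lambda>p. hessian_density \<alpha> V (chart_at A p) p)"
    "\<And>c p. c \<in> A \<Longrightarrow> p \<in> fst c \<Longrightarrow> hessian_density \<alpha> V c p = hessian_density \<alpha> V (chart_at A p) p"
    by (fact sd)+
  show "second_variation \<alpha> A g A g id V V = (\<integral>p. hessian_density \<alpha> V (chart_at A p) p \<partial>vol)"
    unfolding second_variation_def
  proof (rule the_equality)
    show "\<exists>\<Psi>. smooth_variation A A id \<Psi> \<and> variation_field A (\<lambda>t. \<Psi> (t, 0)) V \<and> variation_field A (\<lambda>s. \<Psi> (0, s)) V \<and>
      (\<integral>p. hessian_density \<alpha> V (chart_at A p) p \<partial>vol) = deriv (\<lambda>t. deriv (\<lambda>s. alpha_energy \<alpha> A g A g (\<Psi> (t, s))) 0) 0"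
      by (intro exI[of _ \<Psi>] conjI \<Psi> fields sd(1)[symmetric])
  qed (use second_derivative_variation(1) in auto)
qed

text \<open>The derivative of a function with symmetric values is symmetric, by uniqueness of
  derivatives, and the two remaining summands are transposes of each other.\<close>

lemma lie_derivative_metric_symmetric:
  assumes c: "c \<in> A" and p: "p \<in> fst c"
  shows "transpose (lie_derivative_metric g V c p) = lie_derivative_metric g V c p"
proof -
  let ?x = "snd c p" and ?G = "g c \<circ> chart_inv c"
  have x: "?x \<in> snd c ` fst c" using p by simp
  have G: "(?G has_derivative frechet_derivative ?G (at ?x)) (at ?x)"
    using Ck_on_SucD_derivative[OF Ck_on_metric[OF c] x] by (simp add: o_def)
  from bounded_linear.has_derivative[OF bounded_linear_transpose G]
  have "(?G has_derivative (\<lambda>v. transpose (frechet_derivative ?G (at ?x) v))) (at ?x)"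
    by (rule has_derivative_transform_within_open[OF _ open_chart_image[OF c] x])
      (use c in \<open>auto simp: chart_inv_chart metric_symmetric\<close>)
  then have "(\<lambda>v. transpose (frechet_derivative ?G (at ?x) v)) = frechet_derivative ?G (at ?x)"
    using G by (rule has_derivative_unique)
  then have "transpose (frechet_derivative ?G (at ?x) v) = frechet_derivative ?G (at ?x) v" for v by metis
  then show ?thesis
    by (simp add: lie_derivative_metric_def Let_def linear_add[OF bounded_linear.linear[OF bounded_linear_transpose]]
        matrix_transpose_mul metric_symmetric[OF c p] add_ac)
qed

lemma matrix_inv_metric:
  assumes c: "c \<in> A" and p: "p \<in> fst c"
  shows "transpose (matrix_inv (g c p)) = matrix_inv (g c p)" "v \<noteq> 0 \<Longrightarrow> 0 < v \<bullet> (matrix_inv (g c p) *v v)"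
proof -
  note inv = matrix_inv_mult[OF invertible_metric[OF c p]]
  have "transpose (matrix_inv (g c p)) ** g c p = transpose (g c p ** matrix_inv (g c p))"
    by (simp add: matrix_transpose_mul metric_symmetric[OF c p])
  then have "transpose (matrix_inv (g c p)) ** g c p = mat 1" by (simp add: inv transpose_mat)
  from matrix_inv_unique[OF this] show "transpose (matrix_inv (g c p)) = matrix_inv (g c p)" by simp
  assume "v \<noteq> 0"
  define w where "w = matrix_inv (g c p) *v v"
  have gw: "g c p *v w = v" by (simp add: w_def matrix_vector_mul_assoc inv)
  with \<open>v \<noteq> 0\<close> have "w \<noteq> 0" by auto
  then have "0 < w \<bullet> (g c p *v w)" by (rule metric_pos_def[OF c p])
  then show "0 < v \<bullet> (matrix_inv (g c p) *v v)" unfolding gw by (simp add: w_def inner_commute)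
qed

lemma hessian_density_nonneg:
  assumes c: "c \<in> A" and p: "p \<in> fst c" and \<alpha>: "0 < \<alpha>" "real CARD('m) + 3 \<le> 2 * \<alpha>"
  shows "0 \<le> hessian_density \<alpha> V c p"
proof -
  have "1 / 2 \<le> (\<alpha> - 1) / (1 + real CARD('m))" using \<alpha> by (simp add: field_simps)
  then show ?thesis
    unfolding hessian_density_def Let_def
    using trace_square_spd_nonneg[OF matrix_inv_metric[OF c p] lie_derivative_metric_symmetric[OF c p, of V]] \<alpha>(1)
    by (intro mult_nonneg_nonneg add_nonneg_nonneg) auto
qed

text \<open>At this exponent the coefficient of the squared trace is exactly 0, leaving a positive
  multiple of the squared norm of the Lie derivative.\<close>

lemma hessian_density_eq_0_iff:
  assumes c: "c \<in> A" and p: "p \<in> fst c" and \<alpha>: "\<alpha> = (real CARD('m) + 3) / 2"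
  shows "hessian_density \<alpha> V c p = 0 \<longleftrightarrow> lie_derivative_metric g V c p = 0"
proof -
  have coeff: "(\<alpha> - 1) / (1 + real CARD('m)) - 1 / 2 = 0" using \<alpha> by (simp add: field_simps)
  have "0 < \<alpha>" using \<alpha> by simp
  then have "hessian_density \<alpha> V c p = 0 \<longleftrightarrow>
      trace (matrix_inv (g c p) ** lie_derivative_metric g V c p ** (matrix_inv (g c p) ** lie_derivative_metric g V c p)) = 0"
    unfolding hessian_density_def Let_def coeff by simp
  then show ?thesis
    using trace_square_spd_eq_0[OF matrix_inv_metric[OF c p] lie_derivative_metric_symmetric[OF c p, of V]]
    by (auto simp: bounded_bilinear.zero_right[OF bounded_bilinear_matrix_matrix_mult] linear_0[OF bounded_linear.linear[OF bounded_linear_trace]])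
qed

lemma continuous_integral_eq_0:
  assumes f: "continuous_on UNIV f" "integrable vol f" "\<And>p. (0::real) \<le> f p" and "(\<integral>p. f p \<partial>vol) = 0"
  shows "f p = 0"
proof (rule ccontr)
  assume "f p \<noteq> 0"
  have o: "open (f -` (- {0}))" using f(1) by (intro open_vimage) auto
  have "AE p in vol. f p = 0"
    using integral_nonneg_eq_0_iff_AE[where f=f and M=vol] f assms(4) by simp
  then have "emeasure vol (f -` (- {0})) = 0"
    using o by (subst (asm) AE_iff_measurable[OF _ refl]) (auto simp: vimage_def)
  then show False using emeasure_vol_open_pos[OF o, of p] \<open>f p \<noteq> 0\<close> by simp
qed

theorem stable:
  assumes "0 < \<alpha>" "real CARD('m) + 3 \<le> 2 * \<alpha>"
  shows "alpha_stable \<alpha> A g"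
  unfolding alpha_stable_def alpha_stable_map_def
proof (intro conjI allI impI alpha_harmonic_id)
  fix \<omega> assume "vector_field_along A A id \<omega>"
  then show "0 \<le> second_variation \<alpha> A g A g id \<omega> \<omega>"
    using hessian_density_nonneg[OF chart_at assms] by (simp add: second_variation_eq(1))
qed

theorem killing_iff:
  assumes \<alpha>: "\<alpha> = (real CARD('m) + 3) / 2" and V: "vector_field A V"
  shows "killing A g V \<longleftrightarrow> second_variation \<alpha> A g A g id V V = 0"
proof
  assume "killing A g V"
  then have "hessian_density \<alpha> V (chart_at A p) p = 0" for p
    using hessian_density_eq_0_iff[OF chart_at \<alpha>] chart_at by (simp add: killing_def)
  then show "second_variation \<alpha> A g A g id V V = 0" by (simp add: second_variation_eq(1)[OF V])
next
  assume 0: "second_variation \<alpha> A g A g id V V = 0"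
  have nonneg: "0 \<le> hessian_density \<alpha> V (chart_at A p) p" for p
    using \<alpha> by (intro hessian_density_nonneg chart_at) auto
  have "hessian_density \<alpha> V (chart_at A p) p = 0" for p
    using continuous_integral_eq_0[OF second_variation_eq(2,3)[OF V] nonneg] 0 second_variation_eq(1)[OF V] by simp
  \<comment> \<open>The Killing condition concerns every chart of the atlas, while the integrand
    uses \<open>chart_at\<close> only; independence of the chart closes the gap.\<close>
  then have "hessian_density \<alpha> V c p = 0" if "c \<in> A" "p \<in> fst c" for c p
    by (simp only: second_variation_eq(4)[OF V that])
  then have "lie_derivative_metric g V c p = 0" if "c \<in> A" "p \<in> fst c" for c p
    using hessian_density_eq_0_iff[OF that \<alpha>, of V] that by blast
  then show "killing A g V" using V by (simp add: killing_def)
qed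

end

theorem proposition15:
  fixes A :: "('a::{t2_space, second_countable_topology}, real^'m) chart set"
    and g :: "('a, 'm) metric_components"
    and \<alpha> :: real
  assumes "riemannian_manifold A g"
    and "compact (UNIV :: 'a set)"
    and "orientable A"
    and "\<alpha> > 0"
    and "2 * \<alpha> \<ge> real CARD('m) + 3"
  shows "alpha_stable \<alpha> A g \<and>
    (\<alpha> = (real CARD('m) + 3) / 2 \<longrightarrow>
      (\<forall>V. vector_field A V \<longrightarrow>
        (killing A g V \<longleftrightarrow> second_variation \<alpha> A g A g id V V = 0)))"
proof -
  interpret compact_riemannian A g
    using assms(1,2) by unfold_locales (auto simp: riemannian_manifold_def)
  show ?thesis using stable[OF assms(4,5)] killing_iff by blast
qed

end
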